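(* Let $Z_0\in\mathbb{C}^{d\times r}$ be a fixed matrix and let $\{Y_1,\dots,Y_n\}\subset\mathbb{M}_d$ be an independent family of random matrices. Form the product $$Z_n=Y_nY_{n-1}\cdots Y_2Y_1Z_0\in\mathbb{C}^{d\times r}.$$ Let $2\le q\le p$ be real parameters and assume that $$\|\mathbb{E}Y_i\|\le m_i\quad\text{and}\quad\big(\mathbb{E}\|Y_i-\mathbb{E}Y_i\|^q\big)^{1/q}\le\sigma_im_i\quad\text{for } i=1,\dots,n.$$ Define $M=\prod_{i=1}^nm_i$ and $v=\sum_{i=1}^n\sigma_i^2$, and let $C_p=p-1$. Then $$|||Z_n|||_{p,q}\le e^{C_pv/2}\,\|Z_0\|_p\cdot M$$ and $$|||Z_n-\mathbb{E}Z_n|||_{p,q}\le\big(e^{C_pv}-1\big)^{1/2}\,\|Z_0\|_p\cdot M.$$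
   Context: $\mathbb{M}_d$ is the algebra of $d\times d$ complex matrices and $\|\cdot\|$ is the spectral norm ($\ell_2$ operator norm). For $p\ge1$, $\|\cdot\|_p$ is the Schatten $p$-norm, i.e. the $\ell_p$ norm of the singular values. For a random matrix $X$ and $p,q\ge1$, $|||X|||_{p,q}:=\big(\mathbb{E}\|X\|_p^q\big)^{1/q}$. *)

theory Defs
  imports "HOL-Probability.Probability" "HOL-Computational_Algebra.Polynomial"
begin

text \<open>
  A complex matrix with \<open>d\<close> rows and \<open>r\<close> columns is an element of \<^typ>\<open>complex ^ 'r ^ 'd\<close>.  The
  library's \<open>norm\<close> on this type is the Frobenius norm, not the spectral norm.
\<close>

definition conj_transpose :: "complex ^ 'c ^ 'r \<Rightarrow> complex ^ 'r ^ 'c" where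
  "conj_transpose A = (\<chi> i j. cnj (A $ j $ i))"

definition charpoly :: "'a::comm_ring_1 ^ 'n ^ 'n \<Rightarrow> 'a poly" where
  "charpoly A = det (\<chi> i j. (if i = j then [:0, 1:] else 0) - [:A $ i $ j:])"

text \<open>
  Square roots of the eigenvalues of \<open>A\<^sup>*A\<close>, with multiplicity.  These eigenvalues are
  nonnegative reals, so taking \<^const>\<open>Re\<close> only changes the type.  There are as many singular values
  as columns; other conventions differ by zeros, which do not affect the Schatten norms.
\<close>
definition singular_values :: "complex ^ 'c ^ 'r \<Rightarrow> real multiset" where
  "singular_values A = {# sqrt (Re z). z \<in># proots (charpoly (conj_transpose A ** A)) #}"

definition schatten_norm :: "real \<Rightarrow> complex ^ 'c ^ 'r \<Rightarrow> real" where
  "schatten_norm p A = (\<Sum>s\<in>#singular_values A. s powr p) powr (1 / p)"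

definition spectral_norm :: "complex ^ 'c ^ 'r \<Rightarrow> real" where
  "spectral_norm A = onorm (\<lambda>x. A *v x)"

text \<open>
  \<open>(E f\<^sup>q)\<^sup>1\<^sup>/\<^sup>q\<close> for a nonnegative random variable \<open>f\<close>, with value \<open>\<infinity>\<close> if the \<open>q\<close>-th moment is
  infinite, so that an upper bound by a real number includes finiteness of the moment.
\<close>
definition Lq_norm :: "'w measure \<Rightarrow> real \<Rightarrow> ('w \<Rightarrow> real) \<Rightarrow> ereal" where
  "Lq_norm P q f =
     (let I = (\<integral>\<^sup>+ \<omega>. ennreal (f \<omega> powr q) \<partial>P)
      in if I = \<infinity> then \<infinity> else ereal (enn2real I powr (1 / q)))"

definition mixed_norm ::
  "'w measure \<Rightarrow> real \<Rightarrow> real \<Rightarrow> ('w \<Rightarrow> complex ^ 'c ^ 'r) \<Rightarrow> ereal" where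
  "mixed_norm P p q X = Lq_norm P q (\<lambda>\<omega>. schatten_norm p (X \<omega>))"

text \<open>The product \<open>Y\<^sub>n \<cdots> Y\<^sub>1 Z\<^sub>0\<close>.\<close>
primrec mat_product ::
  "(nat \<Rightarrow> complex ^ 'd ^ 'd) \<Rightarrow> complex ^ 'r ^ 'd \<Rightarrow> nat \<Rightarrow> complex ^ 'r ^ 'd" where
  "mat_product Y Z0 0 = Z0"
| "mat_product Y Z0 (Suc n) = Y (Suc n) ** mat_product Y Z0 n"

end

theory Submission
  imports Defs
begin

text \<open>
  Write \<open>Z\<^sub>k = (E Y\<^sub>k) Z\<^sub>k\<^sub>-\<^sub>1 + (Y\<^sub>k - E Y\<^sub>k) Z\<^sub>k\<^sub>-\<^sub>1\<close>; given \<open>Z\<^sub>k\<^sub>-\<^sub>1\<close>, the second summand has mean zero.  Uniform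
  smoothness of the Schatten class with constant \<open>p - 1\<close> gives
  \<open>\<bar>\<bar>\<bar>U + V\<bar>\<bar>\<bar>\<^sup>2 \<le> \<bar>\<bar>\<bar>U\<bar>\<bar>\<bar>\<^sup>2 + (p - 1) \<bar>\<bar>\<bar>V\<bar>\<bar>\<bar>\<^sup>2\<close> for such sums, and both bounds follow by induction on \<open>k\<close>.

  Uniform smoothness is a two-point inequality for self-adjoint maps \<open>A \<plusminus> Y\<close> (dilate the matrices).
  It follows from a bound on the second differences of \<open>t \<mapsto> tr \<bar>A + t Y\<bar>\<^sup>p\<close>.  To obtain that
  bound without differentiating, write the Bregman divergence of \<open>tr \<bar>\<cdot>\<bar>\<^sup>p\<close> as a double sum over the
  eigenbases of both arguments, of scalar Bregman divergences.  The scalar second derivative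
  \<open>p (p - 1) \<bar>x\<bar>\<^sup>p\<^sup>-\<^sup>2\<close> is dominated using convexity if \<open>p \<ge> 3\<close> and operator concavity of \<open>x\<^sup>p\<^sup>-\<^sup>2\<close> if
  \<open>2 < p < 3\<close>, which reduces the double sum to the eigenbasis of \<open>Y\<close>, where Hoelder's inequality
  applies.
\<close>

section \<open>Inequalities for powers and sums\<close>

text \<open>The constant \<open>p - 1\<close> has to survive every reduction. Comparing
  \<open>U + V\<close> with \<open>U - V\<close> just once would double it. Instead the squared
  moment norm is followed along the whole line \<open>U + t V\<close>: it is midpoint concave up to
  a multiple of \<open>t\<^sup>2\<close> and minimal at \<open>t = 0\<close>, and repeated halving
  of the step recovers the sharp constant. In the Bregman double sum, the points between an
  eigenvalue of one map and an eigenvalue of the other are eigenvalues of neither. Only weights of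
  the form \<open>g u + h w\<close> can be summed over both bases, so the second derivative must be
  bounded by such a weight, or by a power of one. Taylor's formula weights the segment by the
  density \<open>2 * (1 - s)\<close>, whose mean \<open>1/3\<close> is the origin of the
  coefficients \<open>2/3\<close> and \<open>1/3\<close>. All analysis takes place for real-linear
  maps. Forgetting the complex structure and dilating each double every singular value, so each
  multiplies all norms by \<open>2 powr (1 / p)\<close>. The two-point inequality is homogeneous of
  degree 2 and these factors cancel.\<close>

lemma powr_mult_le_weighted_sum:
  fixes x y s :: real
  assumes "0 \<le> x" "0 \<le> y" "0 < s" "s < 1"
  shows "x powr s * y powr (1 - s) \<le> s * x + (1 - s) * y"
proof (cases "x = 0 \<or> y = 0")
  case True
  then show ?thesis using assms by auto
next
  case False
  then show ?thesis
    using Youngs_inequality_0[of s "1 - s" x y] assms by auto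
qed

text \<open>Young's inequality for \<open>x powr r\<close> and \<open>y powr r\<close> with weight
  \<open>1/r\<close>. This route includes the endpoint 0 without a derivative there.\<close>

lemma powr_ge_tangent:
  fixes x y r :: real
  assumes "0 \<le> x" "0 \<le> y" "1 \<le> r"
  shows "y powr r + r * y powr (r - 1) * (x - y) \<le> x powr r"
proof (cases "r = 1")
  case True
  then show ?thesis using assms by (cases "y = 0") auto
next
  case False
  then have r: "1 < r" using assms by auto
  have "(x powr r) powr (1/r) * (y powr r) powr (1 - 1/r) \<le> (1/r) * x powr r + (1 - 1/r) * y powr r"
    using r by (intro powr_mult_le_weighted_sum) auto
  moreover have "(x powr r) powr (1/r) = x" "(y powr r) powr (1 - 1/r) = y powr (r - 1)"
    using r assms by (simp_all add: powr_powr right_diff_distrib)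
  ultimately have "r * (x * y powr (r - 1)) \<le> r * ((1/r) * x powr r + (1 - 1/r) * y powr r)"
    using r by (intro mult_left_mono) auto
  also have "\<dots> = x powr r + (r - 1) * y powr r"
    using r by (simp add: field_simps)
  also have "y powr r = y * y powr (r - 1)"
    using assms r by (cases "y = 0") (auto simp: powr_mult_base)
  finally show ?thesis using \<open>y powr r = y * y powr (r - 1)\<close> by (simp add: algebra_simps)
qed

text \<open>Young's inequality for \<open>x\<close> and \<open>y\<close>, multiplied by
  \<open>y powr (s - 1)\<close>. The point of tangency must be positive: at \<open>y = 0\<close> the
  right side would be 0, since \<open>0 powr r = 0\<close>.\<close>

lemma powr_le_tangent:
  fixes x y s :: real
  assumes "0 \<le> x" "0 < y" "0 < s" "s \<le> 1"
  shows "x powr s \<le> y powr s + s * y powr (s - 1) * (x - y)"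
proof (cases "s = 1")
  case True
  then show ?thesis using assms by auto
next
  case False
  then have s: "s < 1" using assms by auto
  have "x powr s * y powr (1 - s) \<le> s * x + (1 - s) * y"
    using assms s by (intro powr_mult_le_weighted_sum) auto
  then have "x powr s * y powr (1 - s) * y powr (s - 1) \<le> (s * x + (1 - s) * y) * y powr (s - 1)"
    by (intro mult_right_mono) auto
  also have "x powr s * y powr (1 - s) * y powr (s - 1) = x powr s"
    using assms by (simp add: mult.assoc flip: powr_add)
  also have "y powr s = y * y powr (s - 1)"
    using assms by (auto simp: powr_mult_base)
  then have "(s * x + (1 - s) * y) * y powr (s - 1) = y powr s + s * y powr (s - 1) * (x - y)"
    by (simp add: algebra_simps)
  finally show ?thesis .
qed

text \<open>The tangent inequality at the weighted mean; the linear terms sum to zero.\<close>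

lemma powr_sum_Jensen:
  fixes w x :: "'i \<Rightarrow> real" and r :: real
  assumes "finite I" "\<And>i. i \<in> I \<Longrightarrow> 0 \<le> w i" "\<And>i. i \<in> I \<Longrightarrow> 0 \<le> x i" "sum w I = 1" "1 \<le> r"
  shows "(\<Sum>i\<in>I. w i * x i) powr r \<le> (\<Sum>i\<in>I. w i * x i powr r)"
proof -
  define y where "y = (\<Sum>i\<in>I. w i * x i)"
  have y: "0 \<le> y" unfolding y_def using assms by (intro sum_nonneg mult_nonneg_nonneg) auto
  have "y powr r = (\<Sum>i\<in>I. w i * (y powr r + r * y powr (r - 1) * (x i - y)))"
    using assms(4)
    by (simp add: algebra_simps sum.distrib sum_subtractf y_def[symmetric] flip: sum_distrib_left sum_distrib_right)
       (simp add: y_def sum_distrib_left sum_distrib_right algebra_simps)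
  also have "\<dots> \<le> (\<Sum>i\<in>I. w i * x i powr r)"
    using assms y by (intro sum_mono mult_left_mono powr_ge_tangent) auto
  finally show ?thesis unfolding y_def .
qed

lemma powr_add_Jensen:
  fixes a b \<alpha> \<beta> r :: real
  assumes "0 \<le> a" "0 \<le> b" "0 \<le> \<alpha>" "0 \<le> \<beta>" "\<alpha> + \<beta> = 1" "1 \<le> r"
  shows "(\<alpha> * a + \<beta> * b) powr r \<le> \<alpha> * a powr r + \<beta> * b powr r"
  using powr_sum_Jensen[of UNIV "\<lambda>i. if i then \<alpha> else \<beta>" "\<lambda>i. if i then a else b" r] assms
  by (simp add: UNIV_bool add.commute)

lemma Holder_sum:
  fixes x y :: "'i \<Rightarrow> real"
  assumes "finite I" "\<And>i. i \<in> I \<Longrightarrow> 0 \<le> x i" "\<And>i. i \<in> I \<Longrightarrow> 0 \<le> y i" "0 < s" "s < 1"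
  shows "(\<Sum>i\<in>I. x i powr s * y i powr (1 - s)) \<le> (\<Sum>i\<in>I. x i) powr s * (\<Sum>i\<in>I. y i) powr (1 - s)"
proof -
  define X Y where "X = (\<Sum>i\<in>I. x i)" and "Y = (\<Sum>i\<in>I. y i)"
  have "X \<ge> 0" "Y \<ge> 0" unfolding X_def Y_def using assms by (auto intro: sum_nonneg)
  show ?thesis
  proof (cases "X = 0 \<or> Y = 0")
    case True
    then have "\<forall>i\<in>I. x i = 0 \<or> y i = 0"
      using assms unfolding X_def Y_def by (auto simp: sum_nonneg_eq_0_iff)
    then have "(\<Sum>i\<in>I. x i powr s * y i powr (1 - s)) = 0"
      by (intro sum.neutral) auto
    then show ?thesis by simp
  next
    case False
    then have XY: "X > 0" "Y > 0" using \<open>X \<ge> 0\<close> \<open>Y \<ge> 0\<close> by auto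
    have "(\<Sum>i\<in>I. x i powr s * y i powr (1 - s))
        = X powr s * Y powr (1 - s) * (\<Sum>i\<in>I. (x i / X) powr s * (y i / Y) powr (1 - s))"
      using XY assms by (auto simp: sum_distrib_left powr_divide intro!: sum.cong)
    also have "\<dots> \<le> X powr s * Y powr (1 - s) * (\<Sum>i\<in>I. s * (x i / X) + (1 - s) * (y i / Y))"
      using XY assms by (intro mult_left_mono sum_mono powr_mult_le_weighted_sum) auto
    also have "(\<Sum>i\<in>I. s * (x i / X) + (1 - s) * (y i / Y)) = s * (X / X) + (1 - s) * (Y / Y)"
      by (simp only: sum.distrib sum_distrib_left[symmetric] sum_divide_distrib[symmetric] X_def Y_def)
    also have "\<dots> = 1" using XY by simp
    finally show ?thesis unfolding X_def Y_def by simp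
  qed
qed

text \<open>Summed or integrated with \<open>a\<close> and \<open>b\<close> the norms of \<open>x\<close> and \<open>y\<close>, this is Minkowski's inequality.\<close>
lemma powr_add_le_normalized:
  fixes a b x y r :: real
  assumes "0 \<le> x" "0 \<le> y" "0 < a" "0 < b" "1 \<le> r"
  shows "(x + y) powr r \<le> (a + b) powr (r - 1) * (x powr r / a powr (r - 1) + y powr r / b powr (r - 1))"
proof -
  define c where "c = a + b"
  have c: "c > 0" and c1: "a / c + b / c = 1"
    using assms unfolding c_def by (auto simp flip: add_divide_distrib)
  have "x + y = c * ((a / c) * (x / a) + (b / c) * (y / b))"
    using c assms by (simp add: field_simps)
  then have "(x + y) powr r = c powr r * ((a / c) * (x / a) + (b / c) * (y / b)) powr r"
    using c assms by (subst powr_mult[symmetric]) auto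
  also have "\<dots> \<le> c powr r * ((a / c) * (x / a) powr r + (b / c) * (y / b) powr r)"
    using assms c c1 by (intro mult_left_mono powr_add_Jensen) auto
  also have "\<dots> = c powr (r - 1) * (x powr r / a powr (r - 1) + y powr r / b powr (r - 1))"
    using assms c by (simp add: powr_divide powr_diff field_simps)
  finally show ?thesis unfolding c_def .
qed

lemma Minkowski_sum:
  fixes x y :: "'i \<Rightarrow> real"
  assumes "finite I" "\<And>i. i \<in> I \<Longrightarrow> 0 \<le> x i" "\<And>i. i \<in> I \<Longrightarrow> 0 \<le> y i" "1 \<le> r"
  shows "(\<Sum>i\<in>I. (x i + y i) powr r) powr (1 / r)
    \<le> (\<Sum>i\<in>I. x i powr r) powr (1 / r) + (\<Sum>i\<in>I. y i powr r) powr (1 / r)"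
proof -
  define A B where "A = (\<Sum>i\<in>I. x i powr r)" and "B = (\<Sum>i\<in>I. y i powr r)"
  define a b where "a = A powr (1 / r)" and "b = B powr (1 / r)"
  have AB: "A \<ge> 0" "B \<ge> 0" unfolding A_def B_def by (auto intro: sum_nonneg)
  have ar: "a powr r = A" "b powr r = B"
    using assms AB unfolding a_def b_def by (auto simp: powr_powr)
  consider "A = 0" | "B = 0" | "A > 0" "B > 0" using AB by fastforce
  then show ?thesis
  proof cases
    case 1
    then have "\<forall>i\<in>I. x i = 0" using assms unfolding A_def by (auto simp: sum_nonneg_eq_0_iff)
    then show ?thesis by simp
  next
    case 2
    then have "\<forall>i\<in>I. y i = 0" using assms unfolding B_def by (auto simp: sum_nonneg_eq_0_iff)
    then show ?thesis by simp
  next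
    case 3
    then have ab: "a > 0" "b > 0" unfolding a_def b_def by auto
    have "(\<Sum>i\<in>I. (x i + y i) powr r)
        \<le> (\<Sum>i\<in>I. (a + b) powr (r - 1) * (x i powr r / a powr (r - 1) + y i powr r / b powr (r - 1)))"
      using assms ab by (intro sum_mono powr_add_le_normalized) auto
    also have "\<dots> = (a + b) powr (r - 1) * (A / a powr (r - 1) + B / b powr (r - 1))"
      unfolding A_def B_def by (simp add: sum_distrib_left sum.distrib sum_divide_distrib distrib_left)
    also have "\<dots> = (a + b) powr r"
      using ab by (simp add: powr_diff flip: ar)
    finally have "(\<Sum>i\<in>I. (x i + y i) powr r) powr (1 / r) \<le> ((a + b) powr r) powr (1 / r)"
      using assms by (intro powr_mono2 sum_nonneg) auto
    also have "\<dots> = a + b" using ab assms by (simp add: powr_powr)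
    finally show ?thesis unfolding a_def b_def A_def B_def .
  qed
qed

section \<open>Orthonormal bases, singular values and Schatten norms of linear maps\<close>

definition onb :: "'a::euclidean_space set \<Rightarrow> bool" where
  "onb B \<longleftrightarrow> pairwise orthogonal B \<and> (\<forall>b\<in>B. norm b = 1) \<and> span B = UNIV"

lemma onb_inner:
  assumes "onb B" "b \<in> B" "c \<in> B"
  shows "b \<bullet> c = (if b = c then 1 else 0)"
proof (cases "b = c")
  case True
  then show ?thesis using assms by (auto simp: onb_def norm_eq_1)
next
  case False
  then show ?thesis using assms by (auto simp: onb_def pairwise_def orthogonal_def)
qed

lemma onb_independent: "onb B \<Longrightarrow> independent B"
  unfolding onb_def by (intro pairwise_orthogonal_independent) auto

lemma onb_finite: "onb B \<Longrightarrow> finite B"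
  using onb_independent independent_imp_finite by blast

lemma onb_card:
  fixes B :: "'a::euclidean_space set"
  assumes "onb B" shows "card B = DIM('a)"
proof -
  have "dim (UNIV :: 'a set) = card B"
    using assms onb_independent[OF assms] by (intro dim_unique[of B]) (auto simp: onb_def)
  then show ?thesis by simp
qed

lemma onb_expansion:
  assumes "onb B" shows "(\<Sum>b\<in>B. (x \<bullet> b) *\<^sub>R b) = x"
proof -
  have fin: "finite B" using assms by (rule onb_finite)
  have "x \<in> span B" using assms by (simp add: onb_def)
  then obtain c where c: "x = (\<Sum>b\<in>B. c b *\<^sub>R b)"
    using span_finite[OF fin] by auto
  have "x \<bullet> b = c b" if "b \<in> B" for b
  proof -
    have "x \<bullet> b = (\<Sum>a\<in>B. c a * (a \<bullet> b))" unfolding c by (simp add: inner_sum_left)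
    also have "\<dots> = (\<Sum>a\<in>B. if a = b then c a else 0)"
      using that by (intro sum.cong) (auto simp: onb_inner[OF assms])
    also have "\<dots> = c b" using that fin by simp
    finally show ?thesis .
  qed
  then show ?thesis using c by simp
qed

lemma onb_Parseval:
  assumes "onb B" shows "(\<Sum>b\<in>B. (x \<bullet> b) * (y \<bullet> b)) = x \<bullet> y"
proof -
  have "x \<bullet> y = x \<bullet> (\<Sum>b\<in>B. (y \<bullet> b) *\<^sub>R b)" by (simp add: onb_expansion[OF assms])
  also have "\<dots> = (\<Sum>b\<in>B. (x \<bullet> b) * (y \<bullet> b))" by (simp add: inner_sum_right mult.commute)
  finally show ?thesis by simp
qed

lemma onb_Parseval_norm:
  assumes "onb B" shows "(\<Sum>b\<in>B. (x \<bullet> b)\<^sup>2) = (norm x)\<^sup>2"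
  using onb_Parseval[OF assms, of x x] unfolding power2_norm_eq_inner by (simp add: power2_eq_square)

text \<open>A maximizer \<open>v\<close> of the Rayleigh quotient on the unit sphere of
  \<open>S\<close> is an eigenvector. The form \<open>Q\<close> is nonnegative on \<open>S\<close>
  and vanishes at \<open>v\<close>. Moving from \<open>v\<close> towards the residual
  \<open>w = T v - a v\<close> lowers \<open>Q\<close> to first order by
  \<open>2 * t * (w \<bullet> w)\<close>, so the residual is zero.\<close>

lemma self_adjoint_eigenvector_exists:
  fixes T :: "'a::euclidean_space \<Rightarrow> 'a"
  assumes lin: "linear T" and sa: "\<And>x y. T x \<bullet> y = x \<bullet> T y"
    and S: "subspace S" "S \<noteq> {0}" "\<And>x. x \<in> S \<Longrightarrow> T x \<in> S"
  obtains v a where "v \<in> S" "norm v = 1" "T v = a *\<^sub>R v"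
proof -
  interpret linear T by fact
  let ?K = "sphere 0 1 \<inter> S"
  obtain z where z: "z \<in> S" "z \<noteq> 0" using S subspace_0 by blast
  have "z /\<^sub>R norm z \<in> ?K" using z S by (auto simp: subspace_scale)
  moreover have "compact ?K"
    using closed_subspace[OF S(1)] by (simp add: compact_Int_closed)
  moreover have "continuous_on ?K (\<lambda>x. x \<bullet> T x)"
    using linear_continuous_on[OF lin[unfolded linear_conv_bounded_linear]]
    by (intro continuous_intros)
  ultimately obtain v where v: "v \<in> ?K" "\<And>y. y \<in> ?K \<Longrightarrow> y \<bullet> T y \<le> v \<bullet> T v"
    using continuous_attains_sup[of ?K "\<lambda>x. x \<bullet> T x"] by blast
  define a where "a = v \<bullet> T v"
  define w where "w = T v - a *\<^sub>R v"
  define Q where "Q x = a * (x \<bullet> x) - x \<bullet> T x" for x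
  have Qpos: "Q x \<ge> 0" if "x \<in> S" for x
  proof (cases "x = 0")
    case True then show ?thesis by (simp add: Q_def)
  next
    case False
    then have "x /\<^sub>R norm x \<in> ?K" using that S by (auto simp: subspace_scale)
    then have "(x /\<^sub>R norm x) \<bullet> T (x /\<^sub>R norm x) \<le> a" using v(2) a_def by blast
    then have "(x \<bullet> T x) / (norm x)\<^sup>2 \<le> a"
      by (simp add: scale power2_eq_square divide_inverse mult_ac)
    then show ?thesis using False by (simp add: Q_def field_simps power2_norm_eq_inner)
  qed
  have vS: "v \<in> S" "norm v = 1" using v by auto
  have wS: "w \<in> S" unfolding w_def using S vS by (intro subspace_diff subspace_scale) auto
  have wv: "w \<bullet> v = 0" unfolding w_def a_def
    using vS by (simp add: inner_diff_left norm_eq_1 sa)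
  have exp: "Q (v + t *\<^sub>R w) = t\<^sup>2 * Q w - 2 * t * (w \<bullet> w)" for t
  proof -
    have "Q (v + t *\<^sub>R w) = (a * (v \<bullet> v) - v \<bullet> T v) + t * (a * (v \<bullet> w) + a * (w \<bullet> v) - v \<bullet> T w - w \<bullet> T v) + t\<^sup>2 * Q w"
      unfolding Q_def by (simp add: add scale inner_add_left inner_add_right algebra_simps power2_eq_square)
    also have "a * (v \<bullet> v) - v \<bullet> T v = 0" using vS by (simp add: a_def norm_eq_1)
    also have "v \<bullet> T w = w \<bullet> T v" using sa[of v w] by (simp add: inner_commute)
    also have "w \<bullet> T v = w \<bullet> w" using wv by (simp add: w_def inner_diff_right inner_diff_left)
    finally show ?thesis using wv by (simp add: inner_commute)
  qed
  have "w \<bullet> w = 0"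
  proof (rule ccontr)
    assume "w \<bullet> w \<noteq> 0"
    then have ww: "w \<bullet> w > 0" by simp
    \<comment> \<open>A step small enough for the quadratic term \<open>t * Q w\<close> to stay
      below \<open>w \<bullet> w\<close>; the \<open>+ 1\<close> covers
      \<open>Q w = 0\<close>.\<close>
    define t where "t = (w \<bullet> w) / (Q w + 1)"
    have Qw: "Q w \<ge> 0" using Qpos wS by blast
    then have t: "t > 0" using ww unfolding t_def by simp
    have "0 \<le> Q (v + t *\<^sub>R w)" using S vS wS by (intro Qpos subspace_add subspace_scale) auto
    then have "2 * (w \<bullet> w) \<le> t * Q w" using t by (simp add: exp power2_eq_square)
    moreover have "t * Q w \<le> w \<bullet> w" using Qw ww unfolding t_def by (simp add: field_simps)
    ultimately show False using ww by simp
  qed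
  then have "T v = a *\<^sub>R v" by (simp add: w_def)
  then show ?thesis using that vS by blast
qed

text \<open>
  Both spectral theorems needed are instances: \<open>J = id\<close> gives the real one, while multiplication
  by \<open>\<i>\<close> gives the complex one, \<open>B\<close> then being a complex orthonormal basis.
\<close>
lemma self_adjoint_eigenbasis_subspace:
  fixes T J :: "'a::euclidean_space \<Rightarrow> 'a"
  assumes lin: "linear T" and sa: "\<And>x y. T x \<bullet> y = x \<bullet> T y"
    and J: "linear J" "\<And>x y. J x \<bullet> J y = x \<bullet> y" "\<And>x y. J x \<bullet> y = \<epsilon> * (x \<bullet> J y)"
    and TJ: "\<And>x. T (J x) = J (T x)"
    and J_cases: "(\<forall>x. J x = x) \<or> (\<forall>x. J x \<bullet> x = 0)"
    and S: "subspace S" "\<And>x. x \<in> S \<Longrightarrow> T x \<in> S" "\<And>x. x \<in> S \<Longrightarrow> J x \<in> S"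
  shows "\<exists>B. B \<subseteq> S \<and> (\<forall>b\<in>B. norm b = 1 \<and> (\<exists>a. T b = a *\<^sub>R b))
    \<and> (\<forall>b\<in>B. \<forall>c\<in>B. b \<noteq> c \<longrightarrow> b \<bullet> c = 0 \<and> b \<bullet> J c = 0) \<and> span (B \<union> J ` B) = S"
  using S
proof (induction "dim S" arbitrary: S rule: less_induct)
  case less
  show ?case
  proof (cases "S = {0}")
    case True
    then show ?thesis by (intro exI[of _ "{}"]) auto
  next
    case False
    then obtain v a where v: "v \<in> S" "norm v = 1" "T v = a *\<^sub>R v"
      using self_adjoint_eigenvector_exists[OF lin sa less.prems(1)] less.prems(2) by blast
    \<comment> \<open>The orthogonal complement of \<open>v\<close> and \<open>J v\<close> within
      \<open>S\<close>. It is invariant under \<open>T\<close> by self-adjointness and under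
      \<open>J\<close> by the two inner product rules for \<open>J\<close>.\<close>
    define S' where "S' = {x \<in> S. x \<bullet> v = 0 \<and> x \<bullet> J v = 0}"
    have sub: "subspace S'"
      using less.prems(1) unfolding S'_def subspace_def by (auto simp: inner_add_left)
    have "v \<notin> S'" using v by (auto simp: S'_def norm_eq_1)
    moreover have "S' \<subseteq> S" unfolding S'_def by auto
    ultimately have "S' \<subset> S" using v by auto
    then have "dim S' < dim S"
      using sub less.prems(1) by (metis dim_psubset span_eq_iff)
    moreover have "T x \<in> S'" if "x \<in> S'" for x
      using that less.prems(2)[of x] v unfolding S'_def
      by (auto simp: sa TJ linear_scale[OF J(1)])
    moreover have "J x \<in> S'" if "x \<in> S'" for x
    proof -
      have "J x \<bullet> v = \<epsilon> * (x \<bullet> J v)" "J x \<bullet> J v = x \<bullet> v" by (rule J)+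
      then show ?thesis using that less.prems(3)[of x] unfolding S'_def by auto
    qed
    ultimately obtain B where B: "B \<subseteq> S'" "\<And>b. b \<in> B \<Longrightarrow> norm b = 1 \<and> (\<exists>a. T b = a *\<^sub>R b)"
        "\<And>b c. b \<in> B \<Longrightarrow> c \<in> B \<Longrightarrow> b \<noteq> c \<Longrightarrow> b \<bullet> c = 0 \<and> b \<bullet> J c = 0" "span (B \<union> J ` B) = S'"
      using less.hyps[of S'] sub by metis
    define C where "C = insert v B"
    have Jv: "J v \<in> S" "norm (J v) = 1" using less.prems(3) v J(2)[of v v] by (auto simp: norm_eq_1)
    have BS: "B \<subseteq> S" using B(1) unfolding S'_def by auto
    have "span (C \<union> J ` C) = S"
    proof
      have "C \<union> J ` C \<subseteq> S" unfolding C_def using v Jv BS less.prems(3) by auto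
      then show "span (C \<union> J ` C) \<subseteq> S" using less.prems(1) by (simp add: span_minimal)
    next
      show "S \<subseteq> span (C \<union> J ` C)"
      proof
        fix x assume x: "x \<in> S"
        have C: "v \<in> span (C \<union> J ` C)" "J v \<in> span (C \<union> J ` C)"
          unfolding C_def by (auto intro: span_base)
        have "S' \<subseteq> span (C \<union> J ` C)"
          unfolding B(4)[symmetric] C_def by (intro span_mono) auto
        moreover have "x - (x \<bullet> v) *\<^sub>R v - (x \<bullet> J v) *\<^sub>R J v \<in> S'" if "\<forall>x. J x \<bullet> x = 0"
        proof -
          have "J v \<bullet> v = 0" "v \<bullet> J v = 0" using that by (metis inner_commute)+
          then show ?thesis unfolding S'_def
            using x v Jv less.prems(1) by (auto intro!: subspace_diff subspace_scale simp: inner_diff_left norm_eq_1)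
        qed
        moreover have "x - (x \<bullet> v) *\<^sub>R v \<in> S'" if "\<forall>x. J x = x"
          unfolding S'_def
          using that x v less.prems(1) by (auto intro!: subspace_diff subspace_scale simp: inner_diff_left norm_eq_1)
        \<comment> \<open>If \<open>J\<close> is the identity then \<open>J v = v\<close>, and
          subtracting both projections would remove \<open>v\<close> twice; hence two different
          decompositions.\<close>
        ultimately have "x - (x \<bullet> v) *\<^sub>R v - (x \<bullet> J v) *\<^sub>R J v \<in> span (C \<union> J ` C) 
            \<or> x - (x \<bullet> v) *\<^sub>R v \<in> span (C \<union> J ` C)"
          using J_cases by blast
        then show "x \<in> span (C \<union> J ` C)"
        proof
          assume "x - (x \<bullet> v) *\<^sub>R v - (x \<bullet> J v) *\<^sub>R J v \<in> span (C \<union> J ` C)"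
          from span_add[OF span_add[OF this span_scale[OF C(2), of "x \<bullet> J v"]] span_scale[OF C(1), of "x \<bullet> v"]]
          show ?thesis by simp
        next
          assume "x - (x \<bullet> v) *\<^sub>R v \<in> span (C \<union> J ` C)"
          from span_add[OF this span_scale[OF C(1), of "x \<bullet> v"]] show ?thesis by simp
        qed
      qed
    qed
    moreover have "v \<bullet> b = 0 \<and> v \<bullet> J b = 0 \<and> b \<bullet> v = 0 \<and> b \<bullet> J v = 0" if "b \<in> B" for b
    proof -
      have "b \<bullet> v = 0" "b \<bullet> J v = 0" using that B(1) S'_def by auto
      moreover have "v \<bullet> J b = \<epsilon> * (b \<bullet> J v)" by (metis J(3) inner_commute)
      ultimately show ?thesis by (simp add: inner_commute)
    qed
    ultimately show ?thesis
      using v B(2,3) BS by (intro exI[of _ C]) (auto simp: C_def)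
  qed
qed

lemma self_adjoint_eigenbasis:
  fixes T :: "'a::euclidean_space \<Rightarrow> 'a"
  assumes "linear T" "\<And>x y. T x \<bullet> y = x \<bullet> T y"
  obtains B where "onb B" "\<And>b. b \<in> B \<Longrightarrow> T b = (b \<bullet> T b) *\<^sub>R b"
proof -
  obtain B where B: "\<And>b. b \<in> B \<Longrightarrow> norm b = 1 \<and> (\<exists>a. T b = a *\<^sub>R b)"
    "\<And>b c. b \<in> B \<Longrightarrow> c \<in> B \<Longrightarrow> b \<noteq> c \<Longrightarrow> b \<bullet> c = 0" "span B = UNIV"
    using self_adjoint_eigenbasis_subspace[OF assms, of id 1 UNIV] by (auto simp: linear_id)
  then have "onb B" by (auto simp: onb_def pairwise_def orthogonal_def)
  moreover have "T b = (b \<bullet> T b) *\<^sub>R b" if "b \<in> B" for b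
    using B(1)[OF that] by (auto simp: norm_eq_1)
  ultimately show ?thesis using that by blast
qed

section \<open>Right singular vectors and the Schatten norm of a real-linear map\<close>

definition singular_basis :: "('a::euclidean_space \<Rightarrow> 'b::euclidean_space) \<Rightarrow> 'a set \<Rightarrow> bool" where
  "singular_basis X V \<longleftrightarrow> onb V \<and> pairwise (\<lambda>v w. X v \<bullet> X w = 0) V"

lemma singular_basis_exists:
  fixes X :: "'a::euclidean_space \<Rightarrow> 'b::euclidean_space"
  assumes "linear X" obtains V where "singular_basis X V"
proof -
  have adj: "X x \<bullet> y = x \<bullet> adjoint X y" for x y using adjoint_works[OF assms] by (simp add: inner_commute)
  have "linear (\<lambda>x. adjoint X (X x))"
    using linear_compose[OF assms adjoint_linear[OF assms]] by (simp add: o_def)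
  moreover have "adjoint X (X x) \<bullet> y = x \<bullet> adjoint X (X y)" for x y
    by (metis adj inner_commute)
  ultimately obtain V where V: "onb V" "\<And>b. b \<in> V \<Longrightarrow> adjoint X (X b) = (b \<bullet> adjoint X (X b)) *\<^sub>R b"
    using self_adjoint_eigenbasis by metis
  have "X v \<bullet> X w = 0" if "v \<in> V" "w \<in> V" "v \<noteq> w" for v w
  proof -
    have "X v \<bullet> X w = v \<bullet> ((w \<bullet> adjoint X (X w)) *\<^sub>R w)" by (metis adj V(2)[OF that(2)])
    then show ?thesis using onb_inner[OF V(1) that(1,2)] that(3) by simp
  qed
  then have "singular_basis X V" using V(1) by (auto simp: singular_basis_def pairwise_def)
  then show ?thesis using that by blast
qed

lemma singular_basis_norm:
  assumes "linear X" "singular_basis X V"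
  shows "(norm (X w))\<^sup>2 = (\<Sum>v\<in>V. (w \<bullet> v)\<^sup>2 * (norm (X v))\<^sup>2)"
proof -
  interpret linear X by fact
  have V: "onb V" "finite V" using assms(2) by (auto simp: singular_basis_def onb_finite)
  have "X w = (\<Sum>v\<in>V. (w \<bullet> v) *\<^sub>R X v)"
    using arg_cong[OF onb_expansion[OF V(1), of w], of X] by (simp add: sum scale)
  then have "(norm (X w))\<^sup>2 = (\<Sum>v\<in>V. \<Sum>u\<in>V. (w \<bullet> v) * (w \<bullet> u) * (X v \<bullet> X u))"
    unfolding power2_norm_eq_inner by (simp only: inner_sum_left inner_sum_right inner_scaleR_left inner_scaleR_right sum_distrib_left mult.assoc)
       (simp only: inner_commute)
  also have "\<dots> = (\<Sum>v\<in>V. \<Sum>u\<in>V. if u = v then (w \<bullet> v)\<^sup>2 * (norm (X v))\<^sup>2 else 0)"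
    using assms(2) by (intro sum.cong refl) 
      (auto simp: singular_basis_def pairwise_def power2_eq_square power2_norm_eq_inner[unfolded power2_eq_square])
  also have "\<dots> = (\<Sum>v\<in>V. (w \<bullet> v)\<^sup>2 * (norm (X v))\<^sup>2)" using V by simp
  finally show ?thesis .
qed

lemma onb_weight_sum:
  assumes "onb V" "onb W" "w \<in> W" shows "(\<Sum>v\<in>V. (w \<bullet> v)\<^sup>2) = 1"
  using onb_Parseval_norm[OF assms(1), of w] assms(2,3) by (simp add: onb_def)

text \<open>The norms of the \<open>X v\<close> are the singular values. By Pythagoras, each
  \<open>(norm (X w))\<^sup>2\<close> is an average of their squares with weights
  \<open>(w \<bullet> v)\<^sup>2\<close>, which sum to 1 over either basis. Jensen applies to the
  exponent \<open>p / 2\<close>, which is at least 1. The sum over a singular basis is thus the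
  maximum over all orthonormal bases.\<close>

lemma sum_norm_powr_le_singular:
  assumes "linear X" "singular_basis X V" "onb W" "2 \<le> p"
  shows "(\<Sum>w\<in>W. norm (X w) powr p) \<le> (\<Sum>v\<in>V. norm (X v) powr p)"
proof -
  have V: "onb V" "finite V" using assms(2) by (auto simp: singular_basis_def onb_finite)
  have sq: "((norm y)\<^sup>2) powr (p/2) = norm y powr p" for y :: 'b
    by (simp add: powr_powr flip: powr_numeral)
  have "(\<Sum>w\<in>W. norm (X w) powr p) = (\<Sum>w\<in>W. (\<Sum>v\<in>V. (w \<bullet> v)\<^sup>2 * (norm (X v))\<^sup>2) powr (p/2))"
    by (simp add: sq flip: singular_basis_norm[OF assms(1,2)])
  also have "\<dots> \<le> (\<Sum>w\<in>W. \<Sum>v\<in>V. (w \<bullet> v)\<^sup>2 * ((norm (X v))\<^sup>2) powr (p/2))"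
    using V assms by (intro sum_mono powr_sum_Jensen) (auto simp: onb_weight_sum)
  also have "\<dots> = (\<Sum>v\<in>V. (\<Sum>w\<in>W. (v \<bullet> w)\<^sup>2) * norm (X v) powr p)"
    unfolding sq by (subst sum.swap) (simp add: sum_distrib_right inner_commute)
  also have "\<dots> = (\<Sum>v\<in>V. norm (X v) powr p)"
    using V assms by (intro sum.cong) (auto simp: onb_weight_sum)
  finally show ?thesis .
qed

text \<open>The choice of basis is immaterial for linear \<open>X\<close> and
  \<open>2 \<le> p\<close>: by the maximum property, any two singular bases give the same
  sum.\<close>

definition Snorm :: "real \<Rightarrow> ('a::euclidean_space \<Rightarrow> 'b::euclidean_space) \<Rightarrow> real" where
  "Snorm p X = (\<Sum>v\<in>(SOME V. singular_basis X V). norm (X v) powr p) powr (1 / p)"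

lemma Snorm_eq:
  assumes "linear X" "singular_basis X V" "2 \<le> p"
  shows "Snorm p X = (\<Sum>v\<in>V. norm (X v) powr p) powr (1 / p)"
proof -
  let ?U = "SOME V. singular_basis X V"
  have U: "singular_basis X ?U" using assms(2) by (rule someI)
  have "(\<Sum>v\<in>?U. norm (X v) powr p) = (\<Sum>v\<in>V. norm (X v) powr p)"
    using U assms by (intro antisym sum_norm_powr_le_singular) (auto simp: singular_basis_def)
  then show ?thesis by (simp add: Snorm_def)
qed

lemma Snorm_nonneg [simp]: "0 \<le> Snorm p X"
  by (simp add: Snorm_def)

lemma Snorm_powr:
  assumes "linear X" "singular_basis X V" "2 \<le> p"
  shows "Snorm p X powr p = (\<Sum>v\<in>V. norm (X v) powr p)"
  unfolding Snorm_eq[OF assms] using assms by (simp add: powr_powr sum_nonneg)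

lemma sum_norm_powr_le_Snorm:
  assumes "linear X" "onb W" "2 \<le> p"
  shows "(\<Sum>w\<in>W. norm (X w) powr p) powr (1 / p) \<le> Snorm p X"
proof -
  obtain V where V: "singular_basis X V" using singular_basis_exists assms(1) by blast
  show ?thesis unfolding Snorm_eq[OF assms(1) V assms(3)]
    using assms V by (intro powr_mono2 sum_norm_powr_le_singular) (auto intro: sum_nonneg)
qed

text \<open>In a singular basis of the sum the left side is a plain \<open>p\<close>-sum of norms,
  so scalar Minkowski applies. Both resulting sums are bounded because singular bases
  maximize.\<close>

lemma Snorm_triangle:
  assumes "linear X" "linear Z" "2 \<le> p"
  shows "Snorm p (\<lambda>x. X x + Z x) \<le> Snorm p X + Snorm p Z"
proof -
  have lin: "linear (\<lambda>x. X x + Z x)" using assms by (intro linear_compose_add)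
  obtain V where V: "singular_basis (\<lambda>x. X x + Z x) V" using singular_basis_exists lin by blast
  then have onb: "onb V" and fin: "finite V" by (auto simp: singular_basis_def onb_finite)
  have "Snorm p (\<lambda>x. X x + Z x) = (\<Sum>v\<in>V. norm (X v + Z v) powr p) powr (1 / p)"
    using Snorm_eq[OF lin V assms(3)] .
  also have "\<dots> \<le> (\<Sum>v\<in>V. (norm (X v) + norm (Z v)) powr p) powr (1 / p)"
    using assms by (intro powr_mono2 sum_mono sum_nonneg norm_triangle_ineq) auto
  also have "\<dots> \<le> (\<Sum>v\<in>V. norm (X v) powr p) powr (1 / p) + (\<Sum>v\<in>V. norm (Z v) powr p) powr (1 / p)"
    using fin assms by (intro Minkowski_sum) auto
  also have "\<dots> \<le> Snorm p X + Snorm p Z"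
    using assms onb by (intro add_mono sum_norm_powr_le_Snorm)
  finally show ?thesis .
qed

lemma Snorm_comp_le:
  assumes "linear X" "linear A" "\<And>y. norm (A y) \<le> K * norm y" "0 \<le> K" "2 \<le> p"
  shows "Snorm p (\<lambda>x. A (X x)) \<le> K * Snorm p X"
proof -
  have lin: "linear (\<lambda>x. A (X x))" using assms linear_compose[of X A] by (simp add: o_def)
  obtain V where V: "singular_basis (\<lambda>x. A (X x)) V" using singular_basis_exists lin by blast
  then have onb: "onb V" by (auto simp: singular_basis_def)
  have "Snorm p (\<lambda>x. A (X x)) = (\<Sum>v\<in>V. norm (A (X v)) powr p) powr (1 / p)"
    using Snorm_eq[OF lin V assms(5)] .
  also have "\<dots> \<le> (\<Sum>v\<in>V. (K * norm (X v)) powr p) powr (1 / p)"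
    using assms by (intro powr_mono2 sum_mono sum_nonneg) auto
  also have "\<dots> = K * (\<Sum>v\<in>V. norm (X v) powr p) powr (1 / p)"
    using assms by (simp add: powr_mult sum_nonneg powr_powr flip: sum_distrib_left)
  also have "\<dots> \<le> K * Snorm p X"
    using assms onb by (intro mult_left_mono sum_norm_powr_le_Snorm)
  finally show ?thesis .
qed

lemma Snorm_scale:
  assumes "linear X" "2 \<le> p"
  shows "Snorm p (\<lambda>x. c *\<^sub>R X x) = \<bar>c\<bar> * Snorm p X"
proof -
  obtain V where V: "singular_basis X V" using singular_basis_exists assms by blast
  have lin: "linear (\<lambda>x. c *\<^sub>R X x)" using assms by (simp add: linear_compose_scale_right)
  have "singular_basis (\<lambda>x. c *\<^sub>R X x) V" using V by (auto simp: singular_basis_def pairwise_def)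
  then have "Snorm p (\<lambda>x. c *\<^sub>R X x) = (\<Sum>v\<in>V. (\<bar>c\<bar> * norm (X v)) powr p) powr (1 / p)"
    using Snorm_eq[OF lin _ assms(2)] by simp
  also have "\<dots> = \<bar>c\<bar> * Snorm p X"
    using assms Snorm_eq[OF assms(1) V assms(2)]
    by (simp add: powr_mult sum_nonneg powr_powr flip: sum_distrib_left)
  finally show ?thesis .
qed

text \<open>Hoelder with exponents \<open>p / (p - 1)\<close> and \<open>p\<close>. The left side,
  as a function of \<open>Z\<close>, is the trace pairing with
  \<open>X \<bar>X\<bar>\<^sup>p\<^sup>-\<^sup>2\<close>; after normalization it becomes the
  functional that norms \<open>X\<close>.\<close>

lemma Snorm_supporting_functional:
  assumes "linear X" "linear Z" "singular_basis X V" "2 \<le> p"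
  shows "(\<Sum>v\<in>V. norm (X v) powr (p - 2) * (X v \<bullet> Z v)) \<le> Snorm p X powr (p - 1) * Snorm p Z"
proof -
  define s where "s = (p - 1) / p"
  have s: "0 < s" "s < 1" "p * s = p - 1" "p * (1 - s) = 1" "1 - s = 1 / p"
    using assms unfolding s_def by (auto simp: field_simps)
  have V: "onb V" "finite V" using assms by (auto simp: singular_basis_def onb_finite)
  have "(\<Sum>v\<in>V. norm (X v) powr (p - 2) * (X v \<bullet> Z v))
      \<le> (\<Sum>v\<in>V. (norm (X v) powr p) powr s * (norm (Z v) powr p) powr (1 - s))"
  proof (intro sum_mono)
    fix v
    have "norm (X v) powr (p - 2) * (X v \<bullet> Z v) \<le> norm (X v) powr (p - 2) * (norm (X v) * norm (Z v))"
      by (intro mult_left_mono norm_cauchy_schwarz) auto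
    also have "\<dots> = norm (X v) powr (p - 1) * norm (Z v)"
      using powr_mult_base[of "norm (X v)" "p - 2"] by (simp add: algebra_simps)
    finally show "norm (X v) powr (p - 2) * (X v \<bullet> Z v)
        \<le> (norm (X v) powr p) powr s * (norm (Z v) powr p) powr (1 - s)"
      using s by (simp add: powr_powr)
  qed
  also have "\<dots> \<le> (\<Sum>v\<in>V. norm (X v) powr p) powr s * (\<Sum>v\<in>V. norm (Z v) powr p) powr (1 - s)"
    using V s by (intro Holder_sum) auto
  also have "(\<Sum>v\<in>V. norm (X v) powr p) powr s = Snorm p X powr (p - 1)"
    by (simp add: powr_powr s flip: Snorm_powr[OF assms(1,3,4)])
  also have "Snorm p X powr (p - 1) * (\<Sum>v\<in>V. norm (Z v) powr p) powr (1 - s)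
      \<le> Snorm p X powr (p - 1) * Snorm p Z"
    unfolding s(5) using assms V by (intro mult_left_mono sum_norm_powr_le_Snorm) auto
  finally show ?thesis .
qed

lemma singular_basis_eigenvector:
  assumes "linear X" "singular_basis X V" "v \<in> V"
  shows "adjoint X (X v) = (norm (X v))\<^sup>2 *\<^sub>R v"
proof -
  have V: "onb V" "finite V" using assms by (auto simp: singular_basis_def onb_finite)
  have "adjoint X (X v) = (\<Sum>u\<in>V. (adjoint X (X v) \<bullet> u) *\<^sub>R u)"
    by (simp add: onb_expansion[OF V(1)])
  also have "\<dots> = (\<Sum>u\<in>V. if u = v then (norm (X v))\<^sup>2 *\<^sub>R v else 0)"
    using assms adjoint_works[OF assms(1)]
    by (intro sum.cong) (auto simp: singular_basis_def pairwise_def power2_norm_eq_inner inner_commute)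
  also have "\<dots> = (norm (X v))\<^sup>2 *\<^sub>R v" using V assms by simp
  finally show ?thesis .
qed

text \<open>Both sides equal a double sum of \<open>(X v \<bullet> w)\<^sup>2\<close> times a power
  \<open>p - 2\<close> of a singular value of \<open>X\<close> or of its adjoint. Moving
  \<open>adjoint X\<close> across the inner product shows that the two singular values agree
  wherever \<open>X v \<bullet> w\<close> is nonzero.\<close>

lemma Snorm_adjoint:
  fixes X :: "'a::euclidean_space \<Rightarrow> 'b::euclidean_space"
  assumes lin: "linear X" and p: "2 \<le> p"
  shows "Snorm p (adjoint X) = Snorm p X"
proof -
  have lin': "linear (adjoint X)" using adjoint_linear[OF lin] .
  obtain V where V: "singular_basis X V" using singular_basis_exists lin by blast
  obtain W where W: "singular_basis (adjoint X) W" using singular_basis_exists lin' by blast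
  have onb: "onb V" "onb W" using V W by (auto simp: singular_basis_def)
  have split: "x powr p = x\<^sup>2 * x powr (p - 2)" if "x \<ge> 0" for x :: real
    using that by (cases "x = 0") (auto simp: powr_diff)
  have key: "(X v \<bullet> w)\<^sup>2 * norm (X v) powr (p - 2) = (X v \<bullet> w)\<^sup>2 * norm (adjoint X w) powr (p - 2)"
    if "v \<in> V" "w \<in> W" for v w
  proof (cases "X v \<bullet> w = 0")
    case False
    have adj: "x \<bullet> adjoint X y = X x \<bullet> y" for x y
      using adjoint_works[OF lin] .
    have "(norm (X v))\<^sup>2 * (X v \<bullet> w) = X (adjoint X (X v)) \<bullet> w"
      using singular_basis_eigenvector[OF lin V that(1)] by (simp add: linear_scale[OF lin])
    also have "\<dots> = X v \<bullet> X (adjoint X w)"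
      by (metis adj inner_commute)
    also have "\<dots> = X v \<bullet> adjoint (adjoint X) (adjoint X w)"
      by (simp add: adjoint_adjoint[OF lin])
    also have "\<dots> = (norm (adjoint X w))\<^sup>2 * (X v \<bullet> w)"
      using singular_basis_eigenvector[OF lin' W that(2)] by simp
    finally have "norm (X v) = norm (adjoint X w)" using False by simp
    then show ?thesis by simp
  qed simp
  have "Snorm p X powr p = (\<Sum>v\<in>V. (\<Sum>w\<in>W. (X v \<bullet> w)\<^sup>2) * norm (X v) powr (p - 2))"
    unfolding Snorm_powr[OF lin V p] by (simp add: split onb_Parseval_norm[OF onb(2)])
  also have "\<dots> = (\<Sum>v\<in>V. \<Sum>w\<in>W. (X v \<bullet> w)\<^sup>2 * norm (adjoint X w) powr (p - 2))"
    unfolding sum_distrib_right using key by (intro sum.cong refl)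
  also have "\<dots> = (\<Sum>w\<in>W. (\<Sum>v\<in>V. (adjoint X w \<bullet> v)\<^sup>2) * norm (adjoint X w) powr (p - 2))"
    using adjoint_works[OF lin]
    by (subst sum.swap) (simp add: sum_distrib_right inner_commute)
  also have "\<dots> = Snorm p (adjoint X) powr p"
    unfolding Snorm_powr[OF lin' W p] by (simp add: split onb_Parseval_norm[OF onb(1)])
  finally have "(Snorm p X powr p) powr (1 / p) = (Snorm p (adjoint X) powr p) powr (1 / p)" by simp
  then show ?thesis using p by (simp add: powr_powr)
qed

section \<open>The self-adjoint block dilation\<close>

definition dilation :: "('a::euclidean_space \<Rightarrow> 'b::euclidean_space) \<Rightarrow> 'a \<times> 'b \<Rightarrow> 'a \<times> 'b" where
  "dilation X z = (adjoint X (snd z), X (fst z))"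

lemma linear_dilation:
  assumes "linear X" shows "linear (dilation X)"
proof -
  have "linear (adjoint X)" using adjoint_linear[OF assms] .
  then show ?thesis using assms unfolding dilation_def
    by (intro linearI) (auto simp: linear_add linear_scale)
qed

lemma dilation_self_adjoint:
  assumes "linear X" shows "dilation X z \<bullet> z' = z \<bullet> dilation X z'"
  using adjoint_works[OF assms] by (simp add: dilation_def inner_prod_def inner_commute)

lemma onb_Times:
  fixes V :: "'a::euclidean_space set" and W :: "'b::euclidean_space set"
  assumes "onb V" "onb W"
  shows "onb ((\<lambda>v. (v, 0)) ` V \<union> (\<lambda>w. (0, w)) ` W)" (is "onb ?B")
proof -
  have ind: "pairwise orthogonal ?B" "\<forall>b\<in>?B. norm b = 1"
    using assms onb_inner[OF assms(1)] onb_inner[OF assms(2)]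
    by (auto simp: pairwise_def orthogonal_def norm_Pair onb_def split: if_splits)
  moreover have "0 \<notin> ?B" using ind(2) by (metis norm_zero zero_neq_one)
  ultimately have "independent ?B" by (intro pairwise_orthogonal_independent) auto
  moreover have "card ?B = DIM('a \<times> 'b)"
  proof -
    have "0 \<notin> V" using assms by (auto simp: onb_def)
    then have "card ?B = card ((\<lambda>v. (v, 0::'b)) ` V) + card ((\<lambda>w. (0::'a, w)) ` W)"
      using onb_finite[OF assms(1)] onb_finite[OF assms(2)] by (intro card_Un_disjoint) auto
    also have "\<dots> = card V + card W" by (simp add: card_image inj_on_def)
    finally show ?thesis using onb_card assms by (metis DIM_prod)
  qed
  ultimately have "span ?B = UNIV"
    using card_eq_dim[of ?B UNIV] onb_finite[OF assms(1)] onb_finite[OF assms(2)] by auto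
  then show ?thesis using ind by (simp add: onb_def)
qed

text \<open>As a block matrix the dilation has zero diagonal and the off-diagonal blocks
  \<open>adjoint X\<close> and \<open>X\<close>. Singular bases of \<open>X\<close> and of
  \<open>adjoint X\<close>, placed in the two components, form a singular basis of it, and the two
  blocks contribute equally because the adjoint has the same norm.\<close>

lemma Snorm_dilation:
  assumes lin: "linear X" and p: "2 \<le> p"
  shows "Snorm p (dilation X) powr p = 2 * Snorm p X powr p"
proof -
  have lin': "linear (adjoint X)" using adjoint_linear[OF lin] .
  obtain V where V: "singular_basis X V" using singular_basis_exists lin by blast
  obtain W where W: "singular_basis (adjoint X) W" using singular_basis_exists lin' by blast
  have onb: "onb V" "onb W" using V W by (auto simp: singular_basis_def)
  have 0: "X 0 = 0" "adjoint X 0 = 0" using lin lin' by (auto simp: linear_0)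
  let ?B = "(\<lambda>v. (v, 0)) ` V \<union> (\<lambda>w. (0, w)) ` W"
  have B: "singular_basis (dilation X) ?B"
    unfolding singular_basis_def
    using onb_Times[OF onb] V W 
    by (fastforce simp: pairwise_def dilation_def singular_basis_def 0)
  have "0 \<notin> V" using onb by (auto simp: onb_def)
  then have "Snorm p (dilation X) powr p = (\<Sum>z\<in>(\<lambda>v. (v, 0)) ` V. norm (dilation X z) powr p)
      + (\<Sum>z\<in>(\<lambda>w. (0, w)) ` W. norm (dilation X z) powr p)"
    unfolding Snorm_powr[OF linear_dilation[OF lin] B p]
    using onb_finite[OF onb(1)] onb_finite[OF onb(2)] by (intro sum.union_disjoint) auto
  also have "\<dots> = (\<Sum>v\<in>V. norm (X v) powr p) + (\<Sum>w\<in>W. norm (adjoint X w) powr p)"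
    by (simp add: sum.reindex inj_on_def dilation_def 0 norm_Pair)
  also have "\<dots> = 2 * Snorm p X powr p"
    using Snorm_adjoint[OF lin p] by (simp flip: Snorm_powr[OF lin V p] Snorm_powr[OF lin' W p])
  finally show ?thesis .
qed

section \<open>Scalar Bregman divergences and powers\<close>

text \<open>With \<open>r = p - 2\<close> and a factor \<open>p\<close> this is the second
  derivative of \<open>\<bar>x\<bar> powr p\<close>. The origin is excluded here and later becomes
  an exceptional point of the integration.\<close>

lemma has_real_derivative_mult_abs_powr:
  fixes x :: real
  assumes "x \<noteq> 0"
  shows "((\<lambda>x. x * \<bar>x\<bar> powr r) has_real_derivative (r + 1) * \<bar>x\<bar> powr r) (at x)"
proof (cases "x > 0")
  case True
  have "((\<lambda>x. x * x powr r) has_real_derivative x powr r + x * (r * x powr (r - 1))) (at x)"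
    using True by (auto intro!: derivative_eq_intros simp: field_simps)
  moreover have "x * x powr (r - 1) = x powr r" using True by (simp add: powr_mult_base)
  ultimately have "((\<lambda>x. x * x powr r) has_real_derivative (r + 1) * x powr r) (at x)"
    by (simp add: algebra_simps)
  moreover have "eventually (\<lambda>x. x * x powr r = x * \<bar>x\<bar> powr r) (nhds x)"
    using eventually_nhds_in_open[of "{0<..}" x] True by (auto elim: eventually_mono)
  ultimately show ?thesis using True by (subst (asm) DERIV_cong_ev[OF refl _ refl]) auto
next
  case False
  then have x: "x < 0" using assms by simp
  have "((\<lambda>x. x * (- x) powr r) has_real_derivative (- x) powr r - x * (r * (- x) powr (r - 1))) (at x)"
    using x by (auto intro!: derivative_eq_intros simp: field_simps)
  moreover have "x * (- x) powr (r - 1) = - ((- x) powr r)" using x powr_mult_base[of "- x" "r - 1"] by simp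
  moreover from this have "(- x) powr r - x * (r * (- x) powr (r - 1)) = (r + 1) * (- x) powr r"
    by (simp add: algebra_simps)
  ultimately have "((\<lambda>x. x * (- x) powr r) has_real_derivative (r + 1) * (- x) powr r) (at x)"
    by simp
  moreover have "eventually (\<lambda>x. x * (- x) powr r = x * \<bar>x\<bar> powr r) (nhds x)"
    using eventually_nhds_in_open[of "{..<0}" x] x by (auto elim: eventually_mono)
  ultimately show ?thesis using x by (subst (asm) DERIV_cong_ev[OF refl _ refl]) auto
qed

lemma has_real_derivative_abs_powr:
  fixes x :: real
  assumes "x \<noteq> 0"
  shows "((\<lambda>x. \<bar>x\<bar> powr p) has_real_derivative p * x * \<bar>x\<bar> powr (p - 2)) (at x)"
proof (cases "x > 0")
  case True
  have "((\<lambda>x. x powr p) has_real_derivative p * x powr (p - 1)) (at x)"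
    using True by (auto intro!: derivative_eq_intros simp: field_simps)
  moreover have "x powr (p - 1) = x * x powr (p - 2)" using True by (simp add: powr_mult_base)
  ultimately have "((\<lambda>x. x powr p) has_real_derivative p * x * x powr (p - 2)) (at x)"
    by (simp add: algebra_simps)
  moreover have "eventually (\<lambda>x. x powr p = \<bar>x\<bar> powr p) (nhds x)"
    using eventually_nhds_in_open[of "{0<..}" x] True by (auto elim: eventually_mono)
  ultimately show ?thesis using True by (subst (asm) DERIV_cong_ev[OF refl _ refl]) auto
next
  case False
  then have x: "x < 0" using assms by simp
  have "((\<lambda>x. (- x) powr p) has_real_derivative - (p * (- x) powr (p - 1))) (at x)"
    using x by (auto intro!: derivative_eq_intros simp: field_simps)
  moreover have "(- x) powr (p - 1) = - x * (- x) powr (p - 2)" using x powr_mult_base[of "- x" "p - 2"] by simp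
  ultimately have "((\<lambda>x. (- x) powr p) has_real_derivative p * x * (- x) powr (p - 2)) (at x)"
    by (simp add: algebra_simps)
  moreover have "eventually (\<lambda>x. (- x) powr p = \<bar>x\<bar> powr p) (nhds x)"
    using eventually_nhds_in_open[of "{..<0}" x] x by (auto elim: eventually_mono)
  ultimately show ?thesis using x by (subst (asm) DERIV_cong_ev[OF refl _ refl]) auto
qed

text \<open>The factor \<open>p * a * \<bar>a\<bar> powr (p - 2)\<close> is the derivative of
  \<open>\<bar>x\<bar> powr p\<close> at \<open>a\<close>. It is also correct for
  \<open>p = 2\<close> and \<open>a = 0\<close>: there \<open>0 powr 0\<close> is 0, but it is
  multiplied by \<open>a\<close>.\<close>

definition powr_Bregman :: "real \<Rightarrow> real \<Rightarrow> real \<Rightarrow> real" where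
  "powr_Bregman p b a = \<bar>b\<bar> powr p - \<bar>a\<bar> powr p - p * a * \<bar>a\<bar> powr (p - 2) * (b - a)"

text \<open>Taylor's formula with integral remainder; the hypothesis bounds the second derivative.\<close>
lemma powr_Bregman_le:
  fixes a b p \<alpha> \<beta> :: real
  assumes p: "2 < p"
    and bound: "\<And>s. 0 \<le> s \<Longrightarrow> s \<le> 1 \<Longrightarrow> \<bar>a + s * (b - a)\<bar> powr (p - 2) \<le> \<alpha> + \<beta> * s"
  shows "powr_Bregman p b a \<le> p * (p - 1) / 2 * (b - a)\<^sup>2 * (\<alpha> + \<beta> / 3)"
proof (cases "b = a")
  case True
  then show ?thesis by (simp add: powr_Bregman_def)
next
  case False
  define \<delta> where "\<delta> = b - a"
  have \<delta>: "\<delta> \<noteq> 0" using False \<delta>_def by simp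
  define g where "g s = a + s * \<delta>" for s
  \<comment> \<open>The value at \<open>b\<close> predicted by the tangent at \<open>g s\<close>. It
    runs from the tangent at \<open>a\<close> to the value at \<open>b\<close>, and its derivative
    retains only the second-derivative term, with weight \<open>1 - s\<close>.\<close>
  define F where "F s = \<bar>g s\<bar> powr p + (1 - s) * \<delta> * (p * (g s * \<bar>g s\<bar> powr (p - 2)))" for s
  define F' where "F' s = (1 - s) * \<delta>\<^sup>2 * (p * (p - 1)) * \<bar>g s\<bar> powr (p - 2)" for s
  have F: "(F has_real_derivative F' s) (at s)" if "g s \<noteq> 0" for s
  proof -
    have g: "(g has_real_derivative \<delta>) (at s)"
      unfolding g_def by (auto intro!: derivative_eq_intros)
    have 1: "((\<lambda>s. \<bar>g s\<bar> powr p) has_real_derivative p * g s * \<bar>g s\<bar> powr (p - 2) * \<delta>) (at s)"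
      using DERIV_chain2[OF has_real_derivative_abs_powr[OF that] g] .
    have 2: "((\<lambda>s. g s * \<bar>g s\<bar> powr (p - 2)) has_real_derivative (p - 2 + 1) * \<bar>g s\<bar> powr (p - 2) * \<delta>) (at s)"
      using DERIV_chain2[OF has_real_derivative_mult_abs_powr[OF that] g] .
    show ?thesis unfolding F_def F'_def
      by (rule derivative_eq_intros 1 2 refl)+ (simp add: algebra_simps power2_eq_square)
  qed
  have "continuous_on {0..1} (\<lambda>s. \<bar>g s\<bar> powr r)" if "0 < r" for r
    unfolding g_def using that by (intro continuous_on_powr' continuous_intros) auto
  from this[of p] this[of "p - 2"] have "continuous_on {0..1} F"
    unfolding F_def using p by (intro continuous_on_add continuous_on_mult) (auto simp: g_def intro!: continuous_intros)
  moreover have "(F has_vector_derivative F' s) (at s)" if "s \<in> {0<..<1} - {- a / \<delta>}" for s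
  proof -
    have "g s \<noteq> 0" using that \<delta> unfolding g_def by (auto simp: field_simps)
    then show ?thesis using F by (simp add: has_real_derivative_iff_has_vector_derivative)
  qed
  \<comment> \<open>The path \<open>g\<close> meets 0 only at \<open>- a / \<delta>\<close>.
    Continuity of \<open>F\<close> suffices at that point.\<close>
  ultimately have "(F' has_integral (F 1 - F 0)) {0..1}"
    by (intro fundamental_theorem_of_calculus_interior_strong[where S = "{- a / \<delta>}"]) auto
  moreover have "F 1 - F 0 = powr_Bregman p b a"
    by (simp add: F_def g_def powr_Bregman_def \<delta>_def algebra_simps)
  ultimately have I1: "(F' has_integral powr_Bregman p b a) {0..1}" by simp
  define c where "c = \<delta>\<^sup>2 * (p * (p - 1))"
  \<comment> \<open>An antiderivative of the majorant. The integral of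
    \<open>(1 - s) * (\<alpha> + \<beta> * s)\<close> over the unit interval is
    \<open>\<alpha> / 2 + \<beta> / 6\<close>.\<close>
  define G where "G s = c * (\<alpha> * (s - s\<^sup>2 / 2) + \<beta> * (s\<^sup>2 / 2 - s^3 / 3))" for s
  have "(G has_vector_derivative (1 - s) * c * (\<alpha> + \<beta> * s)) (at s within {0..1})" for s
    unfolding G_def has_real_derivative_iff_has_vector_derivative[symmetric]
    by (auto intro!: derivative_eq_intros simp: algebra_simps power2_eq_square)
  then have I2: "((\<lambda>s. (1 - s) * c * (\<alpha> + \<beta> * s)) has_integral (G 1 - G 0)) {0..1}"
    by (intro fundamental_theorem_of_calculus) auto
  have "powr_Bregman p b a \<le> G 1 - G 0"
  proof (rule has_integral_le[OF I1 I2])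
    fix s :: real assume s: "s \<in> {0..1}"
    have "F' s = (1 - s) * c * \<bar>g s\<bar> powr (p - 2)" unfolding F'_def c_def by simp
    also have "\<dots> \<le> (1 - s) * c * (\<alpha> + \<beta> * s)"
      using s p bound[of s] unfolding c_def g_def \<delta>_def by (intro mult_left_mono) auto
    finally show "F' s \<le> (1 - s) * c * (\<alpha> + \<beta> * s)" .
  qed
  also have "G 1 - G 0 = p * (p - 1) / 2 * (b - a)\<^sup>2 * (\<alpha> + \<beta> / 3)"
    unfolding G_def c_def \<delta>_def by (simp add: field_simps)
  finally show ?thesis .
qed

lemma abs_convex_combination_le:
  fixes a b s :: real
  assumes "0 \<le> s" "s \<le> 1"
  shows "\<bar>a + s * (b - a)\<bar> \<le> (1 - s) * \<bar>a\<bar> + s * \<bar>b\<bar>"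
proof -
  have "a + s * (b - a) = (1 - s) * a + s * b" by (simp add: algebra_simps)
  also have "\<bar>\<dots>\<bar> \<le> \<bar>(1 - s) * a\<bar> + \<bar>s * b\<bar>" by (rule abs_triangle_ineq)
  finally show ?thesis using assms by (simp add: abs_mult)
qed

text \<open>For exponent \<open>p - 2 \<ge> 1\<close> the second derivative lies below its chord in
  \<open>s\<close>. The density \<open>2 * (1 - s)\<close> has mean \<open>1/3\<close>, so the chord
  contributes its value there.\<close>

lemma powr_Bregman_le_convex:
  fixes a b p :: real
  assumes p: "3 \<le> p"
  shows "powr_Bregman p b a \<le> p * (p - 1) / 2 * (b - a)\<^sup>2 * (2/3 * \<bar>a\<bar> powr (p - 2) + 1/3 * \<bar>b\<bar> powr (p - 2))"
proof -
  have "powr_Bregman p b a \<le> p * (p - 1) / 2 * (b - a)\<^sup>2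
      * (\<bar>a\<bar> powr (p - 2) + (\<bar>b\<bar> powr (p - 2) - \<bar>a\<bar> powr (p - 2)) / 3)"
  proof (rule powr_Bregman_le)
    fix s :: real assume s: "0 \<le> s" "s \<le> 1"
    have "\<bar>a + s * (b - a)\<bar> powr (p - 2) \<le> ((1 - s) * \<bar>a\<bar> + s * \<bar>b\<bar>) powr (p - 2)"
      using s p by (intro powr_mono2 abs_convex_combination_le) auto
    also have "\<dots> \<le> (1 - s) * \<bar>a\<bar> powr (p - 2) + s * \<bar>b\<bar> powr (p - 2)"
      using s p by (intro powr_add_Jensen) auto
    finally show "\<bar>a + s * (b - a)\<bar> powr (p - 2)
        \<le> \<bar>a\<bar> powr (p - 2) + (\<bar>b\<bar> powr (p - 2) - \<bar>a\<bar> powr (p - 2)) * s"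
      by (simp add: algebra_simps)
  qed (use p in auto)
  then show ?thesis by (simp add: algebra_simps add_divide_distrib diff_divide_distrib)
qed

text \<open>For exponent \<open>p - 2 \<le> 1\<close> the chord is no majorant, but a tangent line
  is. Tangency at the mean point \<open>2/3 * \<bar>a\<bar> + 1/3 * \<bar>b\<bar>\<close> makes the
  linear correction integrate to zero. The mixture stays inside the power, which is the form needed
  for operator concavity.\<close>

lemma powr_Bregman_le_concave:
  fixes a b p :: real
  assumes p: "2 < p" "p \<le> 3"
  shows "powr_Bregman p b a \<le> p * (p - 1) / 2 * (b - a)\<^sup>2 * (2/3 * \<bar>a\<bar> + 1/3 * \<bar>b\<bar>) powr (p - 2)"
proof (cases "a = 0 \<and> b = 0")
  case True
  then show ?thesis by (simp add: powr_Bregman_def)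
next
  case False
  define x where "x = 2/3 * \<bar>a\<bar> + 1/3 * \<bar>b\<bar>"
  define c where "c = (p - 2) * x powr (p - 2 - 1)"
  have x: "x > 0" using False unfolding x_def by auto
  have "powr_Bregman p b a \<le> p * (p - 1) / 2 * (b - a)\<^sup>2
      * (x powr (p - 2) + c * (\<bar>a\<bar> - x) + c * (\<bar>b\<bar> - \<bar>a\<bar>) / 3)"
  proof (rule powr_Bregman_le)
    fix s :: real assume s: "0 \<le> s" "s \<le> 1"
    have "\<bar>a + s * (b - a)\<bar> powr (p - 2) \<le> ((1 - s) * \<bar>a\<bar> + s * \<bar>b\<bar>) powr (p - 2)"
      using s p by (intro powr_mono2 abs_convex_combination_le) auto
    also have "\<dots> \<le> x powr (p - 2) + c * ((1 - s) * \<bar>a\<bar> + s * \<bar>b\<bar> - x)"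
      unfolding c_def using s p x by (intro powr_le_tangent) auto
    finally show "\<bar>a + s * (b - a)\<bar> powr (p - 2)
        \<le> x powr (p - 2) + c * (\<bar>a\<bar> - x) + c * (\<bar>b\<bar> - \<bar>a\<bar>) * s"
      by (simp add: algebra_simps)
  qed (use p in auto)
  also have "x powr (p - 2) + c * (\<bar>a\<bar> - x) + c * (\<bar>b\<bar> - \<bar>a\<bar>) / 3 = x powr (p - 2)"
    unfolding x_def by (simp add: field_simps)
  finally show ?thesis unfolding x_def .
qed

section \<open>Fractional powers as integrals of parallel sums\<close>

definition parallel_kernel :: "real \<Rightarrow> real \<Rightarrow> real \<Rightarrow> real" where
  "parallel_kernel \<theta> x t = x * t powr (\<theta> - 1) / (x + t)"

lemma parallel_kernel_measurable [measurable]: "parallel_kernel \<theta> x \<in> borel_measurable borel"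
  unfolding parallel_kernel_def by measurable

text \<open>For \<open>x > 0\<close> substitute \<open>x * t\<close> for \<open>t\<close>. The
  kernel is the parallel sum of \<open>x\<close> and \<open>t\<close> times
  \<open>t powr (\<theta> - 2)\<close>, so homogeneity produces \<open>x powr \<theta>\<close>. The
  remaining integral is a constant of which only positivity and finiteness matter.\<close>

lemma nn_integral_parallel_kernel_scale:
  assumes "0 \<le> x"
  shows "(\<integral>\<^sup>+t. ennreal (indicator {0<..} t * parallel_kernel \<theta> x t) \<partial>lborel)
    = ennreal (x powr \<theta>) * (\<integral>\<^sup>+t. ennreal (indicator {0<..} t * parallel_kernel \<theta> 1 t) \<partial>lborel)"
proof (cases "x = 0")
  case True
  then show ?thesis by (simp add: parallel_kernel_def)
next
  case False
  then have x: "x > 0" using assms by simp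
  have *: "x * (indicator {0<..} (0 + x * t) * parallel_kernel \<theta> x (0 + x * t))
      = x powr \<theta> * (indicator {0<..} t * parallel_kernel \<theta> 1 t)" for t
  proof (cases "t > 0")
    case True
    have "x + x * t = x * (1 + t)" by (simp add: algebra_simps)
    then show ?thesis using True x
      by (simp add: parallel_kernel_def zero_less_mult_iff powr_mult powr_diff)
  next
    case False
    then show ?thesis using x by (simp add: zero_less_mult_iff)
  qed
  have "(\<integral>\<^sup>+t. ennreal (indicator {0<..} t * parallel_kernel \<theta> x t) \<partial>lborel)
      = ennreal x * (\<integral>\<^sup>+t. ennreal (indicator {0<..} (0 + x * t) * parallel_kernel \<theta> x (0 + x * t)) \<partial>lborel)"
    using x by (subst nn_integral_real_affine[where c = x and t = 0]) auto
  also have "\<dots> = (\<integral>\<^sup>+t. ennreal x * ennreal (indicator {0<..} (0 + x * t) * parallel_kernel \<theta> x (0 + x * t)) \<partial>lborel)"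
    by (subst nn_integral_cmult) auto
  also have "\<dots> = (\<integral>\<^sup>+t. ennreal (x powr \<theta>) * ennreal (indicator {0<..} t * parallel_kernel \<theta> 1 t) \<partial>lborel)"
  proof (intro nn_integral_cong)
    fix t :: real
    show "ennreal x * ennreal (indicator {0<..} (0 + x * t) * parallel_kernel \<theta> x (0 + x * t))
        = ennreal (x powr \<theta>) * ennreal (indicator {0<..} t * parallel_kernel \<theta> 1 t)"
      using x by (subst (1 2) ennreal_mult'[symmetric]) (simp_all only: *, auto)
  qed
  also have "\<dots> = ennreal (x powr \<theta>) * (\<integral>\<^sup>+t. ennreal (indicator {0<..} t * parallel_kernel \<theta> 1 t) \<partial>lborel)"
    by (subst nn_integral_cmult) auto
  finally show ?thesis .
qed

text \<open>The kernel is below \<open>t powr (\<theta> - 1)\<close>, integrable at 0 since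
  \<open>\<theta> > 0\<close>, and below \<open>t powr (\<theta> - 2)\<close>, integrable at
  infinity since \<open>\<theta> < 1\<close>.\<close>

lemma nn_integral_parallel_kernel_1:
  assumes "0 < \<theta>" "\<theta> < 1"
  defines "K \<equiv> \<integral>\<^sup>+t. ennreal (indicator {0<..} t * parallel_kernel \<theta> 1 t) \<partial>lborel"
  shows "0 < K" "K < \<infinity>"
proof -
  have I1: "(\<integral>\<^sup>+t. ennreal (indicator {0..1} t * t powr (\<theta> - 1)) \<partial>lborel) = ennreal (1 powr (\<theta> - 1 + 1) / (\<theta> - 1 + 1))"
    using assms has_integral_powr_from_0[of "\<theta> - 1" 1]
    by (intro nn_integral_has_integral_lebesgue) auto
  have I2: "(\<integral>\<^sup>+t. ennreal (indicator {1..} t * t powr (\<theta> - 2)) \<partial>lborel) = ennreal (- (1 powr (\<theta> - 2 + 1)) / (\<theta> - 2 + 1))"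
    using assms has_integral_powr_to_inf[of "\<theta> - 2" 1]
    by (intro nn_integral_has_integral_lebesgue) auto
  have "K \<le> (\<integral>\<^sup>+t. ennreal (indicator {0..1} t * t powr (\<theta> - 1)) + ennreal (indicator {1..} t * t powr (\<theta> - 2)) \<partial>lborel)"
    unfolding K_def
  proof (rule nn_integral_mono)
    fix t :: real
    have 1: "t powr (\<theta> - 1) / (1 + t) \<le> t powr (\<theta> - 1)" if "0 < t"
      using that by (simp add: field_simps)
    have 2: "t powr (\<theta> - 1) / (1 + t) \<le> t powr (\<theta> - 2)" if "0 < t"
    proof -
      have "t powr (\<theta> - 1) = t * t powr (\<theta> - 2)" using that by (simp add: powr_mult_base)
      also have "\<dots> \<le> (1 + t) * t powr (\<theta> - 2)" by (intro mult_right_mono) auto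
      finally show ?thesis using that by (simp add: field_simps)
    qed
    show "ennreal (indicator {0<..} t * parallel_kernel \<theta> 1 t)
      \<le> ennreal (indicator {0..1} t * t powr (\<theta> - 1)) + ennreal (indicator {1..} t * t powr (\<theta> - 2))"
      using 1 2 by (auto simp: parallel_kernel_def indicator_def ennreal_leI simp flip: ennreal_plus intro: add_increasing)
  qed
  also have "\<dots> = (\<integral>\<^sup>+t. ennreal (indicator {0..1} t * t powr (\<theta> - 1)) \<partial>lborel) + (\<integral>\<^sup>+t. ennreal (indicator {1..} t * t powr (\<theta> - 2)) \<partial>lborel)"
    by (intro nn_integral_add) auto
  also have "\<dots> < \<infinity>" unfolding I1 I2 by simp
  finally show "K < \<infinity>" .
  \<comment> \<open>A lower bound of the kernel on the interval from 1 to 2: the decreasing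
    numerator is at least \<open>2 powr (\<theta> - 1)\<close> and the denominator at most
    3.\<close>
  define c :: real where "c = 2 powr (\<theta> - 1) / 3"
  have "ennreal c = (\<integral>\<^sup>+t. ennreal c * indicator {1..2::real} t \<partial>lborel)"
    by (subst nn_integral_cmult_indicator) auto
  also have "\<dots> \<le> K" unfolding K_def
  proof (rule nn_integral_mono)
    fix t :: real
    show "ennreal c * indicator {1..2} t \<le> ennreal (indicator {0<..} t * parallel_kernel \<theta> 1 t)"
    proof (cases "t \<in> {1..2}")
      case True
      then have "2 powr (\<theta> - 1) \<le> t powr (\<theta> - 1)" using assms by (intro powr_mono2') auto
      then have "c \<le> t powr (\<theta> - 1) / (1 + t)" unfolding c_def using True by (intro frac_le) auto
      then show ?thesis using True by (simp add: parallel_kernel_def ennreal_leI)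
    qed auto
  qed
  finally show "0 < K"
    unfolding c_def by (auto intro: less_le_trans[rotated])
qed

text \<open>Up to a constant, \<open>x\<^sup>\<theta>\<close> is the integral of the parallel sums \<open>x t / (x + t)\<close> against \<open>t\<^sup>\<theta>\<^sup>-\<^sup>2\<close>.\<close>
lemma sum_powr_le_if_parallel_sum_le:
  fixes c x :: "'i \<Rightarrow> real" and d y :: "'j \<Rightarrow> real"
  assumes fin: "finite I" "finite J" and \<theta>: "0 < \<theta>" "\<theta> < 1"
    and nonneg: "\<And>i. i \<in> I \<Longrightarrow> 0 \<le> c i \<and> 0 \<le> x i" "\<And>j. j \<in> J \<Longrightarrow> 0 \<le> d j \<and> 0 \<le> y j"
    and le: "\<And>t. 0 < t \<Longrightarrow> (\<Sum>i\<in>I. c i * (x i * t / (x i + t))) \<le> (\<Sum>j\<in>J. d j * (y j * t / (y j + t)))"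
  shows "(\<Sum>i\<in>I. c i * x i powr \<theta>) \<le> (\<Sum>j\<in>J. d j * y j powr \<theta>)"
proof -
  define k where "k x t = indicator {0<..} t * parallel_kernel \<theta> x t" for x t
  have [measurable]: "k x \<in> borel_measurable borel" for x unfolding k_def by measurable
  define K where "K = (\<integral>\<^sup>+t. ennreal (k 1 t) \<partial>lborel)"
  have K: "0 < K" "K < \<infinity>" unfolding K_def k_def using nn_integral_parallel_kernel_1[OF \<theta>] by auto
  have k_nonneg: "0 \<le> k x t" if "0 \<le> x" for x t
    using that by (auto simp: k_def parallel_kernel_def indicator_def)
  have sum: "(\<integral>\<^sup>+t. ennreal (\<Sum>i\<in>A. c i * k (x i) t) \<partial>lborel) = ennreal (\<Sum>i\<in>A. c i * x i powr \<theta>) * K"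
    if "finite A" and A: "\<And>i. i \<in> A \<Longrightarrow> 0 \<le> c i \<and> 0 \<le> x i" for A and c x :: "'k \<Rightarrow> real"
  proof -
    have "(\<integral>\<^sup>+t. ennreal (\<Sum>i\<in>A. c i * k (x i) t) \<partial>lborel) = (\<integral>\<^sup>+t. (\<Sum>i\<in>A. ennreal (c i) * ennreal (k (x i) t)) \<partial>lborel)"
      using A k_nonneg by (intro nn_integral_cong) (simp add: ennreal_mult flip: sum_ennreal)
    also have "\<dots> = (\<Sum>i\<in>A. ennreal (c i) * (\<integral>\<^sup>+t. ennreal (k (x i) t) \<partial>lborel))"
      by (subst nn_integral_sum) (auto simp: nn_integral_cmult)
    also have "\<dots> = (\<Sum>i\<in>A. ennreal (c i) * (ennreal (x i powr \<theta>) * K))"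
      unfolding K_def k_def using A nn_integral_parallel_kernel_scale by (intro sum.cong refl arg_cong2[where f = "(*)"]) blast
    also have "\<dots> = (\<Sum>i\<in>A. ennreal (c i * x i powr \<theta>) * K)"
      using A by (intro sum.cong refl) (simp add: ennreal_mult mult.assoc)
    also have "\<dots> = ennreal (\<Sum>i\<in>A. c i * x i powr \<theta>) * K"
      using A by (simp add: sum_ennreal flip: sum_distrib_right)
    finally show ?thesis .
  qed
  have "ennreal (\<Sum>i\<in>I. c i * x i powr \<theta>) * K = (\<integral>\<^sup>+t. ennreal (\<Sum>i\<in>I. c i * k (x i) t) \<partial>lborel)"
    by (rule sum[symmetric]) (use fin nonneg in auto)
  also have "\<dots> \<le> (\<integral>\<^sup>+t. ennreal (\<Sum>j\<in>J. d j * k (y j) t) \<partial>lborel)"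
  proof (intro nn_integral_mono ennreal_leI)
    fix t :: real
    show "(\<Sum>i\<in>I. c i * k (x i) t) \<le> (\<Sum>j\<in>J. d j * k (y j) t)"
    proof (cases "t > 0")
      case True
      have k: "k x t = t powr (\<theta> - 2) * (x * t / (x + t))" for x
      proof -
        have "t powr (\<theta> - 1) = t * t powr (\<theta> - 2)" using True by (simp add: powr_mult_base)
        then show ?thesis using True by (simp add: k_def parallel_kernel_def)
      qed
      have "(\<Sum>i\<in>I. c i * k (x i) t) = t powr (\<theta> - 2) * (\<Sum>i\<in>I. c i * (x i * t / (x i + t)))"
        by (simp only: k sum_distrib_left mult.left_commute)
      also have "\<dots> \<le> t powr (\<theta> - 2) * (\<Sum>j\<in>J. d j * (y j * t / (y j + t)))"
        using le[OF True] by (intro mult_left_mono) auto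
      also have "\<dots> = (\<Sum>j\<in>J. d j * k (y j) t)"
        by (simp only: k sum_distrib_left mult.left_commute)
      finally show ?thesis .
    qed (simp add: k_def)
  qed
  also have "\<dots> = ennreal (\<Sum>j\<in>J. d j * y j powr \<theta>) * K"
    by (rule sum) (use fin nonneg in auto)
  finally have "ennreal (\<Sum>i\<in>I. c i * x i powr \<theta>) \<le> ennreal (\<Sum>j\<in>J. d j * y j powr \<theta>)"
    using K ennreal_mult_le_mult_iff[of K] by (simp add: mult.commute[of _ K])
  then show ?thesis using nonneg by (subst (asm) ennreal_le_iff) (auto intro!: sum_nonneg)
qed

section \<open>The trace Bregman divergence of self-adjoint maps\<close>

definition eigenbasis :: "('a::euclidean_space \<Rightarrow> 'a) \<Rightarrow> 'a set \<Rightarrow> bool" where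
  "eigenbasis T B \<longleftrightarrow> onb B \<and> (\<forall>b\<in>B. T b = (b \<bullet> T b) *\<^sub>R b)"

lemma eigenbasis_exists:
  fixes T :: "'a::euclidean_space \<Rightarrow> 'a"
  assumes "linear T" "\<And>x y. T x \<bullet> y = x \<bullet> T y"
  obtains B where "eigenbasis T B"
  using self_adjoint_eigenbasis[OF assms] unfolding eigenbasis_def by metis

lemma eigenbasis_norm:
  assumes "eigenbasis T B" "b \<in> B" shows "norm (T b) = \<bar>b \<bullet> T b\<bar>"
proof -
  have "T b = (b \<bullet> T b) *\<^sub>R b" "norm b = 1" using assms by (auto simp: eigenbasis_def onb_def)
  then show ?thesis by (metis norm_scaleR mult.right_neutral)
qed

lemma eigenbasis_singular_basis:
  assumes "eigenbasis T B" shows "singular_basis T B"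
proof -
  have B: "onb B" "\<And>b. b \<in> B \<Longrightarrow> T b = (b \<bullet> T b) *\<^sub>R b" using assms by (auto simp: eigenbasis_def)
  have "T b \<bullet> T c = 0" if "b \<in> B" "c \<in> B" "b \<noteq> c" for b c
  proof -
    have "T b \<bullet> T c = ((b \<bullet> T b) *\<^sub>R b) \<bullet> ((c \<bullet> T c) *\<^sub>R c)" using B(2) that by metis
    then show ?thesis using onb_inner[OF B(1)] that by simp
  qed
  then show ?thesis using B by (auto simp: singular_basis_def pairwise_def)
qed

lemma Snorm_powr_eigenbasis:
  assumes "linear T" "eigenbasis T B" "2 \<le> p"
  shows "Snorm p T powr p = (\<Sum>b\<in>B. \<bar>b \<bullet> T b\<bar> powr p)"
  unfolding Snorm_powr[OF assms(1) eigenbasis_singular_basis[OF assms(2)] assms(3)]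
  using eigenbasis_norm[OF assms(2)] by simp

text \<open>The squared expression is the \<open>(u, w)\<close> entry of the map that is diagonal in
  \<open>V\<close> with eigenvalues \<open>x k\<close>. For a weight depending on \<open>u\<close>
  alone, Parseval over \<open>W\<close> yields the squared norm of the image of \<open>u\<close>,
  which is then expanded in \<open>V\<close>; weights depending on \<open>w\<close> are
  symmetric.\<close>

lemma onb_double_sum:
  fixes U W V :: "'a::euclidean_space set"
  assumes U: "onb U" and W: "onb W" and V: "onb V"
  shows "(\<Sum>u\<in>U. \<Sum>w\<in>W. (\<Sum>k\<in>V. x k * (k \<bullet> u) * (k \<bullet> w))\<^sup>2 * (g u + h w))
    = (\<Sum>k\<in>V. (x k)\<^sup>2 * ((\<Sum>u\<in>U. (k \<bullet> u)\<^sup>2 * g u) + (\<Sum>w\<in>W. (k \<bullet> w)\<^sup>2 * h w)))"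
proof -
  have fin: "finite V" using V by (rule onb_finite)
  have row: "(\<Sum>w\<in>W. (\<Sum>k\<in>V. x k * (k \<bullet> u) * (k \<bullet> w))\<^sup>2) = (\<Sum>k\<in>V. (x k)\<^sup>2 * (k \<bullet> u)\<^sup>2)"
    if W: "onb W" for u and W :: "'a set"
  proof -
    define z where "z = (\<Sum>k\<in>V. (x k * (k \<bullet> u)) *\<^sub>R k)"
    have zk: "z \<bullet> k = x k * (k \<bullet> u)" if "k \<in> V" for k
    proof -
      have "z \<bullet> k = (\<Sum>l\<in>V. if l = k then x k * (k \<bullet> u) else 0)"
        unfolding z_def inner_sum_left using that by (intro sum.cong) (auto simp: onb_inner[OF V])
      then show ?thesis using fin that by simp
    qed
    have "(\<Sum>w\<in>W. (\<Sum>k\<in>V. x k * (k \<bullet> u) * (k \<bullet> w))\<^sup>2) = (\<Sum>w\<in>W. (z \<bullet> w)\<^sup>2)"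
      unfolding z_def by (simp add: inner_sum_left)
    also have "\<dots> = (\<Sum>k\<in>V. (z \<bullet> k)\<^sup>2)" by (simp add: onb_Parseval_norm W V)
    also have "\<dots> = (\<Sum>k\<in>V. (x k)\<^sup>2 * (k \<bullet> u)\<^sup>2)" by (simp add: zk power_mult_distrib)
    finally show ?thesis .
  qed
  define Q where "Q u w = (\<Sum>k\<in>V. x k * (k \<bullet> u) * (k \<bullet> w))\<^sup>2" for u w
  have Q_sym: "Q u w = Q w u" for u w unfolding Q_def by (simp add: mult_ac)
  have "(\<Sum>u\<in>U. \<Sum>w\<in>W. Q u w * (g u + h w)) = (\<Sum>u\<in>U. \<Sum>w\<in>W. Q u w * g u) + (\<Sum>u\<in>U. \<Sum>w\<in>W. Q u w * h w)"
    by (simp only: distrib_left sum.distrib)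
  also have "(\<Sum>u\<in>U. \<Sum>w\<in>W. Q u w * h w) = (\<Sum>w\<in>W. \<Sum>u\<in>U. Q w u * h w)"
    by (subst sum.swap) (simp only: Q_sym)
  also have "(\<Sum>w\<in>W. \<Sum>u\<in>U. Q w u * h w) = (\<Sum>w\<in>W. \<Sum>k\<in>V. (x k)\<^sup>2 * ((k \<bullet> w)\<^sup>2 * h w))"
    unfolding Q_def sum_distrib_right[symmetric] row[OF U] by (simp only: sum_distrib_right mult.assoc)
  also have "(\<Sum>u\<in>U. \<Sum>w\<in>W. Q u w * g u) = (\<Sum>u\<in>U. \<Sum>k\<in>V. (x k)\<^sup>2 * ((k \<bullet> u)\<^sup>2 * g u))"
    unfolding Q_def sum_distrib_right[symmetric] row[OF W] by (simp only: sum_distrib_right mult.assoc)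
  also have "(\<Sum>u\<in>U. \<Sum>k\<in>V. (x k)\<^sup>2 * ((k \<bullet> u)\<^sup>2 * g u)) + (\<Sum>w\<in>W. \<Sum>k\<in>V. (x k)\<^sup>2 * ((k \<bullet> w)\<^sup>2 * h w))
      = (\<Sum>k\<in>V. (x k)\<^sup>2 * ((\<Sum>u\<in>U. (k \<bullet> u)\<^sup>2 * g u) + (\<Sum>w\<in>W. (k \<bullet> w)\<^sup>2 * h w)))"
    by (subst sum.swap[where A = U], subst sum.swap[where A = W]) (simp only: distrib_left sum.distrib sum_distrib_left)
  finally show ?thesis unfolding Q_def .
qed

text \<open>Completing the square: the parallel sum of \<open>\<tau>\<close> and \<open>t\<close> is
  the minimum over \<open>x\<close> of the right side, for \<open>y = 1\<close>. The minimizer is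
  \<open>x = t * y / (\<tau> + t)\<close>.\<close>

lemma parallel_sum_le:
  fixes x y \<tau> t :: real
  assumes "0 \<le> \<tau>" "0 < t"
  shows "y\<^sup>2 * (\<tau> * t / (\<tau> + t)) \<le> x\<^sup>2 * \<tau> + (y - x)\<^sup>2 * t"
proof -
  have "y\<^sup>2 * (\<tau> * t) + ((\<tau> + t) * x - t * y)\<^sup>2 = (x\<^sup>2 * \<tau> + (y - x)\<^sup>2 * t) * (\<tau> + t)"
    by (simp add: power2_eq_square algebra_simps)
  then have "y\<^sup>2 * (\<tau> * t) \<le> (x\<^sup>2 * \<tau> + (y - x)\<^sup>2 * t) * (\<tau> + t)"
    by (metis le_add_same_cancel1 zero_le_power2)
  then show ?thesis using assms by (simp add: pos_divide_le_eq)
qed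

lemma parallel_sum_eq:
  fixes y \<tau> t :: real
  assumes "0 \<le> \<tau>" "0 < t" and x: "x = t * y / (\<tau> + t)"
  shows "x\<^sup>2 * \<tau> + (y - x)\<^sup>2 * t = y\<^sup>2 * (\<tau> * t / (\<tau> + t))"
proof -
  have pos: "\<tau> + t > 0" using assms by simp
  have "y\<^sup>2 * (\<tau> * t) + ((\<tau> + t) * x - t * y)\<^sup>2 = (x\<^sup>2 * \<tau> + (y - x)\<^sup>2 * t) * (\<tau> + t)"
    by (simp add: power2_eq_square algebra_simps)
  moreover have "(\<tau> + t) * x - t * y = 0" using pos unfolding x by simp
  ultimately show ?thesis using pos by (simp add: eq_divide_eq)
qed

text \<open>
  An instance of operator concavity of \<open>x\<^sup>\<theta>\<close>.  A parallel sum is an infimum over decompositions of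
  \<open>y\<close>; testing it with decompositions that are diagonal in the basis \<open>V\<close> gives the bound.
\<close>
lemma onb_double_sum_powr_le:
  fixes U W V :: "'a::euclidean_space set"
  assumes onb: "onb U" "onb W" "onb V" and \<theta>: "0 < \<theta>" "\<theta> < 1"
    and nonneg: "\<And>u. 0 \<le> g u" "\<And>w. 0 \<le> h w"
  shows "(\<Sum>u\<in>U. \<Sum>w\<in>W. (\<Sum>k\<in>V. y k * (k \<bullet> u) * (k \<bullet> w))\<^sup>2 * (g u + h w) powr \<theta>)
    \<le> (\<Sum>k\<in>V. (y k)\<^sup>2 * ((\<Sum>u\<in>U. (k \<bullet> u)\<^sup>2 * g u) + (\<Sum>w\<in>W. (k \<bullet> w)\<^sup>2 * h w)) powr \<theta>)"
proof -
  define z where "z x u w = (\<Sum>k\<in>V. x k * (k \<bullet> u) * (k \<bullet> w))" for x u w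
  define d where "d k = (\<Sum>u\<in>U. (k \<bullet> u)\<^sup>2 * g u) + (\<Sum>w\<in>W. (k \<bullet> w)\<^sup>2 * h w)" for k
  have d: "0 \<le> d k" for k
    unfolding d_def using nonneg by (intro add_nonneg_nonneg sum_nonneg mult_nonneg_nonneg) auto
  have fin: "finite U" "finite W" "finite V" using onb onb_finite by auto
  have "(\<Sum>i\<in>U \<times> W. (z y (fst i) (snd i))\<^sup>2 * (g (fst i) + h (snd i)) powr \<theta>) \<le> (\<Sum>k\<in>V. (y k)\<^sup>2 * d k powr \<theta>)"
  proof (rule sum_powr_le_if_parallel_sum_le)
    fix t :: real assume t: "0 < t"
    \<comment> \<open>The optimal splitting of \<open>y k\<close> against the averaged weight
      \<open>d k\<close>. It is merely admissible for the individual pairs \<open>(u, w)\<close>,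
      which gives the direction of the inequality.\<close>
    define x where "x k = t * y k / (d k + t)" for k
    have zdiff: "z y u w - z x u w = z (\<lambda>k. y k - x k) u w" for u w
      unfolding z_def by (simp add: sum_subtractf left_diff_distrib)
    have "(\<Sum>i\<in>U \<times> W. (z y (fst i) (snd i))\<^sup>2 * ((g (fst i) + h (snd i)) * t / (g (fst i) + h (snd i) + t)))
        = (\<Sum>u\<in>U. \<Sum>w\<in>W. (z y u w)\<^sup>2 * ((g u + h w) * t / (g u + h w + t)))"
      by (simp add: sum.cartesian_product case_prod_beta)
    \<comment> \<open>The constant weight \<open>t\<close> is written as \<open>t + 0\<close> so
      that \<open>onb_double_sum\<close> also applies to the second term.\<close>
    also have "\<dots> \<le> (\<Sum>u\<in>U. \<Sum>w\<in>W. (z x u w)\<^sup>2 * (g u + h w) + (z (\<lambda>k. y k - x k) u w)\<^sup>2 * (t + 0))"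
      unfolding zdiff[symmetric] add_0_right using t nonneg by (intro sum_mono parallel_sum_le) (auto intro: add_nonneg_nonneg)
    also have "\<dots> = (\<Sum>k\<in>V. (x k)\<^sup>2 * d k) + (\<Sum>k\<in>V. (y k - x k)\<^sup>2 * ((\<Sum>u\<in>U. (k \<bullet> u)\<^sup>2 * t) + (\<Sum>w\<in>W. (k \<bullet> w)\<^sup>2 * 0)))"
      unfolding z_def d_def sum.distrib onb_double_sum[OF onb, of _ "\<lambda>_. t" "\<lambda>_. 0"] onb_double_sum[OF onb, of _ g h] ..
    also have "\<dots> = (\<Sum>k\<in>V. (x k)\<^sup>2 * d k + (y k - x k)\<^sup>2 * t)"
    proof -
      have "(\<Sum>u\<in>U. (k \<bullet> u)\<^sup>2 * t) = t" if "k \<in> V" for k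
        using onb_weight_sum[OF onb(1,3) that] by (simp flip: sum_distrib_right)
      then show ?thesis by (simp add: sum.distrib)
    qed
    also have "\<dots> = (\<Sum>k\<in>V. (y k)\<^sup>2 * (d k * t / (d k + t)))"
      using d t by (intro sum.cong refl parallel_sum_eq) (auto simp: x_def)
    finally show "(\<Sum>i\<in>U \<times> W. (z y (fst i) (snd i))\<^sup>2 * ((g (fst i) + h (snd i)) * t / (g (fst i) + h (snd i) + t)))
        \<le> (\<Sum>k\<in>V. (y k)\<^sup>2 * (d k * t / (d k + t)))" .
  qed (use fin \<theta> d nonneg in \<open>auto intro: add_nonneg_nonneg\<close>)
  then show ?thesis unfolding z_def d_def by (simp add: sum.cartesian_product case_prod_beta)
qed

section \<open>Second-order Taylor bound for the trace of a power\<close>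

locale self_adjoint_difference =
  fixes S T Y :: "'a::euclidean_space \<Rightarrow> 'a" and U W V :: "'a set"
  assumes lin: "linear S" "linear T" "linear Y"
    and self_adjoint: "\<And>x y. S x \<bullet> y = x \<bullet> S y" "\<And>x y. T x \<bullet> y = x \<bullet> T y" "\<And>x y. Y x \<bullet> y = x \<bullet> Y y"
    and diff: "\<And>x. T x = S x + Y x"
    and eig: "eigenbasis S U" "eigenbasis T W" "eigenbasis Y V"
begin

abbreviation "a u \<equiv> u \<bullet> S u"
abbreviation "b w \<equiv> w \<bullet> T w"
abbreviation "y k \<equiv> k \<bullet> Y k"

lemma onb: "onb U" "onb W" "onb V"
  using eig by (auto simp: eigenbasis_def)

lemma fin: "finite U" "finite W" "finite V"
  using onb onb_finite by auto

text \<open>Squared, this exchanges the eigenvalue gap \<open>(b w - a u)\<^sup>2\<close> of a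
  scalar Taylor bound, weighted by \<open>(u \<bullet> w)\<^sup>2\<close>, for an entry of
  \<open>Y\<close>, in which no eigenvalue of \<open>S\<close> or \<open>T\<close> occurs.\<close>

lemma entry:
  assumes "u \<in> U" "w \<in> W" shows "(b w - a u) * (u \<bullet> w) = u \<bullet> Y w"
proof -
  have "T w = b w *\<^sub>R w" "S u = a u *\<^sub>R u" using eig assms by (auto simp: eigenbasis_def)
  then have "u \<bullet> T w = b w * (u \<bullet> w)" "S u \<bullet> w = a u * (u \<bullet> w)" by (metis inner_scaleR_left inner_scaleR_right)+
  then show ?thesis using diff[of w] self_adjoint(1)[of u w] by (simp add: inner_add_right algebra_simps)
qed

lemma entry_expansion: "u \<bullet> Y w = (\<Sum>k\<in>V. y k * (k \<bullet> u) * (k \<bullet> w))"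
proof -
  have "u \<bullet> Y w = (\<Sum>k\<in>V. (u \<bullet> k) * (Y w \<bullet> k))" by (simp add: onb_Parseval[OF onb(3)])
  also have "\<dots> = (\<Sum>k\<in>V. y k * (k \<bullet> u) * (k \<bullet> w))"
  proof (intro sum.cong refl)
    fix k assume "k \<in> V"
    then have "Y k = y k *\<^sub>R k" using eig by (auto simp: eigenbasis_def)
    then have "Y w \<bullet> k = y k * (k \<bullet> w)" by (metis self_adjoint(3) inner_commute inner_scaleR_right)
    then show "(u \<bullet> k) * (Y w \<bullet> k) = y k * (k \<bullet> u) * (k \<bullet> w)" by (simp add: inner_commute)
  qed
  finally show ?thesis .
qed

text \<open>The weights \<open>(u \<bullet> w)\<^sup>2\<close> are doubly stochastic, so the two
  power terms collapse to traces. In the linear term \<open>entry\<close> turns one factor into an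
  entry of \<open>Y\<close>, and Parseval over \<open>W\<close> leaves the diagonal entry at
  \<open>u\<close>.\<close>

lemma Bregman_double_sum:
  "Snorm p T powr p - Snorm p S powr p - (\<Sum>u\<in>U. p * a u * \<bar>a u\<bar> powr (p - 2) * (u \<bullet> Y u))
    = (\<Sum>u\<in>U. \<Sum>w\<in>W. (u \<bullet> w)\<^sup>2 * powr_Bregman p (b w) (a u))" if p: "2 \<le> p"
proof -
  let ?f = "\<lambda>x::real. \<bar>x\<bar> powr p" and ?f' = "\<lambda>x. p * x * \<bar>x\<bar> powr (p - 2)"
  have "(\<Sum>u\<in>U. \<Sum>w\<in>W. (u \<bullet> w)\<^sup>2 * powr_Bregman p (b w) (a u))
      = (\<Sum>u\<in>U. \<Sum>w\<in>W. (u \<bullet> w)\<^sup>2 * ?f (b w)) - (\<Sum>u\<in>U. (\<Sum>w\<in>W. (u \<bullet> w)\<^sup>2) * ?f (a u))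
      - (\<Sum>u\<in>U. ?f' (a u) * (\<Sum>w\<in>W. (u \<bullet> w) * ((b w - a u) * (u \<bullet> w))))"
    unfolding powr_Bregman_def
    by (simp only: sum_distrib_left sum_distrib_right flip: sum_subtractf)
       (intro sum.cong refl, simp add: algebra_simps power2_eq_square)
  also have "(\<Sum>u\<in>U. \<Sum>w\<in>W. (u \<bullet> w)\<^sup>2 * ?f (b w)) = (\<Sum>w\<in>W. (\<Sum>u\<in>U. (w \<bullet> u)\<^sup>2) * ?f (b w))"
    by (subst sum.swap) (simp add: inner_commute sum_distrib_right)
  also have "\<dots> = (\<Sum>w\<in>W. ?f (b w))" using onb_weight_sum[OF onb(1,2)] by simp
  also have "(\<Sum>u\<in>U. (\<Sum>w\<in>W. (u \<bullet> w)\<^sup>2) * ?f (a u)) = (\<Sum>u\<in>U. ?f (a u))"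
    using onb_weight_sum[OF onb(2,1)] by simp
  also have "(\<Sum>u\<in>U. ?f' (a u) * (\<Sum>w\<in>W. (u \<bullet> w) * ((b w - a u) * (u \<bullet> w)))) = (\<Sum>u\<in>U. ?f' (a u) * (u \<bullet> Y u))"
  proof (intro sum.cong refl arg_cong2[where f = "(*)"])
    fix u assume u: "u \<in> U"
    have "(\<Sum>w\<in>W. (u \<bullet> w) * ((b w - a u) * (u \<bullet> w))) = (\<Sum>w\<in>W. (u \<bullet> w) * (Y u \<bullet> w))"
      using entry[OF u] self_adjoint(3)[of u] by (intro sum.cong) auto
    then show "(\<Sum>w\<in>W. (u \<bullet> w) * ((b w - a u) * (u \<bullet> w))) = u \<bullet> Y u" by (simp add: onb_Parseval[OF onb(2)])
  qed
  finally show ?thesis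
    using p by (simp add: Snorm_powr_eigenbasis[OF lin(2) eig(2)] Snorm_powr_eigenbasis[OF lin(1) eig(1)])
qed

text \<open>The diagonal entry at \<open>k\<close> of \<open>2/3 f(S) + 1/3 f(T)\<close> in
  functional calculus, with the coefficients of the scalar Bregman bounds.\<close>

definition mix :: "(real \<Rightarrow> real) \<Rightarrow> 'a \<Rightarrow> real" where
  "mix f k = (\<Sum>u\<in>U. (k \<bullet> u)\<^sup>2 * (2/3 * f (a u))) + (\<Sum>w\<in>W. (k \<bullet> w)\<^sup>2 * (1/3 * f (b w)))"

lemma mix_nonneg: "(\<And>x. 0 \<le> f x) \<Longrightarrow> 0 \<le> mix f k"
  unfolding mix_def by (intro add_nonneg_nonneg sum_nonneg mult_nonneg_nonneg) auto

lemma mix_powr_le: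
  assumes "k \<in> V" "\<And>x. 0 \<le> f x" "1 \<le> r"
  shows "mix f k powr r \<le> mix (\<lambda>x. f x powr r) k"
proof -
  have 1: "mix f k = 2/3 * (\<Sum>u\<in>U. (k \<bullet> u)\<^sup>2 * f (a u)) + 1/3 * (\<Sum>w\<in>W. (k \<bullet> w)\<^sup>2 * f (b w))" for f
    unfolding mix_def sum_distrib_left by (simp add: algebra_simps)
  have "mix f k powr r \<le> 2/3 * (\<Sum>u\<in>U. (k \<bullet> u)\<^sup>2 * f (a u)) powr r + 1/3 * (\<Sum>w\<in>W. (k \<bullet> w)\<^sup>2 * f (b w)) powr r"
    unfolding 1 using assms by (intro powr_add_Jensen sum_nonneg mult_nonneg_nonneg) auto
  also have "\<dots> \<le> 2/3 * (\<Sum>u\<in>U. (k \<bullet> u)\<^sup>2 * f (a u) powr r) + 1/3 * (\<Sum>w\<in>W. (k \<bullet> w)\<^sup>2 * f (b w) powr r)"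
    using assms fin onb_weight_sum[OF onb(1) onb(3) assms(1)] onb_weight_sum[OF onb(2) onb(3) assms(1)]
    by (intro add_mono mult_left_mono powr_sum_Jensen) auto
  finally show ?thesis unfolding 1 .
qed

lemma sum_mix: "(\<Sum>k\<in>V. mix f k) = 2/3 * (\<Sum>u\<in>U. f (a u)) + 1/3 * (\<Sum>w\<in>W. f (b w))"
proof -
  have *: "(\<Sum>k\<in>V. \<Sum>u\<in>B. (k \<bullet> u)\<^sup>2 * h u) = (\<Sum>u\<in>B. h u)" if "onb B" for h and B :: "'a set"
    using onb_weight_sum[OF onb(3) that]
    by (subst sum.swap) (simp add: inner_commute flip: sum_distrib_right)
  show ?thesis unfolding mix_def sum.distrib *[OF onb(1)] *[OF onb(2)] sum_distrib_left ..
qed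

text \<open>The scalar Bregman bounds give a weighted double sum of squared entries of
  \<open>Y\<close>. It reduces to a sum over the eigenbasis of \<open>Y\<close> with weights
  controlled by \<open>mix\<close>, and Hoelder with exponents \<open>p / 2\<close> and
  \<open>p / (p - 2)\<close> separates \<open>Y\<close> from the two endpoints.\<close>

lemma Snorm_Bregman_le:
  assumes p: "2 \<le> p"
  shows "Snorm p T powr p - Snorm p S powr p - (\<Sum>u\<in>U. p * a u * \<bar>a u\<bar> powr (p - 2) * (u \<bullet> Y u))
    \<le> p * (p - 1) / 2 * (Snorm p Y)\<^sup>2 * (2/3 * Snorm p S powr p + 1/3 * Snorm p T powr p) powr ((p - 2) / p)"
proof (cases "Snorm p S = 0 \<and> Snorm p T = 0")
  \<comment> \<open>Split off because \<open>0 powr 0\<close> is 0: at \<open>p = 2\<close> the last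
    factor equals 1 only for a positive base.\<close>
  case True
  then have "(\<Sum>u\<in>U. \<bar>a u\<bar> powr p) = 0"
    using Snorm_powr_eigenbasis[OF lin(1) eig(1) p] by simp
  then have "\<forall>u\<in>U. a u = 0" using fin by (simp add: sum_nonneg_eq_0_iff)
  then show ?thesis using True by simp
next
  case False
  then have pos: "0 < 2/3 * Snorm p S powr p + 1/3 * Snorm p T powr p"
  proof -
    have "0 < Snorm p S powr p \<or> 0 < Snorm p T powr p" using False by simp
    moreover have "0 \<le> Snorm p S powr p" "0 \<le> Snorm p T powr p" by simp_all
    ultimately show ?thesis by linarith
  qed
  define M where "M = 2/3 * Snorm p S powr p + 1/3 * Snorm p T powr p"
  have M: "M = 2/3 * (\<Sum>u\<in>U. \<bar>a u\<bar> powr p) + 1/3 * (\<Sum>w\<in>W. \<bar>b w\<bar> powr p)"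
    unfolding M_def using p
    by (simp add: Snorm_powr_eigenbasis[OF lin(2) eig(2)] Snorm_powr_eigenbasis[OF lin(1) eig(1)])
  define c where "c = p * (p - 1) / 2"
  have c: "0 \<le> c" using p unfolding c_def by simp
  have Yp: "(\<Sum>k\<in>V. \<bar>y k\<bar> powr p) = Snorm p Y powr p"
    using Snorm_powr_eigenbasis[OF lin(3) eig(3) p] by simp
  have sq: "(u \<bullet> w)\<^sup>2 * (c * (b w - a u)\<^sup>2 * m) = c * ((\<Sum>k\<in>V. y k * (k \<bullet> u) * (k \<bullet> w))\<^sup>2 * m)"
    if "u \<in> U" "w \<in> W" for u w m
    unfolding entry_expansion[symmetric] entry[OF that, symmetric] by (simp add: power_mult_distrib)
  have Bregman_sum: "(\<Sum>u\<in>U. \<Sum>w\<in>W. (u \<bullet> w)\<^sup>2 * powr_Bregman p (b w) (a u))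
      \<le> c * (\<Sum>u\<in>U. \<Sum>w\<in>W. (\<Sum>k\<in>V. y k * (k \<bullet> u) * (k \<bullet> w))\<^sup>2 * m u w)"
    if "\<And>u w. powr_Bregman p (b w) (a u) \<le> c * (b w - a u)\<^sup>2 * m u w" for m
  proof -
    have "(\<Sum>u\<in>U. \<Sum>w\<in>W. (u \<bullet> w)\<^sup>2 * powr_Bregman p (b w) (a u))
        \<le> (\<Sum>u\<in>U. \<Sum>w\<in>W. (u \<bullet> w)\<^sup>2 * (c * (b w - a u)\<^sup>2 * m u w))"
      using that by (intro sum_mono mult_left_mono) auto
    also have "\<dots> = (\<Sum>u\<in>U. \<Sum>w\<in>W. c * ((\<Sum>k\<in>V. y k * (k \<bullet> u) * (k \<bullet> w))\<^sup>2 * m u w))"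
      by (intro sum.cong refl sq)
    finally show ?thesis by (simp add: sum_distrib_left)
  qed
  have Hoelder: "(\<Sum>k\<in>V. (y k)\<^sup>2 * e k) \<le> (Snorm p Y)\<^sup>2 * M powr ((p - 2) / p)"
    if p': "2 < p" and e: "\<And>k. k \<in> V \<Longrightarrow> 0 \<le> e k"
      and le: "\<And>k. k \<in> V \<Longrightarrow> e k powr (p / (p - 2)) \<le> mix (\<lambda>x. \<bar>x\<bar> powr p) k" for e
  proof -
    have s: "0 < 2 / p" "2 / p < 1" "1 - 2 / p = (p - 2) / p" using p' by (auto simp: field_simps)
    have "(\<Sum>k\<in>V. (y k)\<^sup>2 * e k) = (\<Sum>k\<in>V. (\<bar>y k\<bar> powr p) powr (2 / p) * (e k powr (p / (p - 2))) powr (1 - 2 / p))"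
      unfolding s(3) using p' e by (intro sum.cong refl) (simp add: powr_powr)
    also have "\<dots> \<le> (\<Sum>k\<in>V. \<bar>y k\<bar> powr p) powr (2 / p) * (\<Sum>k\<in>V. e k powr (p / (p - 2))) powr (1 - 2 / p)"
      using fin s by (intro Holder_sum) auto
    also have "(\<Sum>k\<in>V. \<bar>y k\<bar> powr p) powr (2 / p) = (Snorm p Y)\<^sup>2"
      unfolding Yp using p by (simp add: powr_powr)
    also have "(\<Sum>k\<in>V. e k powr (p / (p - 2))) powr (1 - 2 / p) \<le> M powr ((p - 2) / p)"
    proof -
      have "(\<Sum>k\<in>V. e k powr (p / (p - 2))) \<le> (\<Sum>k\<in>V. mix (\<lambda>x. \<bar>x\<bar> powr p) k)"
        using le by (intro sum_mono)
      also have "\<dots> = M" unfolding sum_mix M ..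
      finally show ?thesis unfolding s(3) using p by (intro powr_mono2 sum_nonneg) auto
    qed
    finally show ?thesis by (simp add: mult_left_mono)
  qed
  consider "p = 2" | "2 < p" "p < 3" | "3 \<le> p" using p by linarith
  then have "(\<Sum>u\<in>U. \<Sum>w\<in>W. (u \<bullet> w)\<^sup>2 * powr_Bregman p (b w) (a u))
      \<le> c * ((Snorm p Y)\<^sup>2 * M powr ((p - 2) / p))"
  proof cases
    case 1
    \<comment> \<open>For \<open>p = 2\<close> the divergence is exactly
      \<open>(b w - a u)\<^sup>2\<close> and \<open>c = 1\<close>. The unit weight appears as
      \<open>1 + 0\<close> to match \<open>onb_double_sum\<close>.\<close>
    have "(\<Sum>u\<in>U. \<Sum>w\<in>W. (u \<bullet> w)\<^sup>2 * powr_Bregman p (b w) (a u))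
        \<le> c * (\<Sum>u\<in>U. \<Sum>w\<in>W. (\<Sum>k\<in>V. y k * (k \<bullet> u) * (k \<bullet> w))\<^sup>2 * (1 + 0))"
      using 1 by (intro Bregman_sum) (auto simp: powr_Bregman_def c_def power2_eq_square algebra_simps)
    also have "\<dots> = c * (\<Sum>k\<in>V. (y k)\<^sup>2)"
      unfolding onb_double_sum[OF onb, of _ "\<lambda>_. 1" "\<lambda>_. 0"] using onb_weight_sum[OF onb(1,3)] by simp
    also have "(\<Sum>k\<in>V. (y k)\<^sup>2) = (Snorm p Y)\<^sup>2"
      using Yp 1 by simp
    also have "\<dots> = (Snorm p Y)\<^sup>2 * M powr ((p - 2) / p)"
      using 1 pos unfolding M_def by simp
    finally show ?thesis .
  next
    case 2
    define d where "d = mix (\<lambda>x. \<bar>x\<bar>)"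
    have d: "0 \<le> d k" for k unfolding d_def by (intro mix_nonneg) auto
    have "(\<Sum>u\<in>U. \<Sum>w\<in>W. (u \<bullet> w)\<^sup>2 * powr_Bregman p (b w) (a u))
        \<le> c * (\<Sum>u\<in>U. \<Sum>w\<in>W. (\<Sum>k\<in>V. y k * (k \<bullet> u) * (k \<bullet> w))\<^sup>2 * (2/3 * \<bar>a u\<bar> + 1/3 * \<bar>b w\<bar>) powr (p - 2))"
      unfolding c_def using 2 by (intro Bregman_sum[unfolded c_def] powr_Bregman_le_concave) auto
    also have "\<dots> \<le> c * (\<Sum>k\<in>V. (y k)\<^sup>2 * d k powr (p - 2))"
      unfolding d_def mix_def using 2 onb c by (intro mult_left_mono onb_double_sum_powr_le) auto
    also have "\<dots> \<le> c * ((Snorm p Y)\<^sup>2 * M powr ((p - 2) / p))"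
    proof (intro mult_left_mono Hoelder)
      fix k assume "k \<in> V"
      then show "(d k powr (p - 2)) powr (p / (p - 2)) \<le> mix (\<lambda>x. \<bar>x\<bar> powr p) k"
        using 2 mix_powr_le[of k "\<lambda>x. \<bar>x\<bar>" p] unfolding d_def by (simp add: powr_powr)
    qed (use 2 c in auto)
    finally show ?thesis .
  next
    case 3
    define d where "d = mix (\<lambda>x. \<bar>x\<bar> powr (p - 2))"
    have d: "0 \<le> d k" for k unfolding d_def by (intro mix_nonneg) auto
    have "(\<Sum>u\<in>U. \<Sum>w\<in>W. (u \<bullet> w)\<^sup>2 * powr_Bregman p (b w) (a u))
        \<le> c * (\<Sum>u\<in>U. \<Sum>w\<in>W. (\<Sum>k\<in>V. y k * (k \<bullet> u) * (k \<bullet> w))\<^sup>2 * (2/3 * \<bar>a u\<bar> powr (p - 2) + 1/3 * \<bar>b w\<bar> powr (p - 2)))"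
      unfolding c_def using 3 by (intro Bregman_sum[unfolded c_def] powr_Bregman_le_convex) auto
    also have "\<dots> = c * (\<Sum>k\<in>V. (y k)\<^sup>2 * d k)"
      unfolding d_def mix_def by (subst onb_double_sum[OF onb]) simp
    also have "\<dots> \<le> c * ((Snorm p Y)\<^sup>2 * M powr ((p - 2) / p))"
    proof (intro mult_left_mono Hoelder)
      fix k assume k: "k \<in> V"
      have "p - 2 \<noteq> 0" "1 \<le> p / (p - 2)" using 3 by (auto simp: field_simps)
      then show "d k powr (p / (p - 2)) \<le> mix (\<lambda>x. \<bar>x\<bar> powr p) k"
        using mix_powr_le[OF k, of "\<lambda>x. \<bar>x\<bar> powr (p - 2)" "p / (p - 2)"] unfolding d_def by (simp add: powr_powr)
    qed (use 3 c d in auto)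
    finally show ?thesis .
  qed
  then show ?thesis unfolding Bregman_double_sum[OF p] c_def M_def by (simp add: mult.assoc)
qed

end

section \<open>Uniform smoothness of Schatten norms\<close>

lemma linear_add_scaleR:
  assumes "linear A" "linear Y" shows "linear (\<lambda>x. A x + t *\<^sub>R Y x)"
  using assms by (intro linear_compose_add linear_compose_scale_right)

lemma Snorm_Lipschitz:
  assumes "linear A" "linear Y" "2 \<le> p"
  shows "Snorm p (\<lambda>x. A x + t *\<^sub>R Y x) \<le> Snorm p (\<lambda>x. A x + s *\<^sub>R Y x) + \<bar>t - s\<bar> * Snorm p Y"
proof -
  have "(\<lambda>x. A x + t *\<^sub>R Y x) = (\<lambda>x. (A x + s *\<^sub>R Y x) + (t - s) *\<^sub>R Y x)"
    by (simp add: algebra_simps)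
  then have "Snorm p (\<lambda>x. A x + t *\<^sub>R Y x) \<le> Snorm p (\<lambda>x. A x + s *\<^sub>R Y x) + Snorm p (\<lambda>x. (t - s) *\<^sub>R Y x)"
    using assms by (simp only:) (intro Snorm_triangle linear_add_scaleR linear_compose_scale_right)
  then show ?thesis using assms by (simp add: Snorm_scale)
qed

text \<open>The Taylor bound is applied from \<open>t\<close> with increments \<open>h\<close> and
  \<open>- h\<close>. The number \<open>a\<close> dominates the norms at all three points and
  replaces the mixture of endpoint norms.\<close>

lemma Snorm_second_difference:
  fixes A Y :: "'a::euclidean_space \<Rightarrow> 'a"
  assumes lin: "linear A" "linear Y" and sa: "\<And>x y. A x \<bullet> y = x \<bullet> A y" "\<And>x y. Y x \<bullet> y = x \<bullet> Y y"
    and p: "2 \<le> p"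
  defines "N \<equiv> \<lambda>t. Snorm p (\<lambda>x. A x + t *\<^sub>R Y x)"
  assumes le: "N t < a" "N (t + h) \<le> a" "N (t - h) \<le> a"
  shows "N (t + h) powr p + N (t - h) powr p - 2 * N t powr p
    \<le> p * (p - 1) * h\<^sup>2 * (Snorm p Y)\<^sup>2 * a powr (p - 2)"
proof -
  define S where "S t x = A x + t *\<^sub>R Y x" for t x
  have linS: "linear (S t)" for t unfolding S_def using lin by (rule linear_add_scaleR)
  have saS: "S t x \<bullet> y = x \<bullet> S t y" for t x y
    unfolding S_def by (simp add: inner_add_left inner_add_right sa)
  have N: "N t = Snorm p (S t)" for t unfolding N_def S_def ..
  obtain U where U: "eigenbasis (S t) U" using eigenbasis_exists linS saS by blast
  define L where "L s = (\<Sum>u\<in>U. p * (u \<bullet> S t u) * \<bar>u \<bullet> S t u\<bar> powr (p - 2) * (u \<bullet> (s *\<^sub>R Y u)))" for s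
  have a: "0 < a" using le(1) by (smt (verit) N Snorm_nonneg)
  have step: "N (t + s) powr p - N t powr p - L s \<le> p * (p - 1) / 2 * h\<^sup>2 * (Snorm p Y)\<^sup>2 * a powr (p - 2)"
    if s: "\<bar>s\<bar> = \<bar>h\<bar>" "N (t + s) \<le> a" for s
  proof -
    have linY: "linear (\<lambda>x. s *\<^sub>R Y x)" using lin by (intro linear_compose_scale_right)
    have saY: "s *\<^sub>R Y x \<bullet> y = x \<bullet> s *\<^sub>R Y y" for x y by (simp add: sa)
    obtain W where W: "eigenbasis (S (t + s)) W" using eigenbasis_exists linS saS by blast
    obtain V where V: "eigenbasis (\<lambda>x. s *\<^sub>R Y x) V" using eigenbasis_exists[OF linY saY] by blast
    interpret D: self_adjoint_difference "S t" "S (t + s)" "\<lambda>x. s *\<^sub>R Y x" U W V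
      by (intro self_adjoint_difference.intro linS linY saS saY U V W) (simp add: S_def algebra_simps)
    define M where "M = 2/3 * N t powr p + 1/3 * N (t + s) powr p"
    have "M \<le> 2/3 * a powr p + 1/3 * a powr p"
      unfolding M_def using le s p by (intro add_mono mult_left_mono powr_mono2) (auto simp: N)
    then have "M powr ((p - 2) / p) \<le> (a powr p) powr ((p - 2) / p)"
      using p unfolding M_def by (intro powr_mono2) auto
    then have M: "M powr ((p - 2) / p) \<le> a powr (p - 2)" using p by (simp add: powr_powr)
    have "N (t + s) powr p - N t powr p - L s
        \<le> p * (p - 1) / 2 * (Snorm p (\<lambda>x. s *\<^sub>R Y x))\<^sup>2 * M powr ((p - 2) / p)"
      using D.Snorm_Bregman_le[OF p] unfolding N L_def M_def .
    also have "(Snorm p (\<lambda>x. s *\<^sub>R Y x))\<^sup>2 = h\<^sup>2 * (Snorm p Y)\<^sup>2"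
      using s(1) by (simp add: Snorm_scale lin p power_mult_distrib)
    also have "p * (p - 1) / 2 * (h\<^sup>2 * (Snorm p Y)\<^sup>2) * M powr ((p - 2) / p)
        \<le> p * (p - 1) / 2 * (h\<^sup>2 * (Snorm p Y)\<^sup>2) * a powr (p - 2)"
      using p M by (intro mult_left_mono) auto
    finally show ?thesis by (simp add: mult.assoc)
  qed
  \<comment> \<open>The first-order terms are odd in the increment and cancel in the second
    difference.\<close>
  have "L (- h) = - L h" unfolding L_def by (simp add: sum_negf)
  with step[of h] step[of "- h"] le show ?thesis by (simp add: field_simps)
qed

text \<open>
  Along the line \<open>A + t Y\<close>, the even function \<open>F\<close> averages the \<open>p\<close>-th powers of the norm at \<open>t\<close>
  and \<open>- t\<close>.  If the claim failed, \<open>F powr (2 / p)\<close> minus a slightly too large multiple of \<open>t\<^sup>2\<close>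
  would have an interior minimum, contradicting the bound on second differences there.
\<close>
lemma Snorm_two_point_self_adjoint:
  fixes A Y :: "'a::euclidean_space \<Rightarrow> 'a"
  assumes lin: "linear A" "linear Y" and sa: "\<And>x y. A x \<bullet> y = x \<bullet> A y" "\<And>x y. Y x \<bullet> y = x \<bullet> Y y"
    and p: "2 \<le> p"
  shows "((Snorm p (\<lambda>x. A x + Y x) powr p + Snorm p (\<lambda>x. A x - Y x) powr p) / 2) powr (2 / p)
    \<le> (Snorm p A)\<^sup>2 + (p - 1) * (Snorm p Y)\<^sup>2"
proof -
  define N where "N t = Snorm p (\<lambda>x. A x + t *\<^sub>R Y x)" for t
  define K where "K = Snorm p Y"
  define F where "F t = (N t powr p + N (- t) powr p) / 2" for t
  have N_nonneg [simp]: "0 \<le> N t" and K_nonneg: "0 \<le> K" for t unfolding N_def K_def by simp_all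
  have F_nonneg: "0 \<le> F t" for t unfolding F_def by simp
  have Lip: "N t \<le> N s + \<bar>t - s\<bar> * K" for s t
    unfolding N_def K_def by (rule Snorm_Lipschitz[OF lin p])
  have root: "(x powr p) powr (2 / p) = x\<^sup>2" if "0 \<le> x" for x :: real
    using p that by (simp add: powr_powr)
  have N0: "N 0 = Snorm p A" unfolding N_def by simp
  have "F 1 powr (2 / p) \<le> (N 0)\<^sup>2 + (p - 1) * K\<^sup>2"
  proof (cases "N 0 = 0")
    \<comment> \<open>Here \<open>F\<close> may vanish, so its powers are not smooth. The Lipschitz
      bound gives the claim directly, using \<open>p - 1 \<ge> 1\<close>.\<close>
    case True
    have "F 1 \<le> (K powr p + K powr p) / 2" unfolding F_def
      using Lip[of 1 0] Lip[of "-1" 0] True p by (intro divide_right_mono add_mono powr_mono2) auto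
    then have "F 1 powr (2 / p) \<le> (K powr p) powr (2 / p)" using p F_nonneg by (intro powr_mono2) auto
    also have "\<dots> = 1 * K\<^sup>2" using root K_nonneg by simp
    also have "\<dots> \<le> (p - 1) * K\<^sup>2" using p by (intro mult_right_mono) auto
    finally show ?thesis using True by simp
  next
    case False
    then have N0_pos: "0 < N 0" using N_nonneg[of 0] by linarith
    \<comment> \<open>Since \<open>2 A\<close> is the sum of \<open>A + t Y\<close> and
      \<open>A - t Y\<close>, the two norms cannot both vanish. Positivity is needed for the tangent
      of \<open>x powr (2 / p)\<close> at \<open>F t\<close>.\<close>
    have F_pos: "0 < F t" for t
    proof -
      have "(\<lambda>x. 2 *\<^sub>R A x) = (\<lambda>x. (A x + t *\<^sub>R Y x) + (A x + (- t) *\<^sub>R Y x))"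
        by (simp add: scaleR_2)
      then have "Snorm p (\<lambda>x. 2 *\<^sub>R A x) \<le> N t + N (- t)"
        unfolding N_def using lin p by (simp only:) (intro Snorm_triangle linear_add_scaleR)
      then have "2 * N 0 \<le> N t + N (- t)" using lin p by (simp add: Snorm_scale N0)
      then have "0 < N t \<or> 0 < N (- t)" using N0_pos by linarith
      then show ?thesis unfolding F_def by (auto intro: add_pos_nonneg add_nonneg_pos)
    qed
    show ?thesis
    proof (rule ccontr)
      assume contra: "\<not> ?thesis"
      \<comment> \<open>Half the excess: the quadratic coefficient becomes strictly larger than
        \<open>(p - 1) * K\<^sup>2\<close>, while \<open>H\<close> at the endpoints still exceeds
        \<open>H 0\<close>.\<close>
      define \<epsilon> where "\<epsilon> = (F 1 powr (2 / p) - (N 0)\<^sup>2 - (p - 1) * K\<^sup>2) / 2"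
      have \<epsilon>: "0 < \<epsilon>" using contra unfolding \<epsilon>_def by simp
      define c where "c = (p - 1) * K\<^sup>2 + \<epsilon>"
      define H where "H t = F t powr (2 / p) - c * t\<^sup>2" for t
      have F0: "F 0 powr (2 / p) = (N 0)\<^sup>2" unfolding F_def using root by simp
      have H1: "H 1 > H 0" "H (- 1) > H 0"
        using \<epsilon> F0 unfolding H_def c_def \<epsilon>_def by (auto simp: F_def add.commute field_simps)
      have N_cont: "continuous_on UNIV N"
      proof (rule continuous_on_iff[THEN iffD2], intro ballI allI impI)
        fix t e :: real assume "0 < e"
        have "dist (N s) (N t) < e" if "dist s t < e / (K + 1)" for s
        proof -
          have "dist (N s) (N t) \<le> \<bar>s - t\<bar> * K"
            using Lip[of s t] Lip[of t s] by (simp add: dist_real_def abs_minus_commute abs_le_iff)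
          also have "\<dots> \<le> \<bar>s - t\<bar> * (K + 1)" by (intro mult_left_mono) auto
          also have "\<dots> < e" using that K_nonneg by (simp add: dist_real_def field_simps)
          finally show ?thesis .
        qed
        then show "\<exists>d>0. \<forall>s\<in>UNIV. dist s t < d \<longrightarrow> dist (N s) (N t) < e"
          using \<open>0 < e\<close> K_nonneg by (intro exI[of _ "e / (K + 1)"]) auto
      qed
      have "continuous_on {-1..1} (\<lambda>t. N (g t) powr p)" if "continuous_on {-1..1} g" for g :: "real \<Rightarrow> real"
        using p continuous_on_compose2[OF N_cont that] by (intro continuous_on_powr') auto
      from this[OF continuous_on_id] this[OF continuous_on_minus[OF continuous_on_id]] have "continuous_on {-1..1} F"
        unfolding F_def by (intro continuous_on_divide continuous_on_add) (auto intro!: continuous_intros)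
      moreover have "F t \<noteq> 0" for t using F_pos[of t] by simp
      ultimately have "continuous_on {-1..1} H" unfolding H_def
        by (intro continuous_on_diff continuous_on_powr continuous_intros) auto
      then obtain t where t: "t \<in> {-1..1}" "\<And>s. s \<in> {-1..1} \<Longrightarrow> H t \<le> H s"
        using continuous_attains_inf[of "{-1..1}" H] by auto
      then have "H t \<le> H 0" by simp
      then have t': "-1 < t" "t < 1" using H1 t(1) by (metis atLeastAtMost_iff less_eq_real_def not_le)+
      \<comment> \<open>At the minimum \<open>t\<close> the second difference of \<open>H\<close> is
        nonnegative, which bounds \<open>c\<close> from above. The slack \<open>\<delta>\<close>
        dominates the norms at neighbouring points; as it tends to 0 the bound becomes
        \<open>(p - 1) * K\<^sup>2\<close>, which is less than \<open>c\<close>.\<close>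
      have key: "c \<le> (p - 1) * K\<^sup>2 * F t powr (2 / p - 1)
          * (((N t + \<delta>) powr p + (N (- t) + \<delta>) powr p) / 2) powr ((p - 2) / p)" if \<delta>: "0 < \<delta>" for \<delta>
      proof -
        \<comment> \<open>Small enough to keep \<open>t + h\<close> and \<open>t - h\<close> in the
          interval and to change the norm by at most \<open>\<delta>\<close>.\<close>
        define h where "h = min (\<delta> / (K + 1)) (1 - \<bar>t\<bar>)"
        have "0 < h" "h \<le> 1 - \<bar>t\<bar>" using \<delta> K_nonneg t' unfolding h_def by auto
        then have h: "0 < h" "t + h \<in> {-1..1}" "t - h \<in> {-1..1}" by auto
        have "h * K \<le> \<delta> / (K + 1) * (K + 1)" unfolding h_def using K_nonneg \<delta> by (intro mult_mono) auto
        then have hK: "h * K \<le> \<delta>" using K_nonneg by simp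
        define D where "D x = (N x + \<delta>) powr (p - 2)" for x
        have diff: "N (x + h) powr p + N (x - h) powr p - 2 * N x powr p \<le> p * (p - 1) * h\<^sup>2 * K\<^sup>2 * D x" for x
        proof -
          have "N x < N x + \<delta>" "N (x + h) \<le> N x + \<delta>" "N (x - h) \<le> N x + \<delta>"
            using Lip[of "x + h" x] Lip[of "x - h" x] hK h(1) \<delta> by auto
          then show ?thesis
            using Snorm_second_difference[OF lin sa p, of x "N x + \<delta>" h, folded N_def K_def] unfolding D_def by simp
        qed
        have "F (t + h) + F (t - h) - 2 * F t
            = ((N (t + h) powr p + N (t - h) powr p - 2 * N t powr p)
              + (N (- t + h) powr p + N (- t - h) powr p - 2 * N (- t) powr p)) / 2"
        proof -
          have "- (t + h) = - t - h" "- (t - h) = - t + h" by auto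
          then show ?thesis unfolding F_def by (simp only:) (simp add: field_simps del: minus_add_distrib)
        qed
        also have "\<dots> \<le> (p * (p - 1) * h\<^sup>2 * K\<^sup>2 * D t + p * (p - 1) * h\<^sup>2 * K\<^sup>2 * D (- t)) / 2"
          by (intro divide_right_mono add_mono diff) auto
        also have "\<dots> = p * (p - 1) * h\<^sup>2 * K\<^sup>2 * (1/2 * D t + 1/2 * D (- t))" by (simp add: field_simps)
        also have "\<dots> \<le> p * (p - 1) * h\<^sup>2 * K\<^sup>2
            * (((N t + \<delta>) powr p + (N (- t) + \<delta>) powr p) / 2) powr ((p - 2) / p)"
        proof (intro mult_left_mono)
          \<comment> \<open>Jensen with exponent \<open>p / (p - 2)\<close> compares the mean of the
            powers \<open>p - 2\<close> with the mean \<open>z\<close> of the powers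
            \<open>p\<close>, the quantity that cancels against \<open>F t\<close> in the
            limit.\<close>
          define z where "z = ((N t + \<delta>) powr p + (N (- t) + \<delta>) powr p) / 2"
          have z: "0 < z" unfolding z_def using \<delta> N_nonneg by (smt (verit) powr_gt_zero half_gt_zero)
          show "1/2 * D t + 1/2 * D (- t) \<le> z powr ((p - 2) / p)"
          proof (cases "p = 2")
            case True
            then show ?thesis using z \<delta> N_nonneg[of t] N_nonneg[of "- t"] unfolding D_def by simp
          next
            case False
            then have p2: "2 < p" using p by simp
            have "(1/2 * D t + 1/2 * D (- t)) powr (p / (p - 2)) \<le> 1/2 * D t powr (p / (p - 2)) + 1/2 * D (- t) powr (p / (p - 2))"
              using p2 unfolding D_def by (intro powr_add_Jensen) (auto simp: field_simps)
            also have "\<dots> = z" unfolding D_def z_def using p2 \<delta> by (simp add: powr_powr add_divide_distrib)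
            finally have "((1/2 * D t + 1/2 * D (- t)) powr (p / (p - 2))) powr ((p - 2) / p) \<le> z powr ((p - 2) / p)"
              using p2 by (intro powr_mono2) auto
            moreover have "0 \<le> 1/2 * D t + 1/2 * D (- t)" unfolding D_def by simp
            ultimately show ?thesis using p2 by (simp add: powr_powr)
          qed
        qed (use p in auto)
        finally have F2: "F (t + h) + F (t - h) - 2 * F t \<le> p * (p - 1) * h\<^sup>2 * K\<^sup>2
            * (((N t + \<delta>) powr p + (N (- t) + \<delta>) powr p) / 2) powr ((p - 2) / p)" (is "_ \<le> _ * ?R") .
        define \<kappa> where "\<kappa> = 2 / p * F t powr (2 / p - 1)"
        have \<kappa>: "0 \<le> \<kappa>" unfolding \<kappa>_def using p by simp
        \<comment> \<open>Concavity of \<open>x powr (2 / p)\<close> transfers the second-difference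
          bound from \<open>F\<close> to its power without a second-order term.\<close>
        have tan: "F s powr (2 / p) \<le> F t powr (2 / p) + \<kappa> * (F s - F t)" for s
          unfolding \<kappa>_def using p F_nonneg F_pos by (intro powr_le_tangent) auto
        have "2 * c * h\<^sup>2 \<le> F (t + h) powr (2 / p) + F (t - h) powr (2 / p) - 2 * F t powr (2 / p)"
          using t(2)[OF h(2)] t(2)[OF h(3)] unfolding H_def by (simp add: power2_eq_square algebra_simps)
        also have "\<dots> \<le> \<kappa> * (F (t + h) + F (t - h) - 2 * F t)"
          using tan[of "t + h"] tan[of "t - h"] by (simp add: algebra_simps)
        also have "\<dots> \<le> \<kappa> * (p * (p - 1) * h\<^sup>2 * K\<^sup>2 * ?R)"
          using F2 \<kappa> by (intro mult_left_mono) auto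
        also have "\<dots> = 2 * ((p - 1) * K\<^sup>2 * F t powr (2 / p - 1) * ?R) * h\<^sup>2"
          unfolding \<kappa>_def using p by (simp add: field_simps)
        finally show ?thesis using h(1) by simp
      qed
      define G where "G \<delta> = (p - 1) * K\<^sup>2 * F t powr (2 / p - 1)
          * (((N t + \<delta>) powr p + (N (- t) + \<delta>) powr p) / 2) powr ((p - 2) / p)" for \<delta>
      have G0: "G 0 = (p - 1) * K\<^sup>2"
      proof -
        have "F t powr (2 / p - 1) * F t powr ((p - 2) / p) = F t powr 0"
          unfolding powr_add[symmetric] using p by (simp add: field_simps)
        then show ?thesis unfolding G_def using F_pos[of t] by (simp add: F_def mult.assoc)
      qed
      have "((\<lambda>\<delta>. (N x + \<delta>) powr p) \<longlongrightarrow> (N x + 0) powr p) (at_right 0)" for x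
      proof (rule tendsto_powr2)
        show "\<forall>\<^sub>F \<delta> in at_right 0. 0 \<le> N x + \<delta>"
          using eventually_at_right_less[of 0] by eventually_elim (simp add: add_nonneg_nonneg)
        show "((\<lambda>\<delta>. N x + \<delta>) \<longlongrightarrow> N x + 0) (at_right 0)" by (intro tendsto_intros)
      qed (use p in auto)
      from tendsto_divide[OF tendsto_add[OF this[of t] this[of "- t"]] tendsto_const[of 2]]
      have "((\<lambda>\<delta>. ((N t + \<delta>) powr p + (N (- t) + \<delta>) powr p) / 2) \<longlongrightarrow> F t) (at_right 0)"
        by (simp add: F_def)
      then have "((\<lambda>\<delta>. (((N t + \<delta>) powr p + (N (- t) + \<delta>) powr p) / 2) powr ((p - 2) / p))
          \<longlongrightarrow> F t powr ((p - 2) / p)) (at_right 0)"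
        using F_pos[of t] by (intro tendsto_powr tendsto_const) auto
      then have "(G \<longlongrightarrow> (p - 1) * K\<^sup>2 * F t powr (2 / p - 1) * F t powr ((p - 2) / p)) (at_right 0)"
        unfolding G_def by (intro tendsto_mult tendsto_const)
      then have "(G \<longlongrightarrow> G 0) (at_right 0)" unfolding G_def by (simp add: F_def)
      moreover have "\<forall>\<^sub>F \<delta> in at_right 0. c \<le> G \<delta>"
        using eventually_at_right_less[of 0] by eventually_elim (simp add: key G_def)
      ultimately have "c \<le> G 0" by (intro tendsto_lowerbound) auto
      then show False using \<epsilon> unfolding G0 c_def by simp
    qed
  qed
  then show ?thesis unfolding F_def K_def N0 by (simp add: N_def)
qed

lemma Snorm_dilation_eq:
  assumes "linear X" "2 \<le> p"
  shows "Snorm p (dilation X) = 2 powr (1 / p) * Snorm p X"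
proof -
  have "(Snorm p (dilation X) powr p) powr (1 / p) = (2 * Snorm p X powr p) powr (1 / p)"
    by (simp add: Snorm_dilation assms)
  then show ?thesis using assms by (simp add: powr_mult powr_powr)
qed

lemma dilation_add_scaleR:
  assumes "linear A" "linear Y"
  shows "dilation (\<lambda>x. A x + c *\<^sub>R Y x) = (\<lambda>z. dilation A z + c *\<^sub>R dilation Y z)"
proof -
  have "adjoint (\<lambda>x. A x + c *\<^sub>R Y x) = (\<lambda>x. adjoint A x + c *\<^sub>R adjoint Y x)"
    using adjoint_works[OF assms(1)] adjoint_works[OF assms(2)]
    by (intro adjoint_unique) (simp add: inner_add_left inner_add_right inner_commute)
  then show ?thesis by (auto simp: dilation_def)
qed

text \<open>Dilation is linear in the map and multiplies each norm by \<open>r\<close>, so both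
  sides of the self-adjoint case acquire the factor \<open>r\<^sup>2\<close>.\<close>

theorem Snorm_two_point:
  fixes A Y :: "'a::euclidean_space \<Rightarrow> 'b::euclidean_space"
  assumes lin: "linear A" "linear Y" and p: "2 \<le> p"
  shows "((Snorm p (\<lambda>x. A x + Y x) powr p + Snorm p (\<lambda>x. A x - Y x) powr p) / 2) powr (2 / p)
    \<le> (Snorm p A)\<^sup>2 + (p - 1) * (Snorm p Y)\<^sup>2"
proof -
  define r :: real where "r = 2 powr (1 / p)"
  have r: "0 < r" unfolding r_def by simp
  have dil: "Snorm p (dilation X) = r * Snorm p X" if "linear X" for X :: "'a \<Rightarrow> 'b"
    using Snorm_dilation_eq[OF that p] r_def by simp
  have lin': "linear (\<lambda>x. A x + Y x)" "linear (\<lambda>x. A x - Y x)"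
    using lin linear_compose_add linear_compose_sub by blast+
  have "((Snorm p (\<lambda>z. dilation A z + dilation Y z) powr p + Snorm p (\<lambda>z. dilation A z - dilation Y z) powr p) / 2) powr (2 / p)
      \<le> (Snorm p (dilation A))\<^sup>2 + (p - 1) * (Snorm p (dilation Y))\<^sup>2"
    using lin p linear_dilation dilation_self_adjoint by (intro Snorm_two_point_self_adjoint) auto
  also have "(\<lambda>z. dilation A z + dilation Y z) = dilation (\<lambda>x. A x + Y x)"
    using dilation_add_scaleR[OF lin, of 1] by simp
  also have "(\<lambda>z. dilation A z - dilation Y z) = dilation (\<lambda>x. A x - Y x)"
    using dilation_add_scaleR[OF lin, of "- 1"] by simp
  also have "(Snorm p (dilation (\<lambda>x. A x + Y x)) powr p + Snorm p (dilation (\<lambda>x. A x - Y x)) powr p) / 2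
      = r powr p * ((Snorm p (\<lambda>x. A x + Y x) powr p + Snorm p (\<lambda>x. A x - Y x) powr p) / 2)"
    using r by (simp add: dil[OF lin'(1)] dil[OF lin'(2)] powr_mult algebra_simps)
  also have "\<dots> powr (2 / p)
      = r\<^sup>2 * ((Snorm p (\<lambda>x. A x + Y x) powr p + Snorm p (\<lambda>x. A x - Y x) powr p) / 2) powr (2 / p)"
    using r p by (subst powr_mult) (auto simp: powr_powr)
  also have "(Snorm p (dilation A))\<^sup>2 + (p - 1) * (Snorm p (dilation Y))\<^sup>2
      = r\<^sup>2 * ((Snorm p A)\<^sup>2 + (p - 1) * (Snorm p Y)\<^sup>2)"
    by (simp add: dil lin power_mult_distrib algebra_simps)
  finally show ?thesis using r by simp
qed

section \<open>Singular values of complex matrices\<close>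

lemma inner_complex_vector: "x \<bullet> y = Re (\<Sum>i\<in>UNIV. cnj (x $ i) * y $ i)" for x y :: "complex ^ 'n"
  by (simp add: inner_vec_def inner_complex_def)

lemma linear_matrix_vector_mult_real: "linear ((*v) A)" for A :: "complex ^ 'c ^ 'r"
  by (intro linearI) (auto simp: matrix_vector_mult_def vec_eq_iff scaleR_sum_right sum.distrib distrib_left)

lemma inner_conj_transpose: "(A *v x) \<bullet> y = x \<bullet> (conj_transpose A *v y)"
  for A :: "complex ^ 'c ^ 'r"
proof -
  have "(\<Sum>i\<in>UNIV. cnj ((A *v x) $ i) * y $ i) = (\<Sum>i\<in>UNIV. \<Sum>j\<in>UNIV. cnj (A $ i $ j) * cnj (x $ j) * y $ i)"
    by (simp add: matrix_vector_mult_def sum_distrib_right)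
  also have "\<dots> = (\<Sum>j\<in>UNIV. cnj (x $ j) * (conj_transpose A *v y) $ j)"
    by (subst sum.swap) (simp add: matrix_vector_mult_def conj_transpose_def sum_distrib_left mult_ac)
  finally show ?thesis by (simp add: inner_complex_vector)
qed

lemma gram_self_adjoint: "((conj_transpose A ** A) *v x) \<bullet> y = x \<bullet> ((conj_transpose A ** A) *v y)"
  for A :: "complex ^ 'c ^ 'r"
  using inner_conj_transpose[of A y "A *v x"] inner_conj_transpose[of A x "A *v y"]
  by (simp add: inner_commute flip: matrix_vector_mul_assoc)

lemma gram_inner: "(A *v x) \<bullet> (A *v y) = x \<bullet> ((conj_transpose A ** A) *v y)"
  for A :: "complex ^ 'c ^ 'r"
  by (simp add: inner_conj_transpose flip: matrix_vector_mul_assoc)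

definition scale_i :: "complex ^ 'n \<Rightarrow> complex ^ 'n" where
  "scale_i x = \<i> *s x"

lemma linear_scale_i: "linear scale_i"
  by (intro linearI) (auto simp: scale_i_def vec_eq_iff scaleR_conv_of_real algebra_simps)

lemma scale_i_inner: "scale_i x \<bullet> scale_i y = x \<bullet> y" "scale_i x \<bullet> y = - (x \<bullet> scale_i y)"
  by (auto simp: scale_i_def inner_vec_def inner_complex_def simp flip: sum_negf intro!: sum.cong)

lemma scale_i_scale_i: "scale_i (scale_i x) = - x"
  by (simp add: scale_i_def vec_eq_iff flip: mult.assoc)

lemma matrix_scale_i: "A *v scale_i x = scale_i (A *v x)"
  by (simp add: scale_i_def matrix_vector_mult_def vec_eq_iff sum_distrib_left mult_ac)

lemma norm_scale_i [simp]: "norm (scale_i x) = norm x"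
  using scale_i_inner(1)[of x x] by (simp add: norm_eq)

text \<open>The vectors \<open>f j\<close> are a complex orthonormal eigenbasis of the Gram matrix:
  \<open>f j \<bullet> scale_i (f k) = 0\<close> says that the Hermitian inner products have no
  imaginary part. Adjoining the multiples by \<open>\<i>\<close> makes it a real orthonormal
  basis.\<close>

lemma complex_singular_basis:
  fixes A :: "complex ^ 'c ^ 'r"
  obtains f :: "'c \<Rightarrow> complex ^ 'c" where
    "inj f" "range f \<inter> scale_i ` range f = {}" "singular_basis ((*v) A) (range f \<union> scale_i ` range f)"
    "\<And>j k. f j \<bullet> f k = (if j = k then 1 else 0)" "\<And>j k. f j \<bullet> scale_i (f k) = 0"
    "\<And>j. (conj_transpose A ** A) *v f j = (norm (A *v f j))\<^sup>2 *\<^sub>R f j"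
proof -
  define T where "T = (*v) (conj_transpose A ** A)"
  have orth: "scale_i x \<bullet> x = 0" for x :: "complex ^ 'c"
    using scale_i_inner(2)[of x x] by (simp add: inner_commute)
  have "\<exists>B. B \<subseteq> UNIV \<and> (\<forall>b\<in>B. norm b = 1 \<and> (\<exists>a. T b = a *\<^sub>R b))
    \<and> (\<forall>b\<in>B. \<forall>c\<in>B. b \<noteq> c \<longrightarrow> b \<bullet> c = 0 \<and> b \<bullet> scale_i c = 0) \<and> span (B \<union> scale_i ` B) = UNIV"
    unfolding T_def
  proof (rule self_adjoint_eigenbasis_subspace[where \<epsilon> = "- 1"])
    show "scale_i x \<bullet> y = - 1 * (x \<bullet> scale_i y)" for x y :: "complex ^ 'c"
      using scale_i_inner(2)[of x y] by simp
  qed (auto intro: linear_matrix_vector_mult_real linear_scale_i scale_i_inner(1) gram_self_adjoint matrix_scale_i orth)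
  then obtain B where B': "\<forall>b\<in>B. norm b = 1 \<and> (\<exists>a. T b = a *\<^sub>R b)"
    "\<forall>b\<in>B. \<forall>c\<in>B. b \<noteq> c \<longrightarrow> b \<bullet> c = 0 \<and> b \<bullet> scale_i c = 0"
    and span: "span (B \<union> scale_i ` B) = UNIV" by (elim exE conjE)
  have B: "norm b = 1" "\<exists>a. T b = a *\<^sub>R b" if "b \<in> B" for b
    using B'(1) that by blast+
  have B_i: "b \<bullet> scale_i c = 0" if "b \<in> B" "c \<in> B" for b c
    using B'(2) that orth[of b] by (cases "b = c") (auto simp: inner_commute)
  have B_inner: "b \<bullet> c = (if b = c then 1 else 0)" if "b \<in> B" "c \<in> B" for b c
    using B(1)[OF that(1)] B'(2) that by (auto simp: norm_eq_1)
  have inj_i: "inj_on scale_i X" for X :: "(complex ^ 'c) set"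
    by (rule inj_on_inverseI[of _ "\<lambda>x. - scale_i x"]) (simp add: scale_i_scale_i)
  have onb: "onb (B \<union> scale_i ` B)"
    unfolding onb_def pairwise_def orthogonal_def
  proof (intro conjI ballI impI span)
    fix x y assume xy: "x \<in> B \<union> scale_i ` B" "y \<in> B \<union> scale_i ` B" "x \<noteq> y"
    have "scale_i b \<bullet> c = 0" if "b \<in> B" "c \<in> B" for b c
      using B_i[OF that(2,1)] by (simp add: inner_commute)
    with xy show "x \<bullet> y = 0"
      by (elim UnE imageE) (auto simp: B_i B_inner scale_i_inner(1))
  next
    fix b assume "b \<in> B \<union> scale_i ` B"
    then show "norm b = 1" using B(1) by auto
  qed
  have disj: "B \<inter> scale_i ` B = {}"
  proof -
    have False if "b \<in> B" "c \<in> B" "b = scale_i c" for b c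
      using B_i[OF that(1,2)] B_inner[OF that(1,1)] that(3) by simp
    then show ?thesis by blast
  qed
  have fin: "finite B" using onb_finite[OF onb] by simp
  \<comment> \<open>The real dimension of the column space is twice the number of columns, so
    \<open>B\<close> can be indexed by the column type.\<close>
  have "2 * card B = card (B \<union> scale_i ` B)"
    using fin disj inj_i by (simp add: card_Un_disjoint card_image)
  also have "\<dots> = CARD('c) * 2" using onb_card[OF onb] by simp
  finally have "card (UNIV :: 'c set) = card B" by simp
  then obtain f where f: "bij_betw f (UNIV :: 'c set) B"
    using fin finite_same_card_bij[of "UNIV :: 'c set" B] by auto
  then have f': "inj f" "range f = B" by (auto simp: bij_betw_def)
  have eig: "T b = (norm (A *v b))\<^sup>2 *\<^sub>R b" if b: "b \<in> B" for b
  proof -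
    obtain a where a: "T b = a *\<^sub>R b" using B(2) b by blast
    then have "(A *v b) \<bullet> (A *v b) = a"
      using B_inner[OF b b] by (simp add: gram_inner T_def)
    then show ?thesis using a by (simp add: power2_norm_eq_inner)
  qed
  have sing: "singular_basis ((*v) A) (B \<union> scale_i ` B)"
  proof -
    have 1: "(A *v b) \<bullet> (A *v c) = 0" if "b \<in> B" "c \<in> B" "b \<noteq> c" for b c
      using eig[OF that(2)] B_inner[OF that(1,2)] that(3) by (simp add: gram_inner T_def)
    have 2: "(A *v b) \<bullet> scale_i (A *v c) = 0" if "b \<in> B" "c \<in> B" for b c
    proof -
      have "(A *v b) \<bullet> scale_i (A *v c) = b \<bullet> scale_i (T c)"
        unfolding matrix_scale_i[symmetric] gram_inner T_def ..
      then show ?thesis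
        using eig[OF that(2)] B_i[OF that(1,2)] by (simp add: linear_scale[OF linear_scale_i])
    qed
    have 3: "scale_i (A *v b) \<bullet> (A *v c) = 0" if "b \<in> B" "c \<in> B" for b c
      using 2[OF that(2,1)] by (simp add: inner_commute)
    show ?thesis unfolding singular_basis_def pairwise_def
    proof (intro conjI ballI impI onb)
      fix x y assume xy: "x \<in> B \<union> scale_i ` B" "y \<in> B \<union> scale_i ` B" "x \<noteq> y"
      have "(A *v b) \<bullet> (A *v c) = 0" if "b \<in> B" "c \<in> B" "scale_i b \<noteq> scale_i c" for b c
        using 1[of b c] that by auto
      with xy show "(A *v x) \<bullet> (A *v y) = 0"
        by (elim UnE imageE) (auto simp: 1 2 3 matrix_scale_i scale_i_inner(1))
    qed
  qed
  show ?thesis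
    using that[of f] f' f disj sing B_inner B_i eig unfolding T_def
    by (auto simp: inj_eq)
qed

section \<open>Singular values as roots of the characteristic polynomial\<close>

definition const_poly_matrix :: "complex ^ 'n ^ 'm \<Rightarrow> complex poly ^ 'n ^ 'm" where
  "const_poly_matrix A = (\<chi> i j. [:A $ i $ j:])"

lemma const_poly_sum: "[:sum f A:] = (\<Sum>i\<in>A. [:f i:])" for f :: "'i \<Rightarrow> complex"
proof (induction A rule: infinite_finite_induct)
  case (insert i A)
  show ?case unfolding sum.insert[OF insert(1,2)] insert(3)[symmetric] by simp
qed auto

lemma const_poly_matrix_mult:
  "const_poly_matrix (A ** B) = const_poly_matrix A ** const_poly_matrix B"
  by (simp add: const_poly_matrix_def matrix_matrix_mult_def vec_eq_iff const_poly_sum mult.commute)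

text \<open>Over the polynomial ring, \<open>X - H\<close> times \<open>V\<close> equals
  \<open>V\<close> times a diagonal matrix. Taking determinants, \<open>det V\<close> cancels
  because the left inverse \<open>V'\<close> makes it nonzero.\<close>

lemma charpoly_diagonalizable:
  fixes H V V' :: "complex ^ 'n ^ 'n" and \<mu> :: "'n \<Rightarrow> complex"
  assumes V: "V' ** V = mat 1" and HV: "\<And>i j. (H ** V) $ i $ j = \<mu> j * V $ i $ j"
  shows "charpoly H = (\<Prod>j\<in>UNIV. [:- \<mu> j, 1:])"
proof -
  define X :: "complex poly ^ 'n ^ 'n" where "X = (\<chi> i j. if i = j then [:0, 1:] else 0)"
  define D where "D = (\<chi> i j. if i = j then [:- \<mu> j, 1:] else (0 :: complex poly))"
  let ?C = "const_poly_matrix"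
  have charpoly: "charpoly H = det (X - ?C H)"
    unfolding charpoly_def X_def const_poly_matrix_def
    by (intro arg_cong[where f = det]) (simp add: vec_eq_iff)
  have "(X - ?C H) ** ?C V = ?C V ** D"
  proof -
    have "((X - ?C H) ** ?C V) $ i $ j = (?C V ** D) $ i $ j" for i j
    proof -
      have "((X - ?C H) ** ?C V) $ i $ j = (X ** ?C V) $ i $ j - ?C (H ** V) $ i $ j"
        unfolding const_poly_matrix_mult
        by (simp add: matrix_matrix_mult_def left_diff_distrib sum_subtractf)
      also have "(X ** ?C V) $ i $ j = [:0, 1:] * [:V $ i $ j:]"
      proof -
        have "(X ** ?C V) $ i $ j = (\<Sum>k\<in>UNIV. if k = i then [:0, 1:] * [:V $ k $ j:] else 0)"
          by (simp only: X_def const_poly_matrix_def matrix_matrix_mult_def vec_lambda_beta, intro sum.cong refl) auto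
        then show ?thesis by (simp only: sum.delta finite UNIV_I if_True)
      qed
      also have "?C (H ** V) $ i $ j = [:\<mu> j * V $ i $ j:]"
        using HV by (simp add: const_poly_matrix_def)
      also have "[:0, 1:] * [:V $ i $ j:] - [:\<mu> j * V $ i $ j:] = [:V $ i $ j:] * [:- \<mu> j, 1:]"
        by simp
      also have "\<dots> = (?C V ** D) $ i $ j"
      proof -
        have "(?C V ** D) $ i $ j = (\<Sum>k\<in>UNIV. if k = j then [:V $ i $ k:] * [:- \<mu> k, 1:] else 0)"
          by (simp only: D_def const_poly_matrix_def matrix_matrix_mult_def vec_lambda_beta, intro sum.cong refl) auto
        then show ?thesis by (simp only: sum.delta finite UNIV_I if_True)
      qed
      finally show ?thesis .
    qed
    then show ?thesis by (simp add: vec_eq_iff)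
  qed
  then have "det (X - ?C H) * det (?C V) = det (?C V) * det D"
    by (metis det_mul)
  moreover have "det (?C V) \<noteq> 0"
  proof -
    have "?C (mat 1) = (mat 1 :: complex poly ^ 'n ^ 'n)"
      by (simp add: const_poly_matrix_def mat_def vec_eq_iff one_pCons)
    then have "det (?C V') * det (?C V) = 1"
      by (metis const_poly_matrix_mult V det_mul det_I)
    then show ?thesis by auto
  qed
  ultimately have "det (X - ?C H) = det D" by (simp add: mult.commute)
  also have "\<dots> = (\<Prod>j\<in>UNIV. D $ j $ j)" by (intro det_diagonal) (simp add: D_def)
  finally show ?thesis unfolding charpoly by (simp add: D_def)
qed

text \<open>The matrix with columns \<open>f j\<close> is unitary and diagonalizes the Gram matrix,
  so the roots of the characteristic polynomial are the squared norms of the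
  \<open>A *v f j\<close>, with multiplicity.\<close>

lemma schatten_norm_eq_sum:
  fixes A :: "complex ^ 'c ^ 'r" and f :: "'c \<Rightarrow> complex ^ 'c"
  assumes f: "\<And>j k. f j \<bullet> f k = (if j = k then 1 else 0)" "\<And>j k. f j \<bullet> scale_i (f k) = 0"
    and eig: "\<And>j. (conj_transpose A ** A) *v f j = (norm (A *v f j))\<^sup>2 *\<^sub>R f j"
  shows "schatten_norm p A = (\<Sum>j\<in>UNIV. norm (A *v f j) powr p) powr (1 / p)"
proof -
  define V :: "complex ^ 'c ^ 'c" where "V = (\<chi> i j. f j $ i)"
  define \<mu> where "\<mu> j = complex_of_real ((norm (A *v f j))\<^sup>2)" for j
  have "conj_transpose V ** V = mat 1"
  proof -
    have "(\<Sum>i\<in>UNIV. cnj (f j $ i) * f k $ i) = (if j = k then 1 else 0)" for j k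
    proof (rule complex_eqI)
      show "Re (\<Sum>i\<in>UNIV. cnj (f j $ i) * f k $ i) = Re (if j = k then 1 else 0)"
        using f(1)[of j k] unfolding inner_complex_vector by simp
      \<comment> \<open>The real part of \<open>\<i> * z\<close> is minus the imaginary part of
        \<open>z\<close>.\<close>
      have "Re (\<Sum>i\<in>UNIV. cnj (f j $ i) * scale_i (f k) $ i) = Re (\<i> * (\<Sum>i\<in>UNIV. cnj (f j $ i) * f k $ i))"
        by (simp only: scale_i_def vector_smult_component sum_distrib_left mult.left_commute)
      then show "Im (\<Sum>i\<in>UNIV. cnj (f j $ i) * f k $ i) = Im (if j = k then 1 else 0)"
        using f(2)[of j k] unfolding inner_complex_vector by simp
    qed
    then show ?thesis
      by (simp add: V_def conj_transpose_def matrix_matrix_mult_def mat_def vec_eq_iff)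
  qed
  moreover have "((conj_transpose A ** A) ** V) $ i $ j = \<mu> j * V $ i $ j" for i j
  proof -
    have "((conj_transpose A ** A) ** V) $ i $ j = ((conj_transpose A ** A) *v f j) $ i"
      by (simp add: matrix_matrix_mult_def[of "conj_transpose A ** A"] matrix_vector_mult_def V_def)
    also have "\<dots> = \<mu> j * V $ i $ j" unfolding eig vector_scaleR_component by (simp add: \<mu>_def V_def scaleR_conv_of_real)
    finally show ?thesis .
  qed
  ultimately have "charpoly (conj_transpose A ** A) = (\<Prod>j\<in>UNIV. [:- \<mu> j, 1:])"
    by (rule charpoly_diagonalizable)
  then have "proots (charpoly (conj_transpose A ** A)) = (\<Sum>j\<in>UNIV. {#\<mu> j#})"
    by (simp add: proots_prod)
  moreover have "(\<Sum>s\<in>#image_mset g (\<Sum>j\<in>J. {#\<mu> j#}). s powr p) = (\<Sum>j\<in>J. g (\<mu> j) powr p)"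
    if "finite J" for g and J :: "'c set"
    using that by induction auto
  ultimately show ?thesis
    unfolding schatten_norm_def singular_values_def by (simp add: \<mu>_def)
qed

text \<open>As a real-linear map, a complex matrix has each of its singular values twice.\<close>
lemma Snorm_eq_schatten_norm:
  fixes A :: "complex ^ 'c ^ 'r"
  assumes p: "2 \<le> p"
  shows "Snorm p ((*v) A) = 2 powr (1 / p) * schatten_norm p A"
proof -
  obtain f :: "'c \<Rightarrow> complex ^ 'c" where f: "inj f" "range f \<inter> scale_i ` range f = {}"
      "singular_basis ((*v) A) (range f \<union> scale_i ` range f)"
    and f': "\<And>j k. f j \<bullet> f k = (if j = k then 1 else 0)" "\<And>j k. f j \<bullet> scale_i (f k) = 0"
    "\<And>j. (conj_transpose A ** A) *v f j = (norm (A *v f j))\<^sup>2 *\<^sub>R f j"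
    using complex_singular_basis[of A] by metis
  have inj_i: "inj_on scale_i (range f)"
    by (rule inj_on_inverseI[of _ "\<lambda>x. - scale_i x"]) (simp add: scale_i_scale_i)
  have "(\<Sum>v\<in>range f \<union> scale_i ` range f. norm (A *v v) powr p)
      = (\<Sum>v\<in>range f. norm (A *v v) powr p) + (\<Sum>v\<in>scale_i ` range f. norm (A *v v) powr p)"
    using f by (intro sum.union_disjoint) auto
  also have "\<dots> = 2 * (\<Sum>j\<in>UNIV. norm (A *v f j) powr p)"
    using f(1) by (simp only: sum.reindex[OF inj_i] sum.reindex[OF f(1)]) (simp add: matrix_scale_i)
  finally show ?thesis
    unfolding Snorm_eq[OF linear_matrix_vector_mult_real f(3) p] schatten_norm_eq_sum[OF f']
    by (simp add: powr_mult sum_nonneg)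
qed

section \<open>Schatten norms of complex matrices\<close>

lemma schatten_norm_eq_Snorm:
  assumes "2 \<le> p" shows "schatten_norm p A = Snorm p ((*v) A) / 2 powr (1 / p)"
  using Snorm_eq_schatten_norm[OF assms, of A] by simp

lemma schatten_norm_nonneg [simp]: "0 \<le> schatten_norm p A"
  by (simp add: schatten_norm_def)

lemma scaleR_matrix_vector_mult: "(c *\<^sub>R A) *v x = c *\<^sub>R (A *v x)" for A :: "complex ^ 'c ^ 'r"
  by (simp add: matrix_vector_mult_def vec_eq_iff scaleR_sum_right)

lemma matrix_vector_mult_fun:
  fixes A B :: "complex ^ 'c ^ 'r"
  shows "(*v) (A + B) = (\<lambda>x. A *v x + B *v x)" "(*v) (A - B) = (\<lambda>x. A *v x - B *v x)"
    "(*v) (c *\<^sub>R A) = (\<lambda>x. c *\<^sub>R (A *v x))"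
  by (simp_all add: fun_eq_iff matrix_vector_mult_add_rdistrib matrix_vector_mult_diff_rdistrib scaleR_matrix_vector_mult)

lemma schatten_norm_triangle:
  assumes "2 \<le> p" shows "schatten_norm p (A + B) \<le> schatten_norm p A + schatten_norm p B"
  using Snorm_triangle[of "(*v) A" "(*v) B" p] assms
  by (simp add: schatten_norm_eq_Snorm linear_matrix_vector_mult_real matrix_vector_mult_fun divide_right_mono
      flip: add_divide_distrib)

lemma schatten_norm_scaleR:
  assumes "2 \<le> p" shows "schatten_norm p (c *\<^sub>R A) = \<bar>c\<bar> * schatten_norm p A"
  using Snorm_scale[of "(*v) A" p c] assms
  by (simp add: schatten_norm_eq_Snorm linear_matrix_vector_mult_real matrix_vector_mult_fun)

lemma norm_matrix_vector_mult_le: "norm (B *v x) \<le> spectral_norm B * norm x" for B :: "complex ^ 'c ^ 'r"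
  unfolding spectral_norm_def
  by (intro onorm linear_matrix_vector_mult_real linear_conv_bounded_linear[THEN iffD1])

lemma spectral_norm_nonneg [simp]: "0 \<le> spectral_norm B" for B :: "complex ^ 'c ^ 'r"
  unfolding spectral_norm_def
  by (intro onorm_pos_le linear_matrix_vector_mult_real linear_conv_bounded_linear[THEN iffD1])

lemma schatten_norm_mult_le:
  fixes B :: "complex ^ 'c ^ 'r" and A :: "complex ^ 's ^ 'c"
  assumes "2 \<le> p" shows "schatten_norm p (B ** A) \<le> spectral_norm B * schatten_norm p A"
proof -
  have "(*v) (B ** A) = (\<lambda>x. B *v (A *v x))"
    by (simp add: fun_eq_iff matrix_vector_mul_assoc)
  then have "Snorm p ((*v) (B ** A)) \<le> spectral_norm B * Snorm p ((*v) A)"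
    using Snorm_comp_le[of "(*v) A" "(*v) B" "spectral_norm B" p] assms
    by (simp add: linear_matrix_vector_mult_real norm_matrix_vector_mult_le)
  then show ?thesis using assms by (simp add: schatten_norm_eq_Snorm divide_right_mono)
qed

lemma schatten_norm_two_point:
  assumes p: "2 \<le> p"
  shows "((schatten_norm p (A + B) powr p + schatten_norm p (A - B) powr p) / 2) powr (2 / p)
    \<le> (schatten_norm p A)\<^sup>2 + (p - 1) * (schatten_norm p B)\<^sup>2"
proof -
  define r :: real where "r = 2 powr (1 / p)"
  have r: "0 < r" "r powr p = 2" unfolding r_def using p by (simp_all add: powr_powr)
  have N: "schatten_norm p X = Snorm p ((*v) X) / r" for X :: "complex ^ 'c ^ 'r"
    unfolding r_def using p by (rule schatten_norm_eq_Snorm)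
  have "(schatten_norm p (A + B) powr p + schatten_norm p (A - B) powr p) / 2
      = ((Snorm p ((*v) (A + B)) powr p + Snorm p ((*v) (A - B)) powr p) / 2) / r powr p"
    using r by (simp add: N powr_divide add_divide_distrib)
  also have "\<dots> powr (2 / p) = ((Snorm p ((*v) (A + B)) powr p + Snorm p ((*v) (A - B)) powr p) / 2) powr (2 / p) / r\<^sup>2"
    using r(1) p by (subst powr_divide) (auto simp: powr_powr)
  also have "\<dots> \<le> ((Snorm p ((*v) A))\<^sup>2 + (p - 1) * (Snorm p ((*v) B))\<^sup>2) / r\<^sup>2"
    using Snorm_two_point[of "(*v) A" "(*v) B" p] p
    by (intro divide_right_mono) (auto simp: linear_matrix_vector_mult_real matrix_vector_mult_fun)
  also have "\<dots> = (schatten_norm p A)\<^sup>2 + (p - 1) * (schatten_norm p B)\<^sup>2"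
    by (simp add: N power_divide add_divide_distrib)
  finally show ?thesis .
qed

lemma schatten_norm_supporting_functional:
  fixes X :: "complex ^ 'c ^ 'r"
  assumes p: "2 \<le> p"
  obtains f :: "complex ^ 'c ^ 'r \<Rightarrow> real" where "linear f" "\<And>Z. f Z \<le> schatten_norm p Z" "f X = schatten_norm p X"
proof (cases "schatten_norm p X = 0")
  case True
  then show ?thesis using that[of "\<lambda>_. 0"] by (simp add: linear_zero)
next
  case False
  obtain V where V: "singular_basis ((*v) X) V"
    using singular_basis_exists linear_matrix_vector_mult_real by blast
  define S where "S = Snorm p ((*v) X)"
  define r :: real where "r = 2 powr (1 / p)"
  have r: "0 < r" unfolding r_def by simp
  have N: "schatten_norm p X = Snorm p ((*v) X) / r" for X :: "complex ^ 'c ^ 'r"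
    unfolding r_def using p by (rule schatten_norm_eq_Snorm)
  have S: "0 < S" using False r unfolding N S_def by (simp add: less_le)
  \<comment> \<open>The norm of \<open>X\<close> is \<open>S / r\<close>. Division by
    \<open>S powr (p - 1)\<close> makes the value at \<open>X\<close> equal to \<open>S\<close>, and
    \<open>r\<close> converts from \<open>Snorm\<close> to the Schatten norm.\<close>
  define f where "f Z = (\<Sum>v\<in>V. norm (X *v v) powr (p - 2) * ((X *v v) \<bullet> (Z *v v))) / (S powr (p - 1) * r)" for Z
  show ?thesis
  proof (rule that[of f])
    show "linear f" unfolding f_def
      by (intro linearI)
         (simp_all add: matrix_vector_mult_add_rdistrib scaleR_matrix_vector_mult inner_add_right distrib_left
           sum.distrib add_divide_distrib sum_distrib_left mult.left_commute)
    show "f Z \<le> schatten_norm p Z" for Z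
      using Snorm_supporting_functional[OF linear_matrix_vector_mult_real linear_matrix_vector_mult_real V p, of Z] S r
      unfolding f_def N S_def[symmetric] by (simp add: divide_simps mult_ac)
    have "norm y powr (p - 2) * (y \<bullet> y) = norm y powr p" for y :: "complex ^ 'r"
    proof (cases "y = 0")
      case False
      then show ?thesis using powr_add[of "norm y" "p - 2" 2] by (simp flip: power2_norm_eq_inner)
    qed simp
    then have "f X = S powr p / (S powr (p - 1) * r)"
      unfolding f_def S_def Snorm_powr[OF linear_matrix_vector_mult_real V p] by simp
    also have "S powr p = S * S powr (p - 1)" using S by (simp add: powr_mult_base)
    finally show "f X = schatten_norm p X" using S unfolding N S_def[symmetric] by simp
  qed
qed

text \<open>Seminorms are convex, and convex functions on a finite-dimensional space are continuous.
  Measurability of the matrix norms rests on this.\<close>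

lemma continuous_on_seminorm:
  fixes N :: "'a::euclidean_space \<Rightarrow> real"
  assumes "\<And>x y. N (x + y) \<le> N x + N y" "\<And>c x. N (c *\<^sub>R x) = \<bar>c\<bar> * N x"
  shows "continuous_on UNIV N"
proof (rule convex_on_continuous)
  show "convex_on UNIV N"
  proof (rule convex_onI)
    fix t :: real and x y :: 'a assume "0 < t" "t < 1"
    then show "N ((1 - t) *\<^sub>R x + t *\<^sub>R y) \<le> (1 - t) * N x + t * N y"
      using assms(1)[of "(1 - t) *\<^sub>R x" "t *\<^sub>R y"] assms(2) by simp
  qed simp
qed simp

lemma continuous_on_schatten_norm:
  assumes "2 \<le> p" shows "continuous_on UNIV (schatten_norm p)"
  using assms by (intro continuous_on_seminorm schatten_norm_triangle schatten_norm_scaleR)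

lemma continuous_on_spectral_norm: "continuous_on UNIV (spectral_norm :: complex ^ 'c ^ 'r \<Rightarrow> real)"
proof (rule continuous_on_seminorm)
  have bl: "bounded_linear ((*v) A)" for A :: "complex ^ 'c ^ 'r"
    using linear_matrix_vector_mult_real linear_conv_bounded_linear by blast
  fix A B :: "complex ^ 'c ^ 'r" and c :: real
  show "spectral_norm (A + B) \<le> spectral_norm A + spectral_norm B"
    using onorm_triangle[OF bl bl, of A B] by (simp add: spectral_norm_def matrix_vector_mult_add_rdistrib)
  show "spectral_norm (c *\<^sub>R A) = \<bar>c\<bar> * spectral_norm A"
    using onorm_scaleR[OF bl, of c A] by (simp add: spectral_norm_def scaleR_matrix_vector_mult)
qed

lemma measurable_schatten_norm [measurable]:
  "2 \<le> p \<Longrightarrow> schatten_norm p \<in> borel_measurable borel"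
  by (intro borel_measurable_continuous_onI continuous_on_schatten_norm)

lemma measurable_spectral_norm [measurable]:
  "(spectral_norm :: complex ^ 'c ^ 'r \<Rightarrow> real) \<in> borel_measurable borel"
  by (intro borel_measurable_continuous_onI continuous_on_spectral_norm)

lemma bounded_bilinear_matrix_mult:
  "bounded_bilinear ((**) :: complex ^ 'b ^ 'a \<Rightarrow> complex ^ 'c ^ 'b \<Rightarrow> complex ^ 'c ^ 'a)"
  unfolding bilinear_conv_bounded_bilinear[symmetric] bilinear_def
  by (auto intro!: linearI simp: matrix_matrix_mult_def vec_eq_iff distrib_left distrib_right sum.distrib scaleR_sum_right)

section \<open>Moments of smooth seminorms\<close>

lemma Minkowski_integral:
  fixes f g :: "'w \<Rightarrow> real"
  assumes [measurable]: "f \<in> borel_measurable M" "g \<in> borel_measurable M"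
    and nonneg: "\<And>\<omega>. 0 \<le> f \<omega>" "\<And>\<omega>. 0 \<le> g \<omega>" and r: "1 \<le> r"
    and int: "integrable M (\<lambda>\<omega>. f \<omega> powr r)" "integrable M (\<lambda>\<omega>. g \<omega> powr r)"
  shows "integrable M (\<lambda>\<omega>. (f \<omega> + g \<omega>) powr r)"
    and "(\<integral>\<omega>. (f \<omega> + g \<omega>) powr r \<partial>M) powr (1 / r)
      \<le> (\<integral>\<omega>. f \<omega> powr r \<partial>M) powr (1 / r) + (\<integral>\<omega>. g \<omega> powr r \<partial>M) powr (1 / r)"
proof -
  \<comment> \<open>The normalized inequality with \<open>a = b = 1\<close>, giving a crude
    integrable majorant.\<close>
  have bound: "(f \<omega> + g \<omega>) powr r \<le> 2 powr (r - 1) * (f \<omega> powr r + g \<omega> powr r)" for \<omega>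
    using powr_add_le_normalized[of "f \<omega>" "g \<omega>" 1 1 r] nonneg r by simp
  show int_sum: "integrable M (\<lambda>\<omega>. (f \<omega> + g \<omega>) powr r)"
    using bound nonneg
    by (intro Bochner_Integration.integrable_bound[OF integrable_mult_right[OF Bochner_Integration.integrable_add[OF int], of "2 powr (r - 1)"]])
       auto
  define A B where "A = (\<integral>\<omega>. f \<omega> powr r \<partial>M)" and "B = (\<integral>\<omega>. g \<omega> powr r \<partial>M)"
  define a b where "a = A powr (1 / r)" and "b = B powr (1 / r)"
  have AB: "0 \<le> A" "0 \<le> B" unfolding A_def B_def by simp_all
  have ar: "a powr r = A" "b powr r = B" using AB r unfolding a_def b_def by (simp_all add: powr_powr)
  consider "A = 0" | "B = 0" | "0 < A" "0 < B" using AB by linarith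
  then have "(\<integral>\<omega>. (f \<omega> + g \<omega>) powr r \<partial>M) powr (1 / r) \<le> a + b"
  proof cases
    case 1
    then have "AE \<omega> in M. f \<omega> powr r = 0"
      unfolding A_def using int by (subst (asm) integral_nonneg_eq_0_iff_AE) auto
    then have "(\<integral>\<omega>. (f \<omega> + g \<omega>) powr r \<partial>M) = B" unfolding B_def by (intro integral_cong_AE) auto
    then show ?thesis unfolding a_def b_def by simp
  next
    case 2
    then have "AE \<omega> in M. g \<omega> powr r = 0"
      unfolding B_def using int by (subst (asm) integral_nonneg_eq_0_iff_AE) auto
    then have "(\<integral>\<omega>. (f \<omega> + g \<omega>) powr r \<partial>M) = A" unfolding A_def by (intro integral_cong_AE) auto
    then show ?thesis unfolding a_def b_def by simp
  next
    case 3
    then have ab: "0 < a" "0 < b" unfolding a_def b_def by auto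
    have "(\<integral>\<omega>. (f \<omega> + g \<omega>) powr r \<partial>M)
        \<le> (\<integral>\<omega>. (a + b) powr (r - 1) * (f \<omega> powr r / a powr (r - 1) + g \<omega> powr r / b powr (r - 1)) \<partial>M)"
      using int int_sum nonneg ab r by (intro integral_mono powr_add_le_normalized) auto
    also have "\<dots> = (a + b) powr (r - 1) * (A / a powr (r - 1) + B / b powr (r - 1))"
      unfolding A_def B_def using int by simp
    also have "\<dots> = (a + b) powr r" using ab by (simp add: powr_diff flip: ar)
    finally have "(\<integral>\<omega>. (f \<omega> + g \<omega>) powr r \<partial>M) powr (1 / r) \<le> ((a + b) powr r) powr (1 / r)"
      using r by (intro powr_mono2) auto
    then show ?thesis using ab r by (simp add: powr_powr)
  qed
  then show "(\<integral>\<omega>. (f \<omega> + g \<omega>) powr r \<partial>M) powr (1 / r)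
      \<le> (\<integral>\<omega>. f \<omega> powr r \<partial>M) powr (1 / r) + (\<integral>\<omega>. g \<omega> powr r \<partial>M) powr (1 / r)"
    unfolding a_def b_def A_def B_def .
qed

lemma power_mean_mono:
  fixes a b q p :: real
  assumes "0 \<le> a" "0 \<le> b" "0 < q" "q \<le> p"
  shows "((a powr q + b powr q) / 2) powr (1 / q) \<le> ((a powr p + b powr p) / 2) powr (1 / p)"
proof -
  have "(1/2 * a powr q + 1/2 * b powr q) powr (p / q) \<le> 1/2 * (a powr q) powr (p / q) + 1/2 * (b powr q) powr (p / q)"
    using assms by (intro powr_add_Jensen) auto
  then have "((a powr q + b powr q) / 2) powr (p / q) \<le> (a powr p + b powr p) / 2"
    using assms by (simp add: powr_powr add_divide_distrib)
  then have "(((a powr q + b powr q) / 2) powr (p / q)) powr (1 / p) \<le> ((a powr p + b powr p) / 2) powr (1 / p)"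
    using assms by (intro powr_mono2) auto
  then show ?thesis using assms by (simp add: powr_powr)
qed

text \<open>Subtracting \<open>c * t\<^sup>2\<close> leaves a midpoint concave
  \<open>\<psi>\<close>, whose increment from 0 to \<open>h = (1/2)^k\<close> is at least
  \<open>h * d\<close>. Near 0, concavity and the minimum of \<open>\<phi>\<close> bound the same
  increment by \<open>c * h\<^sup>2\<close>. Hence \<open>d \<le> c * h\<close> for every dyadic
  \<open>h\<close>, and \<open>d \<le> 0\<close>. No continuity is involved.\<close>

lemma midpoint_concave_plus_square_le:
  fixes \<phi> :: "real \<Rightarrow> real"
  assumes mid: "\<And>t h. \<phi> (t + h) + \<phi> (t - h) \<le> 2 * \<phi> t + 2 * c * h\<^sup>2"
    and min: "\<And>t. \<phi> 0 \<le> \<phi> t"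
  shows "\<phi> 1 \<le> \<phi> 0 + c"
proof -
  define \<psi> where "\<psi> t = \<phi> t - c * t\<^sup>2" for t
  have conc: "\<psi> (t + h) + \<psi> (t - h) \<le> 2 * \<psi> t" for t h
    using mid[of t h] unfolding \<psi>_def by (simp add: power2_eq_square algebra_simps)
  define d where "d = \<psi> 1 - \<psi> 0"
  have dyadic: "(1/2)^k * d \<le> \<psi> ((1/2)^k) - \<psi> 0" for k
  proof (induction k)
    case (Suc k)
    have "\<psi> ((1/2)^k) + \<psi> 0 \<le> 2 * \<psi> ((1/2)^Suc k)"
      using conc[of "(1/2)^Suc k" "(1/2)^Suc k"] by simp
    with Suc show ?case by simp
  qed (simp add: d_def)
  have "d \<le> c * (1/2)^k" for k
  proof -
    define h :: real where "h = (1/2)^k"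
    have "\<psi> h + \<psi> (- h) \<le> 2 * \<psi> 0" using conc[of 0 h] by simp
    moreover have "\<phi> 0 \<le> \<phi> (- h)" by (rule min)
    ultimately have "\<psi> h - \<psi> 0 \<le> c * h\<^sup>2" unfolding \<psi>_def by simp
    moreover have "h * d \<le> \<psi> h - \<psi> 0" unfolding h_def by (rule dyadic)
    ultimately have "h * d \<le> h * (c * h)" by (simp add: power2_eq_square mult_ac)
    moreover have "0 < h" unfolding h_def by simp
    ultimately have "d \<le> c * h" by (simp only: mult_le_cancel_left_pos)
    then show ?thesis unfolding h_def .
  qed
  moreover have "(\<lambda>k. c * (1/2)^k) \<longlonglongrightarrow> c * 0"
    by (intro tendsto_mult tendsto_const LIMSEQ_realpow_zero) auto
  ultimately have "d \<le> c * 0" by (intro LIMSEQ_le_const) auto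
  then show ?thesis unfolding d_def \<psi>_def by simp
qed

text \<open>Integrating the two-point inequality at \<open>U + t V\<close> with increment
  \<open>h V\<close> shows that the squared moment norm along the line meets the midpoint hypothesis
  with constant \<open>C * K\<close>. Minkowski in exponent \<open>q / 2\<close> is where
  \<open>2 \<le> q\<close> enters. The hypothesis \<open>min\<close> abstracts conditional mean
  zero.\<close>

lemma two_smooth_moment_inequality:
  fixes N :: "'a::euclidean_space \<Rightarrow> real" and U V :: "'w \<Rightarrow> 'a"
  assumes N: "\<And>x. 0 \<le> N x" "\<And>x y. N (x + y) \<le> N x + N y" "\<And>c x. N (c *\<^sub>R x) = \<bar>c\<bar> * N x"
    and two_point: "\<And>x y. ((N (x + y) powr p + N (x - y) powr p) / 2) powr (2 / p) \<le> (N x)\<^sup>2 + C * (N y)\<^sup>2"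
    and C: "0 \<le> C" and q: "2 \<le> q" "q \<le> p"
    and meas [measurable]: "N \<in> borel_measurable borel" "U \<in> borel_measurable M" "V \<in> borel_measurable M"
    and int: "integrable M (\<lambda>\<omega>. N (U \<omega>) powr q)" "integrable M (\<lambda>\<omega>. N (V \<omega>) powr q)"
    and min: "\<And>t. (\<integral>\<^sup>+\<omega>. N (U \<omega>) powr q \<partial>M) \<le> (\<integral>\<^sup>+\<omega>. N (U \<omega> + t *\<^sub>R V \<omega>) powr q \<partial>M)"
  shows "integrable M (\<lambda>\<omega>. N (U \<omega> + V \<omega>) powr q)"
    and "(\<integral>\<omega>. N (U \<omega> + V \<omega>) powr q \<partial>M) powr (2 / q)
    \<le> (\<integral>\<omega>. N (U \<omega>) powr q \<partial>M) powr (2 / q) + C * (\<integral>\<omega>. N (V \<omega>) powr q \<partial>M) powr (2 / q)"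
proof -
  define I where "I t = (\<integral>\<omega>. N (U \<omega> + t *\<^sub>R V \<omega>) powr q \<partial>M)" for t
  define K where "K = (\<integral>\<omega>. N (V \<omega>) powr q \<partial>M) powr (2 / q)"
  have I_nonneg: "0 \<le> I t" for t unfolding I_def by simp
  have int_t: "integrable M (\<lambda>\<omega>. N (U \<omega> + t *\<^sub>R V \<omega>) powr q)" for t
  proof (rule Bochner_Integration.integrable_bound)
    show "integrable M (\<lambda>\<omega>. (N (U \<omega>) + \<bar>t\<bar> * N (V \<omega>)) powr q)"
      using N q int by (intro Minkowski_integral) (auto simp: powr_mult)
    show "AE \<omega> in M. norm (N (U \<omega> + t *\<^sub>R V \<omega>) powr q) \<le> norm ((N (U \<omega>) + \<bar>t\<bar> * N (V \<omega>)) powr q)"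
    proof (intro always_eventually allI)
      fix \<omega>
      have "N (U \<omega> + t *\<^sub>R V \<omega>) \<le> N (U \<omega>) + \<bar>t\<bar> * N (V \<omega>)"
        using N(2)[of "U \<omega>" "t *\<^sub>R V \<omega>"] N(3) by simp
      then show "norm (N (U \<omega> + t *\<^sub>R V \<omega>) powr q) \<le> norm ((N (U \<omega>) + \<bar>t\<bar> * N (V \<omega>)) powr q)"
        using N(1) q by (auto intro: powr_mono2)
    qed
  qed measurable
  from int_t[of 1] show "integrable M (\<lambda>\<omega>. N (U \<omega> + V \<omega>) powr q)" by simp
  have sq: "(x\<^sup>2) powr (q / 2) = x powr q" if "0 \<le> x" for x :: real
    using that by (simp add: powr_powr flip: powr_numeral)
  have mid: "I (t + h) powr (2 / q) + I (t - h) powr (2 / q) \<le> 2 * I t powr (2 / q) + 2 * (C * K) * h\<^sup>2" for t h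
  proof -
    define f where "f \<omega> = (N (U \<omega> + t *\<^sub>R V \<omega>))\<^sup>2" for \<omega>
    define g where "g \<omega> = C * h\<^sup>2 * (N (V \<omega>))\<^sup>2" for \<omega>
    have [measurable]: "f \<in> borel_measurable M" "g \<in> borel_measurable M" unfolding f_def g_def by measurable
    have f: "0 \<le> f \<omega>" "f \<omega> powr (q / 2) = N (U \<omega> + t *\<^sub>R V \<omega>) powr q" for \<omega>
      unfolding f_def by (simp_all add: sq N)
    have g: "0 \<le> g \<omega>" "g \<omega> powr (q / 2) = (C * h\<^sup>2) powr (q / 2) * N (V \<omega>) powr q" for \<omega>
      unfolding g_def using C by (simp_all add: powr_mult sq N)
    have pw: "(N (U \<omega> + (t + h) *\<^sub>R V \<omega>) powr q + N (U \<omega> + (t - h) *\<^sub>R V \<omega>) powr q) / 2 \<le> (f \<omega> + g \<omega>) powr (q / 2)" for \<omega>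
    proof -
      let ?x = "U \<omega> + t *\<^sub>R V \<omega>" and ?y = "h *\<^sub>R V \<omega>"
      have eq: "U \<omega> + (t + h) *\<^sub>R V \<omega> = ?x + ?y" "U \<omega> + (t - h) *\<^sub>R V \<omega> = ?x - ?y"
        by (simp_all add: algebra_simps)
      define m where "m r = (N (?x + ?y) powr r + N (?x - ?y) powr r) / 2" for r
      have m: "0 \<le> m r" for r unfolding m_def by simp
      \<comment> \<open>The two-point inequality is stated with \<open>p\<close>-means; power means
        increase with the exponent, so \<open>q \<le> p\<close> gives it for
        \<open>q\<close>-means.\<close>
      have "m q powr (1 / q) \<le> m p powr (1 / p)" unfolding m_def using N q by (intro power_mean_mono) auto
      then have "(m q powr (1 / q)) powr 2 \<le> (m p powr (1 / p)) powr 2" by (intro powr_mono2) auto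
      then have "m q powr (2 / q) \<le> m p powr (2 / p)" by (simp add: powr_powr)
      also have "\<dots> \<le> f \<omega> + g \<omega>"
        unfolding m_def f_def g_def using two_point[of ?x ?y] by (simp add: N(3) power_mult_distrib)
      finally have "(m q powr (2 / q)) powr (q / 2) \<le> (f \<omega> + g \<omega>) powr (q / 2)" using q by (intro powr_mono2) auto
      then have "m q \<le> (f \<omega> + g \<omega>) powr (q / 2)" using q m[of q] by (simp add: powr_powr)
      then show ?thesis unfolding m_def eq .
    qed
    have intf: "integrable M (\<lambda>\<omega>. f \<omega> powr (q / 2))" unfolding f by (rule int_t)
    have intg: "integrable M (\<lambda>\<omega>. g \<omega> powr (q / 2))" unfolding g using int(2) by simp
    have r: "1 \<le> q / 2" using q by simp
    note Mink = Minkowski_integral[of f M g "q / 2", OF _ _ f(1) g(1) r intf intg, simplified]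
    have "(I (t + h) + I (t - h)) / 2 = (\<integral>\<omega>. (N (U \<omega> + (t + h) *\<^sub>R V \<omega>) powr q + N (U \<omega> + (t - h) *\<^sub>R V \<omega>) powr q) / 2 \<partial>M)"
      unfolding I_def using int_t by simp
    also have "\<dots> \<le> (\<integral>\<omega>. (f \<omega> + g \<omega>) powr (q / 2) \<partial>M)"
      using int_t Mink(1) pw by (intro integral_mono) auto
    finally have "((I (t + h) + I (t - h)) / 2) powr (2 / q) \<le> (\<integral>\<omega>. (f \<omega> + g \<omega>) powr (q / 2) \<partial>M) powr (2 / q)"
      using q I_nonneg by (intro powr_mono2) auto
    also have "\<dots> \<le> (\<integral>\<omega>. f \<omega> powr (q / 2) \<partial>M) powr (2 / q) + (\<integral>\<omega>. g \<omega> powr (q / 2) \<partial>M) powr (2 / q)"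
      using Mink(2) by simp
    also have "(\<integral>\<omega>. f \<omega> powr (q / 2) \<partial>M) powr (2 / q) = I t powr (2 / q)" unfolding f I_def ..
    also have "(\<integral>\<omega>. g \<omega> powr (q / 2) \<partial>M) powr (2 / q) = C * K * h\<^sup>2"
      unfolding g K_def using C q by (simp add: powr_mult powr_powr)
    \<comment> \<open>Concavity of \<open>x powr (2 / q)\<close>, needed to obtain a midpoint
      inequality for the squared norms instead of the moments.\<close>
    also have "(I (t + h) powr (2 / q) + I (t - h) powr (2 / q)) / 2 \<le> ((I (t + h) + I (t - h)) / 2) powr (2 / q)"
    proof -
      have "((I (t + h) powr (2 / q) + I (t - h) powr (2 / q)) / 2) powr (1 / (2 / q)) \<le> (I (t + h) + I (t - h)) / 2"
        using power_mean_mono[of "I (t + h)" "I (t - h)" "2 / q" 1] q I_nonneg by simp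
      then have "(((I (t + h) powr (2 / q) + I (t - h) powr (2 / q)) / 2) powr (1 / (2 / q))) powr (2 / q)
          \<le> ((I (t + h) + I (t - h)) / 2) powr (2 / q)" using q by (intro powr_mono2) auto
      then show ?thesis using q by (simp add: powr_powr)
    qed
    finally show ?thesis by simp
  qed
  have "I 1 powr (2 / q) \<le> I 0 powr (2 / q) + C * K"
  proof (rule midpoint_concave_plus_square_le[of "\<lambda>t. I t powr (2 / q)"])
    show "I 0 powr (2 / q) \<le> I t powr (2 / q)" for t
    proof -
      have "ennreal (I 0) \<le> ennreal (I t)"
        using min[of t] int_t[of t] int(1) unfolding I_def by (simp add: nn_integral_eq_integral)
      then show ?thesis using q I_nonneg by (intro powr_mono2) auto
    qed
  qed (rule mid)
  then show "(\<integral>\<omega>. N (U \<omega> + V \<omega>) powr q \<partial>M) powr (2 / q)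
    \<le> (\<integral>\<omega>. N (U \<omega>) powr q \<partial>M) powr (2 / q) + C * (\<integral>\<omega>. N (V \<omega>) powr q \<partial>M) powr (2 / q)"
    unfolding I_def K_def by simp
qed

section \<open>Products of independent random matrices\<close>

lemma measurable_matrix_mult [measurable (raw)]:
  fixes f :: "'w \<Rightarrow> complex ^ 'b ^ 'a" and g :: "'w \<Rightarrow> complex ^ 'c ^ 'b"
  assumes "f \<in> borel_measurable M" "g \<in> borel_measurable M"
  shows "(\<lambda>x. f x ** g x) \<in> borel_measurable M"
  using assms
  by (rule borel_measurable_continuous_Pair)
     (intro bounded_bilinear.continuous_on[OF bounded_bilinear_matrix_mult] continuous_intros)

text \<open>Unlike \<^const>\<open>prob_space.indep_var\<close>, this allows random variables of different types.\<close>
definition (in prob_space) indep_pair ::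
  "'b measure \<Rightarrow> ('a \<Rightarrow> 'b) \<Rightarrow> 'c measure \<Rightarrow> ('a \<Rightarrow> 'c) \<Rightarrow> bool" where
  "indep_pair S X T Y \<longleftrightarrow> X \<in> measurable M S \<and> Y \<in> measurable M T \<and>
    distr M S X \<Otimes>\<^sub>M distr M T Y = distr M (S \<Otimes>\<^sub>M T) (\<lambda>\<omega>. (X \<omega>, Y \<omega>))"

lemma (in prob_space) indep_pair_iff_indep_var: "indep_pair S X T Y \<longleftrightarrow> indep_var S X T Y"
  unfolding indep_pair_def indep_var_distribution_eq by simp

lemma (in prob_space) indep_pair_compose:
  assumes indep: "indep_pair S X T Y" and [measurable]: "f \<in> measurable S S'" "g \<in> measurable T T'"
  shows "indep_pair S' (\<lambda>\<omega>. f (X \<omega>)) T' (\<lambda>\<omega>. g (Y \<omega>))"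
proof -
  have [measurable]: "X \<in> measurable M S" "Y \<in> measurable M T" using indep by (auto simp: indep_pair_def)
  interpret Y: prob_space "distr M T Y" by (rule prob_space_distr) simp
  interpret gY: prob_space "distr (distr M T Y) T' g" by (rule Y.prob_space_distr) simp
  have "distr M S' (\<lambda>\<omega>. f (X \<omega>)) \<Otimes>\<^sub>M distr M T' (\<lambda>\<omega>. g (Y \<omega>))
      = distr (distr M S X) S' f \<Otimes>\<^sub>M distr (distr M T Y) T' g"
    by (simp add: distr_distr o_def)
  also have "\<dots> = distr (distr M S X \<Otimes>\<^sub>M distr M T Y) (S' \<Otimes>\<^sub>M T') (\<lambda>(x, y). (f x, g y))"
    by (intro pair_measure_distr) (auto intro: gY.sigma_finite_measure_axioms)
  also have "\<dots> = distr (distr M (S \<Otimes>\<^sub>M T) (\<lambda>\<omega>. (X \<omega>, Y \<omega>))) (S' \<Otimes>\<^sub>M T') (\<lambda>(x, y). (f x, g y))"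
    using indep by (simp add: indep_pair_def)
  also have "\<dots> = distr M (S' \<Otimes>\<^sub>M T') (\<lambda>\<omega>. (f (X \<omega>), g (Y \<omega>)))"
    by (subst distr_distr) (auto simp: o_def)
  finally show ?thesis by (simp add: indep_pair_def)
qed

lemma (in prob_space) indep_pair_nn_integral:
  fixes f :: "'b::topological_space \<times> 'c::topological_space \<Rightarrow> ennreal"
  assumes indep: "indep_pair borel X borel Y" and f [measurable]: "f \<in> borel_measurable (borel \<Otimes>\<^sub>M borel)"
  shows "(\<integral>\<^sup>+\<omega>. f (X \<omega>, Y \<omega>) \<partial>M) = (\<integral>\<^sup>+\<omega>'. (\<integral>\<^sup>+\<omega>. f (X \<omega>', Y \<omega>) \<partial>M) \<partial>M)"
proof -
  have [measurable]: "X \<in> borel_measurable M" "Y \<in> borel_measurable M"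
    using indep by (auto simp: indep_pair_def)
  interpret Y: prob_space "distr M borel Y" by (rule prob_space_distr) simp
  have "(\<integral>\<^sup>+\<omega>. f (X \<omega>, Y \<omega>) \<partial>M) = integral\<^sup>N (distr M (borel \<Otimes>\<^sub>M borel) (\<lambda>\<omega>. (X \<omega>, Y \<omega>))) f"
    by (subst nn_integral_distr) auto
  also have "\<dots> = integral\<^sup>N (distr M borel X \<Otimes>\<^sub>M distr M borel Y) f"
    using indep by (simp add: indep_pair_def)
  also have "\<dots> = (\<integral>\<^sup>+x. (\<integral>\<^sup>+y. f (x, y) \<partial>distr M borel Y) \<partial>distr M borel X)"
    by (rule Y.nn_integral_fst[symmetric]) simp
  also have "\<dots> = (\<integral>\<^sup>+x. (\<integral>\<^sup>+\<omega>. f (x, Y \<omega>) \<partial>M) \<partial>distr M borel X)"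
    by (intro nn_integral_cong nn_integral_distr) auto
  also have "\<dots> = (\<integral>\<^sup>+\<omega>'. (\<integral>\<^sup>+\<omega>. f (X \<omega>', Y \<omega>) \<partial>M) \<partial>M)"
    by (subst nn_integral_distr) (auto intro!: borel_measurable_nn_integral)
  finally show ?thesis .
qed

lemma (in prob_space) indep_pair_bounded_bilinear:
  fixes prod :: "'b::euclidean_space \<Rightarrow> 'c::euclidean_space \<Rightarrow> 'd::euclidean_space"
  assumes prod: "bounded_bilinear prod" and indep: "indep_pair borel X borel Y"
    and int: "integrable M X" "integrable M Y"
  shows "integrable M (\<lambda>\<omega>. prod (X \<omega>) (Y \<omega>))"
    and "(\<integral>\<omega>. prod (X \<omega>) (Y \<omega>) \<partial>M) = prod (integral\<^sup>L M X) (integral\<^sup>L M Y)"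
proof -
  interpret bounded_bilinear prod by fact
  have [measurable]: "X \<in> borel_measurable M" "Y \<in> borel_measurable M" using int by auto
  have cont: "continuous_on UNIV (\<lambda>x. prod (fst x) (snd x))" by (intro continuous_on continuous_intros)
  have prod_meas [measurable]: "(\<lambda>x. prod (fst x) (snd x)) \<in> borel_measurable (borel \<Otimes>\<^sub>M borel)"
    using borel_measurable_continuous_onI[OF cont] by (simp add: borel_prod)
  obtain K where K: "\<And>a b. norm (prod a b) \<le> norm a * norm b * K" using bounded by blast
  have "indep_pair borel (\<lambda>\<omega>. norm (X \<omega>)) borel (\<lambda>\<omega>. norm (Y \<omega>))"
    using indep by (rule indep_pair_compose) auto
  then have "integrable M (\<lambda>\<omega>. norm (X \<omega>) * norm (Y \<omega>))"
    using int by (intro indep_var_integrable) (auto simp: indep_pair_iff_indep_var)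
  then have "integrable M (\<lambda>\<omega>. norm (X \<omega>) * norm (Y \<omega>) * K)" by (rule integrable_mult_left)
  moreover have "(\<lambda>\<omega>. prod (X \<omega>) (Y \<omega>)) \<in> borel_measurable M"
    using measurable_compose[OF measurable_Pair prod_meas, of X M Y] by simp
  ultimately show int_prod: "integrable M (\<lambda>\<omega>. prod (X \<omega>) (Y \<omega>))"
  proof (rule Bochner_Integration.integrable_bound)
    show "AE \<omega> in M. norm (prod (X \<omega>) (Y \<omega>)) \<le> norm (norm (X \<omega>) * norm (Y \<omega>) * K)"
      using K by (intro AE_I2) (metis abs_ge_self order_trans real_norm_def)
  qed
  interpret PX: prob_space "distr M borel X" by (rule prob_space_distr) simp
  interpret PY: prob_space "distr M borel Y" by (rule prob_space_distr) simp
  interpret XY: pair_sigma_finite "distr M borel X" "distr M borel Y" ..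
  have dist: "distr M borel X \<Otimes>\<^sub>M distr M borel Y = distr M (borel \<Otimes>\<^sub>M borel) (\<lambda>\<omega>. (X \<omega>, Y \<omega>))"
    using indep by (simp add: indep_pair_def)
  have "(\<integral>\<omega>. prod (X \<omega>) (Y \<omega>) \<partial>M) = (\<integral>z. prod (fst z) (snd z) \<partial>(distr M borel X \<Otimes>\<^sub>M distr M borel Y))"
    unfolding dist by (subst integral_distr) auto
  also have "\<dots> = (\<integral>x. (\<integral>y. prod x y \<partial>distr M borel Y) \<partial>distr M borel X)"
  proof -
    have "integrable (distr M borel X \<Otimes>\<^sub>M distr M borel Y) (\<lambda>z. prod (fst z) (snd z))"
      unfolding dist using int_prod by (subst integrable_distr_eq) auto
    from XY.integral_fst'[OF this] show ?thesis by simp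
  qed
  also have "\<dots> = (\<integral>x. prod x (integral\<^sup>L M Y) \<partial>distr M borel X)"
  proof (intro Bochner_Integration.integral_cong refl)
    fix x
    have "(\<integral>y. prod x y \<partial>distr M borel Y) = (\<integral>\<omega>. prod x (Y \<omega>) \<partial>M)"
      by (rule integral_distr) (auto intro!: borel_measurable_continuous_onI continuous_on continuous_intros)
    also have "\<dots> = prod x (integral\<^sup>L M Y)"
      by (rule integral_bounded_linear[OF bounded_linear_right int(2)])
    finally show "(\<integral>y. prod x y \<partial>distr M borel Y) = prod x (integral\<^sup>L M Y)" .
  qed
  also have "\<dots> = (\<integral>\<omega>. prod (X \<omega>) (integral\<^sup>L M Y) \<partial>M)"
    by (rule integral_distr) (auto intro!: borel_measurable_continuous_onI continuous_on continuous_intros)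
  also have "\<dots> = prod (integral\<^sup>L M X) (integral\<^sup>L M Y)"
    by (rule integral_bounded_linear[OF bounded_linear_left int(1)])
  finally show "(\<integral>\<omega>. prod (X \<omega>) (Y \<omega>) \<partial>M) = prod (integral\<^sup>L M X) (integral\<^sup>L M Y)" .
qed

text \<open>Negative values become 0 under \<open>ennreal\<close>, so the right side integrates the
  positive part.\<close>

lemma ennreal_integral_le_nn_integral:
  fixes f :: "'w \<Rightarrow> real"
  assumes "integrable M f" shows "ennreal (\<integral>x. f x \<partial>M) \<le> (\<integral>\<^sup>+x. ennreal (f x) \<partial>M)"
proof -
  have "ennreal (\<integral>x. f x \<partial>M) \<le> ennreal (\<integral>x. max 0 (f x) \<partial>M)"
    using assms by (intro ennreal_leI integral_mono) auto
  also have "\<dots> = (\<integral>\<^sup>+x. ennreal (max 0 (f x)) \<partial>M)"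
    using assms by (intro nn_integral_eq_integral[symmetric]) auto
  finally show ?thesis by simp
qed

text \<open>Jensen's inequality through an affine minorant: the norming functional at
  \<open>X\<close> bounds the norm from below, and the tangent of the \<open>q\<close>-th power at
  the norm of \<open>X\<close> does the rest. The right side may be infinite.\<close>

lemma (in prob_space) schatten_norm_centered_perturbation:
  fixes E :: "'a \<Rightarrow> complex ^ 'r ^ 'd"
  assumes p: "2 \<le> p" and q: "1 \<le> q" and E: "integrable M E" "integral\<^sup>L M E = 0"
  shows "ennreal (schatten_norm p X powr q) \<le> (\<integral>\<^sup>+\<omega>. ennreal (schatten_norm p (X + E \<omega>) powr q) \<partial>M)"
proof -
  obtain f :: "complex ^ 'r ^ 'd \<Rightarrow> real" where f: "linear f" "\<And>Z. f Z \<le> schatten_norm p Z" "f X = schatten_norm p X"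
    using schatten_norm_supporting_functional[OF p] by blast
  have bl: "bounded_linear f" using f(1) linear_conv_bounded_linear by blast
  define x where "x = schatten_norm p X"
  define h where "h \<omega> = x powr q + q * x powr (q - 1) * f (E \<omega>)" for \<omega>
  have fE: "integrable M (\<lambda>\<omega>. f (E \<omega>))" using integrable_bounded_linear[OF bl E(1)] .
  have "(\<integral>\<omega>. f (E \<omega>) \<partial>M) = 0"
    using integral_bounded_linear[OF bl E(1)] E(2) linear_0[OF f(1)] by simp
  then have "(\<integral>\<omega>. h \<omega> \<partial>M) = x powr q"
    unfolding h_def using fE by (simp add: prob_space)
  moreover have "integrable M h" unfolding h_def using fE by simp
  ultimately have "ennreal (x powr q) \<le> (\<integral>\<^sup>+\<omega>. ennreal (h \<omega>) \<partial>M)"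
    using ennreal_integral_le_nn_integral[of M h] by simp
  also have "\<dots> \<le> (\<integral>\<^sup>+\<omega>. ennreal (schatten_norm p (X + E \<omega>) powr q) \<partial>M)"
  proof (intro nn_integral_mono ennreal_leI)
    fix \<omega>
    have "f (E \<omega>) \<le> schatten_norm p (X + E \<omega>) - x"
      using f(2)[of "X + E \<omega>"] f(3) linear_add[OF f(1)] unfolding x_def by simp
    then have "h \<omega> \<le> x powr q + q * x powr (q - 1) * (schatten_norm p (X + E \<omega>) - x)"
      unfolding h_def using q by (intro add_left_mono mult_left_mono) auto
    also have "\<dots> \<le> schatten_norm p (X + E \<omega>) powr q"
      using q unfolding x_def by (intro powr_ge_tangent) auto
    finally show "h \<omega> \<le> schatten_norm p (X + E \<omega>) powr q" .
  qed
  finally show ?thesis unfolding x_def .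
qed

text \<open>With \<open>W\<close> frozen by Fubini, \<open>D ** W\<close> is centered, so adding a
  multiple of it to \<open>g W\<close> cannot lower the moment. The function \<open>g\<close> is
  left open so that one step serves both the product and its deviation from the mean.\<close>

lemma (in prob_space) schatten_norm_product_step:
  fixes W :: "'a \<Rightarrow> complex ^ 'r ^ 'd" and D :: "'a \<Rightarrow> complex ^ 'd ^ 'd"
  assumes indep: "indep_pair borel W borel D" and D: "integrable M D" "integral\<^sup>L M D = 0"
    and q: "2 \<le> q" "q \<le> p" and g: "continuous_on UNIV g"
    and int: "integrable M (\<lambda>\<omega>. schatten_norm p (W \<omega>) powr q)"
      "integrable M (\<lambda>\<omega>. schatten_norm p (g (W \<omega>)) powr q)"
      "integrable M (\<lambda>\<omega>. spectral_norm (D \<omega>) powr q)"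
  shows "integrable M (\<lambda>\<omega>. schatten_norm p (g (W \<omega>) + D \<omega> ** W \<omega>) powr q)"
    and "(\<integral>\<omega>. schatten_norm p (g (W \<omega>) + D \<omega> ** W \<omega>) powr q \<partial>M) powr (2 / q)
      \<le> (\<integral>\<omega>. schatten_norm p (g (W \<omega>)) powr q \<partial>M) powr (2 / q)
        + (p - 1) * ((\<integral>\<omega>. spectral_norm (D \<omega>) powr q \<partial>M) powr (2 / q)
          * (\<integral>\<omega>. schatten_norm p (W \<omega>) powr q \<partial>M) powr (2 / q))"
proof -
  have p: "2 \<le> p" using q by simp
  have [measurable]: "g \<in> borel_measurable borel" using g by (rule borel_measurable_continuous_onI)
  have [measurable]: "W \<in> borel_measurable M" "D \<in> borel_measurable M"
    using indep by (auto simp: indep_pair_def)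
  note [measurable] = measurable_schatten_norm[OF p]
  have indep': "indep_var borel (\<lambda>\<omega>. schatten_norm p (W \<omega>) powr q) borel (\<lambda>\<omega>. spectral_norm (D \<omega>) powr q)"
    unfolding indep_pair_iff_indep_var[symmetric] using indep by (rule indep_pair_compose) measurable
  have prod_le: "schatten_norm p (D \<omega> ** W \<omega>) powr q \<le> spectral_norm (D \<omega>) powr q * schatten_norm p (W \<omega>) powr q" for \<omega>
  proof -
    have "schatten_norm p (D \<omega> ** W \<omega>) powr q \<le> (spectral_norm (D \<omega>) * schatten_norm p (W \<omega>)) powr q"
      using q p by (intro powr_mono2 schatten_norm_mult_le) auto
    then show ?thesis by (simp add: powr_mult)
  qed
  have int_prod: "integrable M (\<lambda>\<omega>. spectral_norm (D \<omega>) powr q * schatten_norm p (W \<omega>) powr q)"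
    using indep_var_integrable[OF indep' int(1,3)] by (simp add: mult.commute)
  have int_V: "integrable M (\<lambda>\<omega>. schatten_norm p (D \<omega> ** W \<omega>) powr q)"
    using prod_le by (intro Bochner_Integration.integrable_bound[OF int_prod]) auto
  have min: "(\<integral>\<^sup>+\<omega>. schatten_norm p (g (W \<omega>)) powr q \<partial>M)
      \<le> (\<integral>\<^sup>+\<omega>. schatten_norm p (g (W \<omega>) + t *\<^sub>R (D \<omega> ** W \<omega>)) powr q \<partial>M)" for t
  proof -
    define f where "f z = ennreal (schatten_norm p (g (fst z) + t *\<^sub>R (snd z ** fst z)) powr q)" for z
    have f: "f \<in> borel_measurable (borel \<Otimes>\<^sub>M borel)" unfolding f_def by measurable
    have "(\<integral>\<^sup>+\<omega>. schatten_norm p (g (W \<omega>)) powr q \<partial>M) \<le> (\<integral>\<^sup>+\<omega>'. (\<integral>\<^sup>+\<omega>. f (W \<omega>', D \<omega>) \<partial>M) \<partial>M)"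
    proof (rule nn_integral_mono)
      fix \<omega>'
      have bl: "bounded_linear (\<lambda>X. t *\<^sub>R (X ** W \<omega>'))"
        using bounded_bilinear.bounded_linear_left[OF bounded_bilinear_matrix_mult] 
        by (intro bounded_linear_compose[OF bounded_linear_scaleR_right])
      have "(\<integral>\<omega>. t *\<^sub>R (D \<omega> ** W \<omega>') \<partial>M) = t *\<^sub>R (0 ** W \<omega>')"
        using integral_bounded_linear[OF bl D(1)] unfolding D(2) .
      then have "(\<integral>\<omega>. t *\<^sub>R (D \<omega> ** W \<omega>') \<partial>M) = 0"
        by (simp add: bounded_bilinear.zero_left[OF bounded_bilinear_matrix_mult])
      then show "ennreal (schatten_norm p (g (W \<omega>')) powr q) \<le> (\<integral>\<^sup>+\<omega>. f (W \<omega>', D \<omega>) \<partial>M)"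
        unfolding f_def fst_conv snd_conv using q
        by (intro schatten_norm_centered_perturbation p integrable_bounded_linear[OF bl D(1)]) auto
    qed
    also have "\<dots> = (\<integral>\<^sup>+\<omega>. f (W \<omega>, D \<omega>) \<partial>M)"
      by (rule indep_pair_nn_integral[OF indep f, symmetric])
    finally show ?thesis unfolding f_def by simp
  qed
  have two_point: "((schatten_norm p (x + y) powr p + schatten_norm p (x - y) powr p) / 2) powr (2 / p)
      \<le> (schatten_norm p x)\<^sup>2 + (p - 1) * (schatten_norm p y)\<^sup>2" for x y :: "complex ^ 'r ^ 'd"
    using p by (rule schatten_norm_two_point)
  have meas: "(\<lambda>\<omega>. g (W \<omega>)) \<in> borel_measurable M" "(\<lambda>\<omega>. D \<omega> ** W \<omega>) \<in> borel_measurable M" by measurable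
  have C: "0 \<le> p - 1" using p by simp
  note ineq = two_smooth_moment_inequality[OF schatten_norm_nonneg schatten_norm_triangle[OF p] schatten_norm_scaleR[OF p]
      two_point C q measurable_schatten_norm[OF p] meas int(2) int_V min]
  show "integrable M (\<lambda>\<omega>. schatten_norm p (g (W \<omega>) + D \<omega> ** W \<omega>) powr q)" by (rule ineq(1))
  have "(\<integral>\<omega>. schatten_norm p (D \<omega> ** W \<omega>) powr q \<partial>M)
      \<le> (\<integral>\<omega>. spectral_norm (D \<omega>) powr q * schatten_norm p (W \<omega>) powr q \<partial>M)"
    using int_V int_prod prod_le by (intro integral_mono) auto
  also have "\<dots> = (\<integral>\<omega>. spectral_norm (D \<omega>) powr q \<partial>M) * (\<integral>\<omega>. schatten_norm p (W \<omega>) powr q \<partial>M)"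
    using indep_var_lebesgue_integral[OF indep' int(1,3)] by (simp add: mult.commute)
  finally have "(\<integral>\<omega>. schatten_norm p (D \<omega> ** W \<omega>) powr q \<partial>M) powr (2 / q)
      \<le> ((\<integral>\<omega>. spectral_norm (D \<omega>) powr q \<partial>M) * (\<integral>\<omega>. schatten_norm p (W \<omega>) powr q \<partial>M)) powr (2 / q)"
    using q by (intro powr_mono2) auto
  also have "\<dots> = (\<integral>\<omega>. spectral_norm (D \<omega>) powr q \<partial>M) powr (2 / q) * (\<integral>\<omega>. schatten_norm p (W \<omega>) powr q \<partial>M) powr (2 / q)"
    by (simp add: powr_mult)
  finally show "(\<integral>\<omega>. schatten_norm p (g (W \<omega>) + D \<omega> ** W \<omega>) powr q \<partial>M) powr (2 / q)
      \<le> (\<integral>\<omega>. schatten_norm p (g (W \<omega>)) powr q \<partial>M) powr (2 / q)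
        + (p - 1) * ((\<integral>\<omega>. spectral_norm (D \<omega>) powr q \<partial>M) powr (2 / q)
          * (\<integral>\<omega>. schatten_norm p (W \<omega>) powr q \<partial>M) powr (2 / q))"
    using ineq(2) C by (meson add_left_mono mult_left_mono order_trans)
qed

section \<open>Moments of the product, by induction over its factors\<close>

lemma Lq_norm_eq_integral:
  assumes "integrable P (\<lambda>\<omega>. f \<omega> powr q)"
  shows "Lq_norm P q f = ereal ((\<integral>\<omega>. f \<omega> powr q \<partial>P) powr (1 / q))"
  using assms by (simp add: Lq_norm_def nn_integral_eq_integral)

lemma Lq_norm_le_imp:
  assumes [measurable]: "f \<in> borel_measurable P" and le: "Lq_norm P q f \<le> ereal c"
  shows "integrable P (\<lambda>\<omega>. f \<omega> powr q)" "(\<integral>\<omega>. f \<omega> powr q \<partial>P) powr (1 / q) \<le> c"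
proof -
  have "(\<integral>\<^sup>+\<omega>. ennreal (f \<omega> powr q) \<partial>P) \<noteq> \<infinity>"
    using le by (auto simp: Lq_norm_def Let_def split: if_splits)
  then show int: "integrable P (\<lambda>\<omega>. f \<omega> powr q)" by (intro integrableI_nonneg) (auto simp: less_top)
  show "(\<integral>\<omega>. f \<omega> powr q \<partial>P) powr (1 / q) \<le> c" using le unfolding Lq_norm_eq_integral[OF int] by simp
qed

lemma mat_product_cong:
  "(\<And>i. i \<in> {1..k} \<Longrightarrow> Y i = Y' i) \<Longrightarrow> mat_product Y Z0 k = mat_product Y' Z0 k"
  by (induction k) auto

lemma measurable_mat_product:
  "j \<le> k \<Longrightarrow> (\<lambda>y. mat_product y Z0 j) \<in> borel_measurable (PiM {1..k} (\<lambda>_. borel))"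
proof (induction j)
  case (Suc j)
  have "(\<lambda>y. y (Suc j)) \<in> borel_measurable (PiM {1..k} (\<lambda>_. borel))"
    using Suc by (intro measurable_component_singleton) auto
  with Suc show ?case by simp
qed simp

text \<open>The partial product is a measurable function of the restriction of the family to the
  first \<open>k\<close> indices, which is independent of the restriction to
  \<open>Suc k\<close>.\<close>

lemma (in prob_space) mat_product_indep:
  fixes Y :: "nat \<Rightarrow> 'a \<Rightarrow> complex ^ 'd ^ 'd" and Z0 :: "complex ^ 'r ^ 'd"
  assumes "indep_vars (\<lambda>_. borel) Y {1..n}" "k < n"
  shows "indep_pair borel (\<lambda>\<omega>. mat_product (\<lambda>i. Y i \<omega>) Z0 k) borel (Y (Suc k))"
proof -
  have "indep_var (PiM {1..k} (\<lambda>_. borel)) (\<lambda>\<omega>. restrict (\<lambda>i. Y i \<omega>) {1..k})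
      (PiM {Suc k} (\<lambda>_. borel)) (\<lambda>\<omega>. restrict (\<lambda>i. Y i \<omega>) {Suc k})"
    using assms by (intro indep_var_restrict) auto
  then have "indep_pair borel (\<lambda>\<omega>. mat_product (restrict (\<lambda>i. Y i \<omega>) {1..k}) Z0 k)
      borel (\<lambda>\<omega>. restrict (\<lambda>i. Y i \<omega>) {Suc k} (Suc k))"
    unfolding indep_pair_iff_indep_var[symmetric]
    by (rule indep_pair_compose[where f = "\<lambda>y. mat_product y Z0 k" and g = "\<lambda>y. y (Suc k)"])
       (rule measurable_mat_product[OF order_refl], rule measurable_component_singleton, simp)
  moreover have "mat_product (restrict (\<lambda>i. Y i \<omega>) {1..k}) Z0 k = mat_product (\<lambda>i. Y i \<omega>) Z0 k" for \<omega>
    by (intro mat_product_cong) auto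
  ultimately show ?thesis by simp
qed

lemma schatten_norm_moment_mult_le:
  fixes A :: "complex ^ 'd ^ 'd" and U :: "'w \<Rightarrow> complex ^ 'r ^ 'd"
  assumes A: "spectral_norm A \<le> m" and p: "2 \<le> p" and q: "0 < q"
    and [measurable]: "U \<in> borel_measurable P" and int: "integrable P (\<lambda>\<omega>. schatten_norm p (U \<omega>) powr q)"
  shows "integrable P (\<lambda>\<omega>. schatten_norm p (A ** U \<omega>) powr q)"
    and "(\<integral>\<omega>. schatten_norm p (A ** U \<omega>) powr q \<partial>P) powr (2 / q)
      \<le> m\<^sup>2 * (\<integral>\<omega>. schatten_norm p (U \<omega>) powr q \<partial>P) powr (2 / q)"
proof -
  note [measurable] = measurable_schatten_norm[OF p]
  have m: "0 \<le> m" using A spectral_norm_nonneg[of A] by linarith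
  have le: "schatten_norm p (A ** U \<omega>) powr q \<le> m powr q * schatten_norm p (U \<omega>) powr q" for \<omega>
  proof -
    have "schatten_norm p (A ** U \<omega>) \<le> m * schatten_norm p (U \<omega>)"
      using schatten_norm_mult_le[OF p, of A "U \<omega>"] mult_right_mono[OF A schatten_norm_nonneg[of p "U \<omega>"]] by linarith
    then have "schatten_norm p (A ** U \<omega>) powr q \<le> (m * schatten_norm p (U \<omega>)) powr q"
      using q by (intro powr_mono2) auto
    then show ?thesis using m by (simp add: powr_mult)
  qed
  show int': "integrable P (\<lambda>\<omega>. schatten_norm p (A ** U \<omega>) powr q)"
    using le by (intro Bochner_Integration.integrable_bound[OF integrable_mult_right[OF int, of "m powr q"]]) auto
  have "(\<integral>\<omega>. schatten_norm p (A ** U \<omega>) powr q \<partial>P) \<le> (\<integral>\<omega>. m powr q * schatten_norm p (U \<omega>) powr q \<partial>P)"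
    using int int' le by (intro integral_mono) auto
  then have "(\<integral>\<omega>. schatten_norm p (A ** U \<omega>) powr q \<partial>P) powr (2 / q)
      \<le> (m powr q * (\<integral>\<omega>. schatten_norm p (U \<omega>) powr q \<partial>P)) powr (2 / q)"
    using q by (intro powr_mono2) auto
  also have "\<dots> = m\<^sup>2 * (\<integral>\<omega>. schatten_norm p (U \<omega>) powr q \<partial>P) powr (2 / q)"
    using m q by (simp add: powr_mult powr_powr)
  finally show "(\<integral>\<omega>. schatten_norm p (A ** U \<omega>) powr q \<partial>P) powr (2 / q)
      \<le> m\<^sup>2 * (\<integral>\<omega>. schatten_norm p (U \<omega>) powr q \<partial>P) powr (2 / q)" .
qed

text \<open>Both bounds are proved together because the fluctuation term in the centered recursion
  involves the uncentered moment \<open>x\<close>. The recursions are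
  \<open>x \<mapsto> s\<^sup>2 * (1 + C * \<sigma>\<^sup>2) * x\<close> and
  \<open>x' \<mapsto> s\<^sup>2 * (x' + C * \<sigma>\<^sup>2 * x)\<close>, and the factor
  \<open>1 + C * \<sigma>\<^sup>2\<close> is absorbed into the exponential.\<close>

lemma (in prob_space) mat_product_moments:
  fixes Y :: "nat \<Rightarrow> 'a \<Rightarrow> complex ^ 'd ^ 'd" and Z0 :: "complex ^ 'r ^ 'd"
  assumes indep: "indep_vars (\<lambda>_. borel) Y {1..n}"
    and Y_int: "\<And>i. i \<in> {1..n} \<Longrightarrow> integrable M (Y i)"
    and q: "2 \<le> q" "q \<le> p"
    and mean: "\<And>i. i \<in> {1..n} \<Longrightarrow> spectral_norm (integral\<^sup>L M (Y i)) \<le> m i"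
    and fluct: "\<And>i. i \<in> {1..n} \<Longrightarrow>
      Lq_norm M q (\<lambda>\<omega>. spectral_norm (Y i \<omega> - integral\<^sup>L M (Y i))) \<le> ereal (\<sigma> i * m i)"
  defines "W \<equiv> \<lambda>k \<omega>. mat_product (\<lambda>i. Y i \<omega>) Z0 k"
  defines "c \<equiv> \<lambda>k. (schatten_norm p Z0)\<^sup>2 * (\<Prod>i=1..k. m i)\<^sup>2"
    and "e \<equiv> \<lambda>k. exp ((p - 1) * (\<Sum>i=1..k. (\<sigma> i)\<^sup>2))"
  assumes k: "k \<le> n"
  shows "integrable M (W k)
    \<and> integrable M (\<lambda>\<omega>. schatten_norm p (W k \<omega>) powr q)
    \<and> (\<integral>\<omega>. schatten_norm p (W k \<omega>) powr q \<partial>M) powr (2 / q) \<le> e k * c k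
    \<and> integrable M (\<lambda>\<omega>. schatten_norm p (W k \<omega> - integral\<^sup>L M (W k)) powr q)
    \<and> (\<integral>\<omega>. schatten_norm p (W k \<omega> - integral\<^sup>L M (W k)) powr q \<partial>M) powr (2 / q) \<le> (e k - 1) * c k"
  using k
proof (induction k)
  case 0
  have W: "W 0 = (\<lambda>_. Z0)" unfolding W_def by simp
  have "schatten_norm p (0 :: complex ^ 'r ^ 'd) = 0"
    using schatten_norm_scaleR[of p 0 "0 :: complex ^ 'r ^ 'd"] q by simp
  then show ?case
    unfolding W c_def e_def using q by (simp add: prob_space powr_powr)
next
  case (Suc k)
  define A where "A = integral\<^sup>L M (Y (Suc k))"
  define D where "D \<omega> = Y (Suc k) \<omega> - A" for \<omega>
  define E where "E = integral\<^sup>L M (W k)"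
  define x where "x = (\<integral>\<omega>. schatten_norm p (W k \<omega>) powr q \<partial>M) powr (2 / q)"
  define x' where "x' = (\<integral>\<omega>. schatten_norm p (W k \<omega> - E) powr q \<partial>M) powr (2 / q)"
  define d where "d = (\<integral>\<omega>. spectral_norm (D \<omega>) powr q \<partial>M) powr (2 / q)"
  define s where "s = m (Suc k)"
  define C where "C = p - 1"
  have p: "2 \<le> p" and C: "0 \<le> C" using q unfolding C_def by auto
  have i: "Suc k \<in> {1..n}" using Suc.prems by auto
  have IH: "integrable M (W k)" "integrable M (\<lambda>\<omega>. schatten_norm p (W k \<omega>) powr q)" "x \<le> e k * c k"
    "integrable M (\<lambda>\<omega>. schatten_norm p (W k \<omega> - E) powr q)" "x' \<le> (e k - 1) * c k"
    using Suc unfolding x_def x'_def E_def by auto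
  have A: "spectral_norm A \<le> s" unfolding A_def s_def using mean i by blast
  have W_Suc: "W (Suc k) \<omega> = Y (Suc k) \<omega> ** W k \<omega>" for \<omega> unfolding W_def by simp
  have indep_Y: "indep_pair borel (W k) borel (Y (Suc k))"
    unfolding W_def using Suc.prems by (intro mat_product_indep[OF indep]) auto
  have indep_D: "indep_pair borel (W k) borel D"
    unfolding D_def using indep_pair_compose[OF indep_Y measurable_ident, of "\<lambda>y. y - A" borel] by simp
  have D: "integrable M D" "integral\<^sup>L M D = 0"
    unfolding D_def using Y_int[OF i] by (simp_all add: prob_space A_def)
  have [measurable]: "D \<in> borel_measurable M" "W k \<in> borel_measurable M" using D IH(1) by auto
  have D_Lq: "Lq_norm M q (\<lambda>\<omega>. spectral_norm (D \<omega>)) \<le> ereal (\<sigma> (Suc k) * s)"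
    unfolding D_def A_def s_def by (rule fluct[OF i])
  have D_int: "integrable M (\<lambda>\<omega>. spectral_norm (D \<omega>) powr q)"
    using D_Lq by (intro Lq_norm_le_imp(1)) measurable
  have "(\<integral>\<omega>. spectral_norm (D \<omega>) powr q \<partial>M) powr (1 / q) \<le> \<sigma> (Suc k) * s"
    using D_Lq by (intro Lq_norm_le_imp(2)) measurable
  then have "((\<integral>\<omega>. spectral_norm (D \<omega>) powr q \<partial>M) powr (1 / q))\<^sup>2 \<le> (\<sigma> (Suc k) * s)\<^sup>2"
    by (intro power_mono) auto
  moreover have "((\<integral>\<omega>. spectral_norm (D \<omega>) powr q \<partial>M) powr (1 / q))\<^sup>2 = d"
    unfolding d_def by (simp add: powr_powr flip: powr_numeral)
  ultimately have d: "d \<le> (\<sigma> (Suc k))\<^sup>2 * s\<^sup>2" by (simp add: power_mult_distrib)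
  have x_nonneg: "0 \<le> x" unfolding x_def by simp
  have Cdx: "C * (d * x) \<le> C * ((\<sigma> (Suc k))\<^sup>2 * s\<^sup>2 * x)"
    using d x_nonneg C by (intro mult_left_mono mult_right_mono) auto
  have c_Suc: "c (Suc k) = s\<^sup>2 * c k" unfolding c_def s_def by (simp add: power_mult_distrib)
  have c_nonneg: "0 \<le> c k" unfolding c_def by simp
  have e_Suc: "(1 + C * (\<sigma> (Suc k))\<^sup>2) * e k \<le> e (Suc k)"
  proof -
    have "(1 + C * (\<sigma> (Suc k))\<^sup>2) * e k \<le> exp (C * (\<sigma> (Suc k))\<^sup>2) * e k"
      unfolding e_def by (intro mult_right_mono exp_ge_add_one_self) auto
    also have "\<dots> = e (Suc k)" unfolding e_def C_def by (simp add: algebra_simps flip: exp_add)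
    finally show ?thesis .
  qed
  have cont: "continuous_on UNIV (\<lambda>w. A ** (w - B))" for B :: "complex ^ 'r ^ 'd"
    by (intro bounded_bilinear.continuous_on[OF bounded_bilinear_matrix_mult] continuous_intros)
  have "bounded_bilinear (\<lambda>(w :: complex ^ 'r ^ 'd) (y :: complex ^ 'd ^ 'd). y ** w)"
    using bounded_bilinear.flip[OF bounded_bilinear_matrix_mult] .
  note EW = indep_pair_bounded_bilinear[OF this indep_Y IH(1) Y_int[OF i], folded W_Suc, folded A_def E_def]
  \<comment> \<open>The vanishing shift puts this in the form \<open>A ** (w - B)\<close>, shared
    with the centered case where \<open>B = E\<close>.\<close>
  have split1: "W (Suc k) \<omega> = A ** (W k \<omega> - 0) + D \<omega> ** W k \<omega>" for \<omega>
    unfolding W_Suc D_def by (simp flip: bounded_bilinear.add_left[OF bounded_bilinear_matrix_mult])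
  have split2: "W (Suc k) \<omega> - integral\<^sup>L M (W (Suc k)) = A ** (W k \<omega> - E) + D \<omega> ** W k \<omega>" for \<omega>
    unfolding EW(2) W_Suc D_def
    by (simp add: bounded_bilinear.diff_left[OF bounded_bilinear_matrix_mult] bounded_bilinear.diff_right[OF bounded_bilinear_matrix_mult])
  have WE: "(\<lambda>\<omega>. W k \<omega> - B) \<in> borel_measurable M" for B by measurable
  have int0: "integrable M (\<lambda>\<omega>. schatten_norm p (W k \<omega> - 0) powr q)" using IH(2) by simp
  have q0: "0 < q" using q by simp
  note AW = schatten_norm_moment_mult_le[OF A p q0 WE int0]
  note AWE = schatten_norm_moment_mult_le[OF A p q0 WE IH(4)]
  note step1 = schatten_norm_product_step[OF indep_D D q cont IH(2) AW(1) D_int, folded split1]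
  note step2 = schatten_norm_product_step[OF indep_D D q cont IH(2) AWE(1) D_int, folded split2]
  have "(\<integral>\<omega>. schatten_norm p (W (Suc k) \<omega>) powr q \<partial>M) powr (2 / q) \<le> s\<^sup>2 * x + C * (d * x)"
    using step1(2) AW(2) unfolding x_def d_def C_def by simp
  also have "\<dots> \<le> s\<^sup>2 * ((1 + C * (\<sigma> (Suc k))\<^sup>2) * x)" using Cdx by (simp add: algebra_simps)
  also have "\<dots> \<le> s\<^sup>2 * ((1 + C * (\<sigma> (Suc k))\<^sup>2) * (e k * c k))"
    using IH(3) C by (intro mult_left_mono) auto
  also have "\<dots> \<le> s\<^sup>2 * (e (Suc k) * c k)"
    using mult_left_mono[OF mult_right_mono[OF e_Suc c_nonneg], of "s\<^sup>2"] by (simp add: mult.assoc)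
  finally have bound1: "(\<integral>\<omega>. schatten_norm p (W (Suc k) \<omega>) powr q \<partial>M) powr (2 / q) \<le> e (Suc k) * c (Suc k)"
    unfolding c_Suc by (simp add: mult_ac)
  have "(\<integral>\<omega>. schatten_norm p (W (Suc k) \<omega> - integral\<^sup>L M (W (Suc k))) powr q \<partial>M) powr (2 / q) \<le> s\<^sup>2 * x' + C * (d * x)"
    using step2(2) AWE(2) unfolding x_def x'_def d_def C_def by simp
  also have "\<dots> \<le> s\<^sup>2 * (x' + C * (\<sigma> (Suc k))\<^sup>2 * x)" using Cdx by (simp add: algebra_simps)
  also have "\<dots> \<le> s\<^sup>2 * ((e k - 1) * c k + C * (\<sigma> (Suc k))\<^sup>2 * (e k * c k))"
    using IH(3,5) C by (intro mult_left_mono add_mono) auto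
  \<comment> \<open>Here \<open>e k - 1\<close> and the new term combine to
    \<open>(1 + C * \<sigma>\<^sup>2) * e k - 1\<close>, so the shape \<open>e - 1\<close>
    reproduces itself.\<close>
  also have "\<dots> = s\<^sup>2 * (((1 + C * (\<sigma> (Suc k))\<^sup>2) * e k - 1) * c k)" by (simp add: algebra_simps)
  also have "\<dots> \<le> s\<^sup>2 * ((e (Suc k) - 1) * c k)"
    using e_Suc c_nonneg by (intro mult_left_mono mult_right_mono) auto
  finally have bound2: "(\<integral>\<omega>. schatten_norm p (W (Suc k) \<omega> - integral\<^sup>L M (W (Suc k))) powr q \<partial>M) powr (2 / q)
      \<le> (e (Suc k) - 1) * c (Suc k)"
    unfolding c_Suc by (simp add: mult_ac)
  show ?case using EW(1) step1(1) step2(1) bound1 bound2 by blast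
qed

theorem theorem5p1:
  fixes P :: "'w measure"
    and Y :: "nat \<Rightarrow> 'w \<Rightarrow> complex ^ 'd ^ 'd"
    and Z0 :: "complex ^ 'r ^ 'd"
    and Z :: "'w \<Rightarrow> complex ^ 'r ^ 'd"
    and n :: nat
    and p q M v C :: real
    and m \<sigma> :: "nat \<Rightarrow> real"
  assumes "prob_space P"
    and "prob_space.indep_vars P (\<lambda>_. borel) Y {1..n}"
    and "\<And>i. i \<in> {1..n} \<Longrightarrow> integrable P (Y i)"
    and "2 \<le> q" and "q \<le> p"
    and "\<And>i. i \<in> {1..n} \<Longrightarrow> spectral_norm (integral\<^sup>L P (Y i)) \<le> m i"
    and "\<And>i. i \<in> {1..n} \<Longrightarrow>
           Lq_norm P q (\<lambda>\<omega>. spectral_norm (Y i \<omega> - integral\<^sup>L P (Y i))) \<le> ereal (\<sigma> i * m i)"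
    and "Z = (\<lambda>\<omega>. mat_product (\<lambda>i. Y i \<omega>) Z0 n)"
    and "M = (\<Prod>i=1..n. m i)"
    and "v = (\<Sum>i=1..n. (\<sigma> i)\<^sup>2)"
    and "C = p - 1"
  shows "mixed_norm P p q Z \<le> ereal (exp (C * v / 2) * schatten_norm p Z0 * M)
    \<and> mixed_norm P p q (\<lambda>\<omega>. Z \<omega> - integral\<^sup>L P Z)
           \<le> ereal (sqrt (exp (C * v) - 1) * schatten_norm p Z0 * M)"
proof -
  interpret prob_space P by fact
  define S where "S = schatten_norm p Z0"
  note moments = mat_product_moments[OF assms(2-7) order_refl, folded assms(9-11) S_def]
  have "0 \<le> m i" if "i \<in> {1..n}" for i
    using assms(6)[OF that] spectral_norm_nonneg[of "integral\<^sup>L P (Y i)"] by linarith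
  then have M: "0 \<le> M" unfolding assms(9) by (intro prod_nonneg) auto
  have S: "0 \<le> S" unfolding S_def by simp
  \<comment> \<open>The moment bounds concern squared norms; taking roots yields \<open>S\<close>
    and \<open>M\<close> themselves because both are nonnegative.\<close>
  have mixed: "mixed_norm P p q U \<le> ereal (sqrt b * S * M)"
    if U: "integrable P (\<lambda>\<omega>. schatten_norm p (U \<omega>) powr q)"
      and le: "(\<integral>\<omega>. schatten_norm p (U \<omega>) powr q \<partial>P) powr (2 / q) \<le> b * (S\<^sup>2 * M\<^sup>2)"
    for b and U :: "'w \<Rightarrow> complex ^ 'r ^ 'd"
  proof -
    define I where "I = (\<integral>\<omega>. schatten_norm p (U \<omega>) powr q \<partial>P)"
    have "I powr (1 / q) = sqrt ((I powr (1 / q))\<^sup>2)" by simp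
    also have "(I powr (1 / q))\<^sup>2 = I powr (2 / q)" by (simp add: powr_powr flip: powr_numeral)
    also have "sqrt \<dots> \<le> sqrt (b * (S\<^sup>2 * M\<^sup>2))" using le unfolding I_def by (rule real_sqrt_le_mono)
    also have "\<dots> = sqrt b * S * M" using S M by (simp add: real_sqrt_mult)
    finally show ?thesis
      unfolding mixed_norm_def Lq_norm_eq_integral[OF U] I_def[symmetric] by simp
  qed
  have "sqrt (exp (C * v)) = exp (C * v / 2)"
    by (rule real_sqrt_unique) (simp_all add: power2_eq_square flip: exp_add)
  then show ?thesis
    using mixed[of Z "exp (C * v)"] mixed[of "\<lambda>\<omega>. Z \<omega> - integral\<^sup>L P Z" "exp (C * v) - 1"] moments
    unfolding S_def assms(8) by auto
qed

end
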